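(* Let $G$ be a non-cyclic finite group of order $n$, let $q$ be the smallest prime divisor of $n$, and let $\phi$ be Euler's function. Then (a) $\rho(G)\le q^{-\phi(n)}\rho(\mathbb{Z}_n)$; (b) $\psi(G)\le\psi(\mathbb{Z}_n)-n\phi(n)(q-1)/q$. In each of (a) and (b), equality holds if and only if either $G\cong\mathbb{Z}_q\times\mathbb{Z}_q$ or $G$ is the quaternion group of order $8$.
   Context: $\mathbb{Z}_n$ is the cyclic group of order $n$. For a finite group $G$, with $o(g)$ denoting the order of $g\in G$, $\psi(G)=\sum_{g\in G}o(g)$ and $\rho(G)=\prod_{g\in G}o(g)$. *)

theory Defs
  imports
    "HOL-Algebra.Elementary_Groups"
    "HOL-Algebra.Multiplicative_Group"
    "HOL-Number_Theory.Totient"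
begin

definition order_sum :: "('a, 'b) monoid_scheme \<Rightarrow> nat" where
  "order_sum G = (\<Sum>g\<in>carrier G. group.ord G g)"

definition order_prod :: "('a, 'b) monoid_scheme \<Rightarrow> nat" where
  "order_prod G = (\<Prod>g\<in>carrier G. group.ord G g)"

(* The tuple (a, b, c, d) stands for the integral quaternion a + b i + c j + d k. *)
fun hamilton_mult ::
  "int \<times> int \<times> int \<times> int \<Rightarrow> int \<times> int \<times> int \<times> int \<Rightarrow> int \<times> int \<times> int \<times> int" where
  "hamilton_mult (a1, b1, c1, d1) (a2, b2, c2, d2) =
    (a1 * a2 - b1 * b2 - c1 * c2 - d1 * d2,
     a1 * b2 + b1 * a2 + c1 * d2 - d1 * c2,
     a1 * c2 - b1 * d2 + c1 * a2 + d1 * b2,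
     a1 * d2 + b1 * c2 - c1 * b2 + d1 * a2)"

definition quaternion_group :: "(int \<times> int \<times> int \<times> int) monoid" where
  "quaternion_group =
    \<lparr>carrier =
       {(1, 0, 0, 0), (-1, 0, 0, 0), (0, 1, 0, 0), (0, -1, 0, 0),
        (0, 0, 1, 0), (0, 0, -1, 0), (0, 0, 0, 1), (0, 0, 0, -1)},
     monoid.mult = hamilton_mult,
     one = (1, 0, 0, 0)\<rparr>"

lemma group_quaternion_group: "group quaternion_group"
proof (rule groupI)
  fix x assume "x \<in> carrier quaternion_group"
  then show "\<exists>y\<in>carrier quaternion_group.
      y \<otimes>\<^bsub>quaternion_group\<^esub> x = \<one>\<^bsub>quaternion_group\<^esub>"
    by (auto simp: quaternion_group_def)
next
  fix x y z
  show "x \<otimes>\<^bsub>quaternion_group\<^esub> y \<otimes>\<^bsub>quaternion_group\<^esub> z =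
      x \<otimes>\<^bsub>quaternion_group\<^esub> (y \<otimes>\<^bsub>quaternion_group\<^esub> z)"
    by (cases x; cases y; cases z) (simp add: quaternion_group_def algebra_simps)
qed (auto simp: quaternion_group_def)

lemma order_quaternion_group: "order quaternion_group = 8"
  by (simp add: order_def quaternion_group_def)

end

theory Submission
  imports Defs "HOL-Algebra.Sylow"
begin

text \<open>
Let S_f(G) be the sum of f(o(x)) over the elements x of G. For f = id this is \<psi>(G), for f = ln it is the
logarithm of \<rho>(G). On the cyclic group of order n it is the sum of \<phi>(d) f(d) over the divisors d of n. For a
noncyclic group G of order n both parts of the theorem say that S_f(G) is at most S_f of the cyclic group minus
\<phi>(n) (f(n) - f(n/q)): the \<phi>(n) generators are replaced by elements of order at most n/q.

Two cases are treated alike for every increasing f. If n is a power of p, summation by parts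
(\<open>ord_sum_prime_power_group\<close>) writes S_f(G) as a constant minus a positive combination of the numbers of solutions of
x^(p^i) = 1 with p^i less than n/p. By Frobenius' theorem (\<open>frobenius_solutions\<close>) each is at least p^i, the number for the
cyclic group. Equality means that all of them equal p^i, and a computation with commutators then leaves only
the two groups in the statement (\<open>iso_elementary_abelian_or_quaternion\<close>). If G has a normal cyclic Sylow subgroup P for a
prime p > q, then in each coset of P either all elements have the same order as the coset, or the orders are
those in P multiplied by the order of the coset (\<open>coset_dichotomy\<close>). So S_f(G) is controlled by the quotient G/P, and
induction yields a strict inequality (\<open>ord_sum_less\<close>).

It remains to show that for n not a prime power the strict inequality holds outright unless the Sylow
subgroup for the largest prime divisor P of n is normal and cyclic. Here the two functions need different arguments.
For f = id, if all orders are at most n/P, then S_f(G) is at most n^2/P, which is smaller than the bound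
(\<open>square_over_largest_prime_less\<close>); otherwise a cyclic subgroup of index less than P contains all elements of P-power
order (\<open>card_torsion_of_small_index\<close>). For f = ln, factorizing the orders expresses S_f(G) through the numbers of solutions
of x^(n/r^k) = 1. If some Sylow subgroup is not cyclic, a single one of these numbers already gives the strict
inequality (\<open>ord_sum_ln_less_if_sylow_noncyclic\<close>). If all are cyclic, then Frobenius' theorem shows, for one
prime after the other in increasing order, that the number of solutions of x^d = 1 is exactly d when d is the part of n
made up of the remaining primes, until d is the full power of P (\<open>card_torsion_top_part\<close>).
\<close>

section \<open>Commuting elements of coprime orders\<close>

definition torsion :: "('a, 'b) monoid_scheme \<Rightarrow> nat \<Rightarrow> 'a set" where
  "torsion G d = {x \<in> carrier G. x [^]\<^bsub>G\<^esub> d = \<one>\<^bsub>G\<^esub>}"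

lemma prime_power_part_coprime:
  fixes p a s :: nat
  assumes "prime p" "\<not> p dvd s" shows "coprime (p ^ a) s"
  using assms by (simp add: prime_imp_coprime)

lemma prime_power_decomposition:
  fixes p n :: nat
  assumes "prime p" "n > 0"
  obtains m where "n = p ^ multiplicity p n * m" "\<not> p dvd m" "m > 0"
proof -
  obtain m where m: "n = p ^ multiplicity p n * m" "\<not> p dvd m"
    using multiplicity_decompose'[of n p] assms by (metis not_prime_unit less_irrefl)
  then show ?thesis using that[of m] by (metis dvd_0_right not_gr0)
qed

lemma exists_idempotent_exponent:
  fixes a b :: nat
  assumes "coprime a b"
  obtains e where "[e = 1] (mod a)" "[e = 0] (mod b)"
  using binary_chinese_remainder_nat[OF assms, of 1 0] by blast

context group
begin

lemma in_torsion_iff: "x \<in> torsion G d \<longleftrightarrow> x \<in> carrier G \<and> ord x dvd d"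
  by (auto simp: torsion_def pow_eq_id)

lemma torsion_subset: "torsion G d \<subseteq> carrier G"
  by (auto simp: torsion_def)

lemma pow_cong:
  assumes x: "x \<in> carrier G" and "[m = n] (mod d)" and "ord x dvd d"
  shows "x [^] (m :: nat) = x [^] n"
proof -
  have "[m = n] (mod ord x)"
    using assms(2,3) by (rule cong_dvd_modulus_nat)
  then have "int (ord x) dvd int n - int m"
    by (simp add: cong_int_iff[symmetric] cong_iff_dvd_diff dvd_diff_commute)
  then show ?thesis
    using int_pow_eq[OF x, of "int m" "int n"] by (simp add: int_pow_int)
qed

lemma commute_pow:
  assumes "x \<in> carrier G" "y \<in> carrier G" "x \<otimes> y = y \<otimes> x"
  shows "x [^] (n::nat) \<otimes> y = y \<otimes> x [^] n"
  using assms by (metis group_commutes_pow)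

text \<open>With e = 1 modulo a and e = 0 modulo b, raising a product of commuting factors to
the power e extracts the first factor.\<close>
lemma coprime_parts_unique:
  fixes a b :: nat
  assumes cop: "coprime a b"
    and v: "v \<in> torsion G a" "v' \<in> torsion G a"
    and y: "y \<in> torsion G b" "y' \<in> torsion G b"
    and com: "v \<otimes> y = y \<otimes> v" "v' \<otimes> y' = y' \<otimes> v'"
    and eq: "v \<otimes> y = v' \<otimes> y'"
  shows "v = v' \<and> y = y'"
proof -
  obtain e where e: "[e = 1] (mod a)" "[e = 0] (mod b)"
    using exists_idempotent_exponent[OF cop] .
  have first: "(w \<otimes> z) [^] e = w" if "w \<in> torsion G a" "z \<in> torsion G b" "w \<otimes> z = z \<otimes> w" for w z
  proof -
    have w: "w \<in> carrier G" "ord w dvd a" and z: "z \<in> carrier G" "ord z dvd b"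
      using that by (auto simp: in_torsion_iff)
    have "(w \<otimes> z) [^] e = w [^] e \<otimes> z [^] e"
      using w z that by (intro pow_mult_distrib) auto
    also have "\<dots> = w [^] (1::nat) \<otimes> z [^] (0::nat)"
      using pow_cong[OF w(1) e(1) w(2)] pow_cong[OF z(1) e(2) z(2)] by simp
    finally show ?thesis using w by simp
  qed
  have vv: "v = v'"
    using first[OF v(1) y(1) com(1)] first[OF v(2) y(2) com(2)] eq by simp
  moreover have "y = y'"
  proof -
    have "v \<otimes> y = v \<otimes> y'" using eq unfolding vv .
    then show ?thesis
      using Units_l_cancel[of v y y'] v(1) y by (auto simp: in_torsion_iff)
  qed
  ultimately show ?thesis by simp
qed

text \<open>Both parts are powers of x. In particular every element that commutes with x
commutes with them.\<close>
lemma coprime_parts: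
  fixes a b :: nat
  assumes cop: "coprime a b" and x: "x \<in> torsion G (a * b)"
  obtains i j :: nat where "x = x [^] i \<otimes> x [^] j" "x [^] i \<in> torsion G a" "x [^] j \<in> torsion G b"
proof -
  have xc: "x \<in> carrier G" and ox: "ord x dvd a * b"
    using x by (auto simp: in_torsion_iff)
  obtain i where i: "[i = 1] (mod a)" "[i = 0] (mod b)"
    using exists_idempotent_exponent[OF cop] .
  obtain j where j: "[j = 1] (mod b)" "[j = 0] (mod a)"
    using exists_idempotent_exponent[of b a] cop by (auto simp: coprime_commute)
  have "[i + j = 1 + 0] (mod a)" "[i + j = 0 + 1] (mod b)"
    using i j by (blast intro: cong_add)+
  then have "[i + j = 1] (mod a * b)"
    using cop by (simp add: coprime_cong_mult_nat)
  from pow_cong[OF xc this ox] have "x = x [^] i \<otimes> x [^] j"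
    using xc by (simp add: nat_pow_mult)
  moreover have "b dvd i" "a dvd j"
    using i j by (simp_all add: cong_0_iff)
  then have "a * b dvd i * a" "a * b dvd j * b"
    by (simp_all add: mult_dvd_mono mult.commute)
  then have "x [^] (i * a) = \<one>" "x [^] (j * b) = \<one>"
    using dvd_trans[OF ox] xc by (simp_all add: pow_eq_id)
  then have "(x [^] i) [^] a = \<one>" "(x [^] j) [^] b = \<one>"
    using xc by (simp_all add: nat_pow_pow)
  ultimately show ?thesis
    using that xc by (auto simp: torsion_def)
qed

lemma ord_mult_coprime:
  assumes x: "x \<in> carrier G" and y: "y \<in> carrier G" and com: "x \<otimes> y = y \<otimes> x"
    and cop: "coprime (ord x) (ord y)"
  shows "ord (x \<otimes> y) = ord x * ord y"
proof -
  have "(x \<otimes> y) [^] n = \<one> \<longleftrightarrow> ord x * ord y dvd n" for n :: nat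
  proof
    assume "(x \<otimes> y) [^] n = \<one>"
    then have *: "x [^] n \<otimes> y [^] n = \<one>"
      using pow_mult_distrib[OF com x y, of n] by simp
    have c: "x [^] n \<otimes> y [^] n = y [^] n \<otimes> x [^] n"
      by (rule commute_pow) (use x y commute_pow[OF y x com[symmetric], of n] in auto)
    have pow_torsion: "z [^] n \<in> torsion G (ord z)" "\<one> \<in> torsion G (ord z)" if "z \<in> carrier G" for z
      using that by (simp_all add: torsion_def nat_pow_pow pow_eq_id)
    have "x [^] n \<otimes> y [^] n = \<one> \<otimes> \<one>"
      using * by simp
    then have "x [^] n = \<one> \<and> y [^] n = \<one>"
      by (intro coprime_parts_unique[OF cop] pow_torsion x y c refl)
    then show "ord x * ord y dvd n"
      using x y cop by (simp add: pow_eq_id divides_mult)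
  next
    assume "ord x * ord y dvd n"
    then have "ord x dvd n" "ord y dvd n"
      using dvd_mult_left dvd_mult_right by blast+
    then show "(x \<otimes> y) [^] n = \<one>"
      using x y com by (simp add: pow_mult_distrib pow_eq_id[symmetric])
  qed
  then show ?thesis
    using x y by (simp add: ord_unique)
qed

end

lemma (in group) ord_pow_coprime:
  assumes "finite (carrier G)" "x \<in> carrier G" "coprime k (ord x)"
  shows "ord (x [^] (k::nat)) = ord x"
  using pow_ord_eq_ord_iff assms by blast

lemma (in group) exists_element_of_ord:
  assumes "finite (carrier G)" "x \<in> carrier G" "e dvd ord x"
  obtains y where "y \<in> carrier G" "ord y = e"
proof -
  obtain k where k: "ord x = e * k" using assms(3) by blast
  then have "k > 0" using ord_ge_1[OF assms(1,2)] by (cases k) auto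
  then have "ord (x [^] k) = e" using ord_pow[OF assms(2), of k] k by simp
  then show ?thesis using that[of "x [^] k"] assms(2) by simp
qed

text \<open>For r dividing the group order the hypothesis expresses that the order of x has
full r-part. Some x satisfies it for r exactly if the Sylow r-subgroups are cyclic.\<close>
lemma (in group) full_prime_power_dvd_ord:
  assumes fin: "finite (carrier G)" and r: "prime r"
    and x: "x \<in> carrier G" "\<not> ord x dvd order G div r"
  shows "r ^ multiplicity r (order G) dvd ord x"
proof -
  have n0: "order G > 0" using fin by (simp add: order_gt_0_iff_finite)
  obtain i where i: "order G = ord x * i" using ord_dvd_group_order[OF x(1)] by blast
  have "\<not> r dvd i"
  proof
    assume "r dvd i"
    then obtain j where "i = r * j" by blast
    then have "order G div r = ord x * j" using i prime_gt_0_nat[OF r] by simp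
    then show False using x(2) by simp
  qed
  then have "coprime (r ^ multiplicity r (order G)) i" by (rule prime_power_part_coprime[OF r])
  moreover have "r ^ multiplicity r (order G) dvd ord x * i" unfolding i[symmetric] by (rule multiplicity_dvd)
  ultimately show ?thesis by (simp add: coprime_dvd_mult_left_iff)
qed

lemma (in group) card_coprime_powers:
  assumes fin: "finite (carrier G)" and x: "x \<in> carrier G"
  shows "card ((\<lambda>k. x [^] k) ` {k \<in> {1..ord x}. coprime k (ord x)}) = totient (ord x)"
proof -
  have "inj_on (\<lambda>k. x [^] k) {k \<in> {1..ord x}. coprime k (ord x)}"
    using ord_inj'[OF x] by (rule inj_on_subset) auto
  moreover have "{k \<in> {1..ord x}. coprime k (ord x)} = totatives (ord x)"
    by (auto simp: totatives_def)
  ultimately show ?thesis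
    by (simp add: card_image totient_def)
qed

text \<open>A set that contains with x every generator of the cyclic group of x is a disjoint
union of such generator sets, and these have phi(o(x)) elements.\<close>
lemma (in group) totient_dvd_card:
  assumes fin: "finite (carrier G)" and sub: "S \<subseteq> carrier G"
    and closed: "\<And>x k. x \<in> S \<Longrightarrow> coprime k (ord x) \<Longrightarrow> x [^] (k::nat) \<in> S"
    and t: "\<And>x. x \<in> S \<Longrightarrow> t dvd totient (ord x)"
  shows "t dvd card S"
proof -
  define cls where "cls x = (\<lambda>k::nat. x [^] k) ` {k \<in> {1..ord x}. coprime k (ord x)}" for x
  have self: "x \<in> cls x" if "x \<in> S" for x
  proof (cases "ord x = 1")
    case True
    then show ?thesis using that sub by (force simp: cls_def)
  next
    case False
    with that sub ord_ge_1[OF fin, of x] have "1 \<le> ord x" by auto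
    then show ?thesis using that sub unfolding cls_def by (intro image_eqI[of _ _ 1]) auto
  qed
  have cls_alt: "cls x = {x [^] k | k::nat. coprime k (ord x)}" if "x \<in> S" for x
  proof -
    have xc: "x \<in> carrier G" using that sub by auto
    have pos: "ord x \<ge> 1" using ord_ge_1[OF fin xc] .
    have "x [^] k \<in> cls x" if k: "coprime k (ord x)" for k :: nat
    proof (cases "ord x = 1")
      case True
      then have "x = \<one>" using xc ord_eq_1 by blast
      then show ?thesis using self[OF \<open>x \<in> S\<close>] by simp
    next
      case False
      have "coprime (k mod ord x) (ord x)"
        using k pos by (subst coprime_mod_left_iff) auto
      moreover from this False have "k mod ord x \<noteq> 0" by (intro notI) simp
      moreover have "x [^] k = x [^] (k mod ord x)"
        by (rule pow_cong[OF xc, of _ _ "ord x"]) auto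
      moreover have "k mod ord x \<le> ord x" using pos by (simp add: less_imp_le)
      ultimately show ?thesis unfolding cls_def by (intro image_eqI[of _ _ "k mod ord x"]) auto
    qed
    then show ?thesis by (auto simp: cls_def)
  qed
  have sub_cls: "cls y = cls x" if x: "x \<in> S" and y: "y \<in> cls x" for x y
  proof -
    have xc: "x \<in> carrier G" using x sub by auto
    obtain k :: nat where k: "y = x [^] k" "coprime k (ord x)"
      using y x cls_alt by blast
    have yS: "y \<in> S" using closed k x by blast
    have oy: "ord y = ord x" using ord_pow_coprime[OF fin xc k(2)] k by simp
    have "cls y \<subseteq> cls x"
    proof
      fix z assume "z \<in> cls y"
      then obtain l :: nat where "z = x [^] (k * l)" "coprime (k * l) (ord x)"
        using yS k xc oy by (auto simp: cls_alt nat_pow_pow)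
      then show "z \<in> cls x" unfolding cls_alt[OF x] by blast
    qed
    moreover have "card (cls y) = card (cls x)"
      using card_coprime_powers[OF fin, of y] card_coprime_powers[OF fin xc] yS sub oy
      by (auto simp: cls_def subset_iff)
    moreover have "finite (cls x)" by (simp add: cls_def)
    ultimately show ?thesis by (simp add: card_subset_eq)
  qed
  have S: "S = \<Union> (cls ` S)"
    using self closed by (auto simp: cls_alt)
  have "t dvd card (\<Union> (cls ` S))"
  proof (rule dvd_partition)
    show "finite (\<Union> (cls ` S))" using S fin sub finite_subset by metis
    show "\<forall>c\<in>cls ` S. t dvd card c"
      using card_coprime_powers[OF fin] sub t by (auto simp: cls_def subset_iff)
    show "\<forall>c1\<in>cls ` S. \<forall>c2\<in>cls ` S. c1 \<noteq> c2 \<longrightarrow> c1 \<inter> c2 = {}"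
      using sub_cls by blast
  qed
  then show ?thesis using S by simp
qed

section \<open>Conjugacy classes and centralizers\<close>

definition (in group) centralizer :: "'a \<Rightarrow> 'a set" where
  "centralizer v = {y \<in> carrier G. y \<otimes> v = v \<otimes> y}"

definition (in group) conj_class :: "'a \<Rightarrow> 'a set" where
  "conj_class v = (\<lambda>g. g \<otimes> v \<otimes> inv g) ` carrier G"

lemma card_eq_sum_card_fibres:
  assumes "finite A"
  shows "card A = (\<Sum>b\<in>f ` A. card {a \<in> A. f a = b})"
  using sum.image_gen[OF assms, of "\<lambda>_. 1::nat" f] by simp

context group
begin

lemma inv_cancel_left [simp]:
  assumes "x \<in> carrier G" "y \<in> carrier G"
  shows "inv x \<otimes> (x \<otimes> y) = y" "x \<otimes> (inv x \<otimes> y) = y"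
  using assms by (simp_all add: m_assoc[symmetric])

lemma conj_eq_iff:
  assumes "v \<in> carrier G" "w \<in> carrier G" "g \<in> carrier G"
  shows "g \<otimes> v \<otimes> inv g = w \<longleftrightarrow> g \<otimes> v = w \<otimes> g"
  using assms by (metis inv_solve_right m_closed)

lemma conj_pow:
  assumes "v \<in> carrier G" "g \<in> carrier G"
  shows "(g \<otimes> v \<otimes> inv g) [^] (n::nat) = g \<otimes> v [^] n \<otimes> inv g"
proof (induction n)
  case (Suc n)
  have "g \<otimes> v [^] n \<otimes> inv g \<otimes> (g \<otimes> v \<otimes> inv g) = g \<otimes> (v [^] n \<otimes> v) \<otimes> inv g"
    using assms by (simp add: m_assoc del: nat_pow_Suc)
  then show ?case using Suc by simp
qed (use assms in simp)

lemma conj_mult: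
  assumes "v \<in> carrier G" "w \<in> carrier G" "g \<in> carrier G"
  shows "(g \<otimes> v \<otimes> inv g) \<otimes> (g \<otimes> w \<otimes> inv g) = g \<otimes> (v \<otimes> w) \<otimes> inv g"
  using assms by (simp add: m_assoc)

lemma conj_inj:
  assumes "v \<in> carrier G" "w \<in> carrier G" "g \<in> carrier G"
  shows "g \<otimes> v \<otimes> inv g = g \<otimes> w \<otimes> inv g \<longleftrightarrow> v = w"
  using assms by (metis inv_closed l_cancel_one' m_closed Units_l_cancel Units_eq right_cancel)

lemma ord_conj:
  assumes "v \<in> carrier G" "g \<in> carrier G"
  shows "ord (g \<otimes> v \<otimes> inv g) = ord v"
proof -
  have "(g \<otimes> v \<otimes> inv g) [^] n = \<one> \<longleftrightarrow> v [^] n = \<one>" for n :: nat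
    using assms conj_inj[of "v [^] n" \<one> g] by (simp add: conj_pow)
  then show ?thesis
    using assms by (simp add: ord_unique pow_eq_id)
qed

lemma subgroup_centralizer:
  assumes v: "v \<in> carrier G"
  shows "subgroup (centralizer v) G"
proof
  show "centralizer v \<subseteq> carrier G" by (auto simp: centralizer_def)
  show "\<one> \<in> centralizer v" using v by (auto simp: centralizer_def)
next
  fix x y assume "x \<in> centralizer v" "y \<in> centralizer v"
  then show "x \<otimes> y \<in> centralizer v"
    using v by (auto simp: centralizer_def) (metis m_assoc)
next
  fix x assume x: "x \<in> centralizer v"
  then have "v \<otimes> inv x = inv x \<otimes> v"
    using v by (auto simp: centralizer_def) (metis inv_closed inv_solve_left inv_solve_right m_assoc m_closed)
  then show "inv x \<in> centralizer v"
    using x v by (auto simp: centralizer_def)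
qed

lemma conj_class_self: "v \<in> carrier G \<Longrightarrow> v \<in> conj_class v"
  unfolding conj_class_def by (rule image_eqI[of _ _ \<one>]) auto

lemma conj_class_eq:
  assumes v: "v \<in> carrier G" and w: "w \<in> conj_class v"
  shows "conj_class w = conj_class v"
proof -
  obtain g where g: "g \<in> carrier G" "w = g \<otimes> v \<otimes> inv g"
    using w by (auto simp: conj_class_def)
  have comp: "h \<otimes> w \<otimes> inv h = (h \<otimes> g) \<otimes> v \<otimes> inv (h \<otimes> g)" if "h \<in> carrier G" for h
    using g that v by (simp add: inv_mult_group m_assoc)
  have "conj_class w \<subseteq> conj_class v"
    unfolding conj_class_def using comp g by (auto intro!: image_eqI)
  moreover have "h \<otimes> v \<otimes> inv h \<in> conj_class w" if h: "h \<in> carrier G" for h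
    unfolding conj_class_def
    by (rule image_eqI[of _ _ "h \<otimes> inv g"]) (use comp[of "h \<otimes> inv g"] g h in \<open>auto simp: m_assoc\<close>)
  ultimately show ?thesis by (auto simp: conj_class_def)
qed

text \<open>The fibres of g \<mapsto> g v g^(-1) are left cosets of the centralizer of v.\<close>
lemma orbit_stabilizer_conj:
  assumes fin: "finite (carrier G)" and v: "v \<in> carrier G"
  shows "card (conj_class v) * card (centralizer v) = order G"
proof -
  have "card {g \<in> carrier G. g \<otimes> v \<otimes> inv g = w} = card (centralizer v)" if w: "w \<in> conj_class v" for w
  proof -
    obtain g where g: "g \<in> carrier G" "w = g \<otimes> v \<otimes> inv g"
      using w unfolding conj_class_def by blast
    have "{h \<in> carrier G. h \<otimes> v \<otimes> inv h = w} = (\<lambda>c. g \<otimes> c) ` centralizer v" (is "?A = ?B")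
    proof
      show "?B \<subseteq> ?A"
      proof
        fix h assume "h \<in> ?B"
        then obtain c where c: "c \<in> carrier G" "c \<otimes> v = v \<otimes> c" "h = g \<otimes> c"
          by (auto simp: centralizer_def)
        have "h \<otimes> v = w \<otimes> h"
        proof -
          have "w \<otimes> h = g \<otimes> (v \<otimes> c)"
            using g c v by (simp add: m_assoc)
          also have "\<dots> = h \<otimes> v" unfolding c(2)[symmetric] using g c v by (simp add: m_assoc)
          finally show ?thesis by simp
        qed
        then show "h \<in> ?A" using conj_eq_iff[of v w h] g c v by auto
      qed
      show "?A \<subseteq> ?B"
      proof
        fix h assume h: "h \<in> ?A"
        then have hc: "h \<in> carrier G" and "h \<otimes> v = w \<otimes> h"
          using conj_eq_iff[of v w h] g v by auto
        then have "inv g \<otimes> h \<otimes> v = (inv g \<otimes> g) \<otimes> v \<otimes> inv g \<otimes> h"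
          using g v by (simp add: m_assoc del: l_inv)
        then have "inv g \<otimes> h \<in> centralizer v"
          using g v hc by (auto simp: centralizer_def m_assoc)
        moreover have "h = g \<otimes> (inv g \<otimes> h)"
          using g hc by (simp add: m_assoc[symmetric])
        ultimately show "h \<in> ?B" by blast
      qed
    qed
    moreover have "inj_on (\<lambda>c. g \<otimes> c) (centralizer v)"
      using inj_on_cmult[OF g(1)] by (rule inj_on_subset) (auto simp: centralizer_def)
    ultimately show ?thesis by (simp add: card_image)
  qed
  then show ?thesis
    using card_eq_sum_card_fibres[OF fin, of "\<lambda>g. g \<otimes> v \<otimes> inv g"]
    by (simp add: conj_class_def[symmetric] order_def)
qed

lemma dvd_sum_over_classes:
  fixes F :: "'a \<Rightarrow> nat"
  assumes fin: "finite (carrier G)" and V: "V \<subseteq> carrier G"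
    and closed: "\<And>v. v \<in> V \<Longrightarrow> conj_class v \<subseteq> V"
    and const: "\<And>v w. v \<in> V \<Longrightarrow> w \<in> conj_class v \<Longrightarrow> F w = F v"
    and s: "\<And>v. v \<in> V \<Longrightarrow> s dvd card (conj_class v) * F v"
  shows "s dvd (\<Sum>v\<in>V. F v)"
proof -
  have finV: "finite V" using fin V finite_subset by blast
  have class_sum: "s dvd (\<Sum>w\<in>{w \<in> V. conj_class w = conj_class v}. F w)" if v: "v \<in> V" for v
  proof -
    have "{w \<in> V. conj_class w = conj_class v} = conj_class v"
      using closed[OF v] v V conj_class_self conj_class_eq by blast
    then show ?thesis using s[OF v] const[OF v] by simp
  qed
  have "s dvd (\<Sum>w\<in>{w \<in> V. conj_class w = K}. F w)" if "K \<in> conj_class ` V" for K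
    using that class_sum by auto
  then show ?thesis
    unfolding sum.image_gen[OF finV, of F conj_class] by (rule dvd_sum)
qed

end

lemma (in group) ord_subgroup:
  assumes H: "subgroup H G" and x: "x \<in> H"
  shows "group.ord (G\<lparr>carrier := H\<rparr>) x = ord x"
proof -
  interpret H: group "G\<lparr>carrier := H\<rparr>" using H by (rule subgroup_imp_group)
  have "x \<in> carrier G" using x H subgroup.mem_carrier by metis
  then show ?thesis
    using x by (subst H.ord_unique) (auto simp: nat_pow_consistent[symmetric] pow_eq_id)
qed

lemma (in group) torsion_subgroup_eq:
  assumes "subgroup H G"
  shows "torsion (G\<lparr>carrier := H\<rparr>) d = H \<inter> torsion G d"
  using subgroup.mem_carrier[OF assms] by (auto simp: torsion_def nat_pow_consistent[symmetric])

lemma (in group) torsion_gcd_order: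
  "torsion G d = torsion G (gcd d (order G))"
  using ord_dvd_group_order by (auto simp: in_torsion_iff)

section \<open>Frobenius' theorem on the equation x^d = 1\<close>

context group
begin

text \<open>For v of order prime to s, these are the elements that can stand as the s-part next
to v in a product with commuting parts of coprime orders.\<close>
definition commuting_parts :: "nat \<Rightarrow> 'a \<Rightarrow> 'a set" where
  "commuting_parts s v = centralizer v \<inter> torsion G s"

lemma card_commuting_products:
  assumes fin: "finite (carrier G)" and cop: "coprime a s" and V: "V \<subseteq> torsion G a"
  shows "card {v \<otimes> y |v y. v \<in> V \<and> y \<in> commuting_parts s v} = (\<Sum>v\<in>V. card (commuting_parts s v))"
proof -
  have finV: "finite V" and finC: "finite (commuting_parts s v)" for v
    using V fin torsion_subset finite_subset unfolding commuting_parts_def by (metis subset_trans, metis finite_Int)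
  have "{v \<otimes> y |v y. v \<in> V \<and> y \<in> commuting_parts s v} =
      (\<lambda>(v, y). v \<otimes> y) ` (SIGMA v:V. commuting_parts s v)"
    by auto
  moreover have "inj_on (\<lambda>(v, y). v \<otimes> y) (SIGMA v:V. commuting_parts s v)"
  proof (rule inj_onI)
    fix p p' assume p: "p \<in> (SIGMA v:V. commuting_parts s v)" "p' \<in> (SIGMA v:V. commuting_parts s v)"
      and eq: "(case p of (v, y) \<Rightarrow> v \<otimes> y) = (case p' of (v, y) \<Rightarrow> v \<otimes> y)"
    obtain v y v' y' where vy: "p = (v, y)" "p' = (v', y')" by fastforce
    have "v = v' \<and> y = y'"
      by (rule coprime_parts_unique[OF cop])
        (use p eq vy V in \<open>auto simp: commuting_parts_def centralizer_def\<close>)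
    then show "p = p'" using vy by simp
  qed
  ultimately show ?thesis
    using finV finC by (simp add: card_image card_SigmaI)
qed

lemma conj_class_ord: "v \<in> carrier G \<Longrightarrow> w \<in> conj_class v \<Longrightarrow> ord w = ord v"
  by (auto simp: conj_class_def ord_conj)

lemma conj_class_subset: "v \<in> carrier G \<Longrightarrow> conj_class v \<subseteq> carrier G"
  by (auto simp: conj_class_def)

lemma card_commuting_parts_conj:
  assumes v: "v \<in> carrier G" and w: "w \<in> conj_class v"
  shows "card (commuting_parts s w) = card (commuting_parts s v)"
proof -
  obtain g where g: "g \<in> carrier G" and wg: "w = g \<otimes> v \<otimes> inv g"
    using w unfolding conj_class_def by blast
  have into: "g \<otimes> y \<otimes> inv g \<in> commuting_parts s (g \<otimes> v \<otimes> inv g)"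
    if "y \<in> commuting_parts s v" "v \<in> carrier G" "g \<in> carrier G" for g v y
    using that by (auto simp: commuting_parts_def centralizer_def in_torsion_iff ord_conj conj_mult)
  have backw: "inv g \<otimes> w \<otimes> g = v"
    using g v by (simp add: wg m_assoc)
  have "bij_betw (\<lambda>y. g \<otimes> y \<otimes> inv g) (commuting_parts s v) (commuting_parts s w)"
  proof (rule bij_betwI[where g = "\<lambda>y. inv g \<otimes> y \<otimes> g"])
    show "(\<lambda>y. g \<otimes> y \<otimes> inv g) \<in> commuting_parts s v \<rightarrow> commuting_parts s w"
      using into v g wg by auto
    show "(\<lambda>y. inv g \<otimes> y \<otimes> g) \<in> commuting_parts s w \<rightarrow> commuting_parts s v"
      using into[of _ w "inv g"] v g wg backw by auto
  qed (use g in \<open>auto simp: commuting_parts_def in_torsion_iff m_assoc\<close>)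
  then show ?thesis by (metis bij_betw_same_card)
qed

lemma centralizer_eq_carrier_iff:
  "centralizer v = carrier G \<longleftrightarrow> (\<forall>g\<in>carrier G. g \<otimes> v = v \<otimes> g)"
  unfolding centralizer_def by blast

text \<open>The torsion set alone is not closed under products; restricting to central elements
makes it so.\<close>
lemma subgroup_central_torsion:
  "subgroup {v \<in> torsion G a. centralizer v = carrier G} G" (is "subgroup ?Z G")
proof
  show sub: "?Z \<subseteq> carrier G" using torsion_subset by auto
  show "\<one> \<in> ?Z" by (simp add: in_torsion_iff centralizer_eq_carrier_iff)
  have com: "g \<otimes> x = x \<otimes> g" if "x \<in> ?Z" "g \<in> carrier G" for x g
    using that by (simp add: centralizer_eq_carrier_iff)
  fix x assume x: "x \<in> ?Z"
  then have xc: "x \<in> carrier G" using sub by auto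
  {
    fix y assume y: "y \<in> ?Z"
    then have yc: "y \<in> carrier G" using sub by auto
    have "(x \<otimes> y) [^] a = \<one>"
      using x y pow_mult_distrib[OF com[OF y xc] xc yc] by (simp add: torsion_def)
    moreover have "g \<otimes> (x \<otimes> y) = (x \<otimes> y) \<otimes> g" if g: "g \<in> carrier G" for g
      using com[OF x g] com[OF y g] xc yc g by (metis m_assoc)
    ultimately show "x \<otimes> y \<in> ?Z"
      using xc yc by (simp add: centralizer_eq_carrier_iff torsion_def)
  }
  have "g \<otimes> inv x = inv x \<otimes> g" if g: "g \<in> carrier G" for g
  proof -
    have "inv (inv g \<otimes> x) = inv (x \<otimes> inv g)"
      using com[OF x, of "inv g"] g by simp
    then show ?thesis using xc g by (simp add: inv_mult_group)
  qed
  then show "inv x \<in> ?Z"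
    using x xc by (simp add: centralizer_eq_carrier_iff in_torsion_iff)
qed

text \<open>By Cauchy's theorem the subgroup contains an element of order r.\<close>
lemma prime_dvd_card_torsion_subgroup:
  assumes fin: "finite (carrier G)" and sg: "subgroup H G" and H: "H \<subseteq> torsion G e"
    and r: "prime r" "r dvd card H"
  shows "r dvd e"
proof -
  have sub: "H \<subseteq> carrier G" using sg by (rule subgroup.subset)
  interpret H: group "G\<lparr>carrier := H\<rparr>" using sg by (rule subgroup_imp_group)
  obtain m' where m': "card H = r ^ 1 * m'" using r by auto
  then obtain K where K: "subgroup K (G\<lparr>carrier := H\<rparr>)" "card K = r ^ 1"
    using sylow_thm[OF r(1) H.is_group, of 1 m'] finite_subset[OF sub fin] by (auto simp: order_def)
  have KH: "K \<subseteq> H" using subgroup.subset[OF K(1)] by simp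
  have sgK: "subgroup K G" using incl_subgroup[OF sg K(1)] .
  interpret K: group "G\<lparr>carrier := K\<rparr>" using sgK by (rule subgroup_imp_group)
  have "K \<noteq> {\<one>}" using K(2) r(1) by auto
  then obtain h where h: "h \<in> K" "h \<noteq> \<one>"
    using subgroup.one_closed[OF sgK] by blast
  have hc: "h \<in> carrier G" using h KH sub by auto
  have "ord h dvd r"
    using K.ord_dvd_group_order[of h] h K(2) ord_subgroup[OF sgK h(1)] by (simp add: order_def)
  then have "ord h = r"
    using r(1) h hc ord_eq_1[OF hc] by (auto simp: prime_nat_iff)
  then show ?thesis using h KH H by (auto simp: in_torsion_iff)
qed

end

text \<open>Frobenius' theorem, by a double induction, upwards on the order of the group and
downwards on d. Let p be a prime dividing n/d and write d = p^l s with s prime to p. By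
induction d p, and hence d, divides the number of solutions of x^(d p) = 1, so it suffices that
d divides the number of elements x of S, those whose order divides d p but not d. The order of
each has p-part exactly p^(l+1). Sorting S by generated cyclic subgroups gives divisibility by p^l.
Sorting S by the p-part v of x gives divisibility by s: for v outside the centre the induction
applies to the centralizer of v, and the factor that is lost is regained from the size of
the conjugacy class of v. Each central v contributes the same number T of solutions of
y^s = 1, and T is divisible by s because this holds for the solutions of x^(p^a s) = 1, p^a being the full
power of p in n, and because the number of central p-elements is a power of p.\<close>
theorem frobenius_solutions:
  assumes "group G" "finite (carrier G)" "d dvd order G"
  shows "d dvd card (torsion G d)"
  using assms
proof (induction "order G" arbitrary: G d rule: less_induct)
  case (less G d)
  interpret group G by fact
  note fin = \<open>finite (carrier G)\<close>
  define n where "n = order G"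
  have n0: "n > 0" using fin by (simp add: n_def order_gt_0_iff_finite)
  have sub_fin: "finite A" if "A \<subseteq> carrier G" for A using that fin finite_subset by blast
  \<comment> \<open>s divides gcd(s, c) times n/c, where c is the order of the centralizer.\<close>
  have noncentral: "s dvd card (conj_class v) * card (commuting_parts s v)"
    if v: "v \<in> carrier G" and nc: "centralizer v \<noteq> carrier G" and s: "s dvd n" for s v
  proof -
    let ?C = "G\<lparr>carrier := centralizer v\<rparr>"
    have sg: "subgroup (centralizer v) G" using subgroup_centralizer[OF v] .
    have sub: "centralizer v \<subseteq> carrier G" by (auto simp: centralizer_def)
    interpret C: group ?C using sg by (rule subgroup_imp_group)
    have oC: "order ?C = card (centralizer v)" by (simp add: order_def)
    have "order ?C < order G"
      unfolding oC unfolding order_def using sub nc fin by (intro psubset_card_mono) auto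
    then have "gcd s (order ?C) dvd card (torsion ?C (gcd s (order ?C)))"
      by (rule less.hyps) (use sub_fin[OF sub] in \<open>auto simp: C.is_group\<close>)
    then have "gcd s (card (centralizer v)) dvd card (commuting_parts s v)"
      using C.torsion_gcd_order[of s] torsion_subgroup_eq[OF sg, of s] oC
      by (simp add: commuting_parts_def)
    then have "card (conj_class v) * gcd s (card (centralizer v)) dvd
        card (conj_class v) * card (commuting_parts s v)"
      by (rule mult_dvd_mono[OF dvd_refl])
    moreover have "card (conj_class v) * gcd s (card (centralizer v)) = gcd (card (conj_class v) * s) n"
      using orbit_stabilizer_conj[OF fin v] by (simp add: gcd_mult_distrib_nat n_def)
    moreover have "s dvd gcd (card (conj_class v) * s) n" using s by simp
    ultimately show ?thesis by (metis dvd_trans)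
  qed
  show ?case
    using \<open>d dvd order G\<close>
  proof (induction "n - d" arbitrary: d rule: less_induct)
    case (less d)
    show ?case
    proof (cases "d = n")
      case True
      have "torsion G n = carrier G"
        using ord_dvd_group_order by (auto simp: in_torsion_iff n_def)
      then show ?thesis using True by (simp add: n_def order_def)
    next
      case False
      obtain m where m: "n = d * m" using less.prems by (auto simp: n_def)
      have "m \<noteq> 1" using False m by auto
      then obtain p where p: "prime p" "p dvd m" by (meson prime_factor_nat)
      have dp: "d * p dvd n" using m p by simp
      have d0: "d > 0" using m n0 by auto
      define l where "l = multiplicity p d"
      obtain s where s: "d = p ^ l * s" "\<not> p dvd s" "s > 0"
        using prime_power_decomposition[OF p(1) d0] unfolding l_def .
      define a where "a = multiplicity p n"
      have s_n: "s dvd n" using s m by auto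
      have la: "l < a"
      proof -
        have "p ^ Suc l dvd n" using dp s by (auto intro: dvd_trans[rotated])
        then show ?thesis using multiplicity_geI[of n p "Suc l"] n0 prime_gt_1_nat[OF p(1)] by (auto simp: a_def Suc_le_eq)
      qed
      have cop: "coprime (p ^ i) s" for i using prime_power_part_coprime p s by blast
      let ?N = "\<lambda>v. card (commuting_parts s v)"
      define Z where "Z = {v \<in> torsion G (p ^ a). centralizer v = carrier G}"
      have Z_sub: "Z \<subseteq> torsion G (p ^ a)" by (auto simp: Z_def)
      \<comment> \<open>Conjugacy classes meeting the centre are singletons, so removing the central elements
leaves a union of classes.\<close>
      have off_centre: "s dvd (\<Sum>v\<in>V - Z. ?N v)"
        if V: "V \<subseteq> torsion G (p ^ a)" and closed: "\<And>v. v \<in> V \<Longrightarrow> conj_class v \<subseteq> V" for V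
      proof (rule dvd_sum_over_classes[OF fin])
        show "V - Z \<subseteq> carrier G" using V torsion_subset by blast
        fix v assume v: "v \<in> V - Z"
        then have vc: "v \<in> carrier G" and nc: "centralizer v \<noteq> carrier G"
          using V torsion_subset by (auto simp: Z_def)
        show "s dvd card (conj_class v) * ?N v" by (rule noncentral[OF vc nc s_n])
        show "\<And>w. w \<in> conj_class v \<Longrightarrow> ?N w = ?N v"
          by (rule card_commuting_parts_conj[OF vc])
        have "w \<notin> Z" if w: "w \<in> conj_class v" for w
        proof
          assume "w \<in> Z"
          then have cen: "centralizer w = carrier G" and wc: "w \<in> carrier G"
            using torsion_subset by (auto simp: Z_def)
          have "conj_class w = {w}"
          proof -
            have "g \<otimes>\<^bsub>G\<^esub> w \<otimes>\<^bsub>G\<^esub> inv\<^bsub>G\<^esub> g = w" if g: "g \<in> carrier G" for g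
              using conj_eq_iff[of w w g] cen g wc by (simp add: centralizer_eq_carrier_iff)
            then show ?thesis using wc by (auto simp: conj_class_def)
          qed
          then have "v = w" using conj_class_eq[OF vc w] conj_class_self[OF vc] by auto
          then show False using cen nc by simp
        qed
        then show "conj_class v \<subseteq> V - Z" using closed[of v] v by auto
      qed
      let ?T = "card (torsion G s)"
      have central: "?N v = ?T" if "v \<in> Z" for v
        using that torsion_subset by (auto simp: Z_def commuting_parts_def Int_absorb1)
      have split: "(\<Sum>v\<in>V. ?N v) = (\<Sum>v\<in>V - Z. ?N v) + card (V \<inter> Z) * ?T"
        if V: "V \<subseteq> torsion G (p ^ a)" for V
      proof -
        have "finite V" using V torsion_subset sub_fin by blast
        then have "(\<Sum>v\<in>V. ?N v) = (\<Sum>v\<in>V - Z. ?N v) + (\<Sum>v\<in>V \<inter> Z. ?N v)"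
          by (metis add.commute sum.Int_Diff)
        then show ?thesis using central by simp
      qed
      have products: "{v \<otimes>\<^bsub>G\<^esub> y |v y. v \<in> torsion G (p ^ i) \<and> y \<in> commuting_parts s v} = torsion G (p ^ i * s)" for i
      proof (intro equalityI subsetI)
        fix x assume "x \<in> {v \<otimes>\<^bsub>G\<^esub> y |v y. v \<in> torsion G (p ^ i) \<and> y \<in> commuting_parts s v}"
        then obtain v y where x: "x = v \<otimes>\<^bsub>G\<^esub> y" and vy: "v \<in> torsion G (p ^ i)" "y \<in> commuting_parts s v"
          by blast
        then have v: "v \<in> carrier G" "ord v dvd p ^ i"
          and y: "y \<in> carrier G" "ord y dvd s" "v \<otimes>\<^bsub>G\<^esub> y = y \<otimes>\<^bsub>G\<^esub> v"
          by (auto simp: in_torsion_iff commuting_parts_def centralizer_def)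
        have "ord x dvd ord v * ord y" using ord_mul_divides[of v y] v y x by simp
        then show "x \<in> torsion G (p ^ i * s)"
          using v y x by (auto simp: in_torsion_iff intro: dvd_trans mult_dvd_mono)
      next
        fix x assume x: "x \<in> torsion G (p ^ i * s)"
        obtain j k :: nat where jk: "x = x [^]\<^bsub>G\<^esub> j \<otimes>\<^bsub>G\<^esub> x [^]\<^bsub>G\<^esub> k"
          "x [^]\<^bsub>G\<^esub> j \<in> torsion G (p ^ i)" "x [^]\<^bsub>G\<^esub> k \<in> torsion G s"
          using coprime_parts[OF cop x] .
        have "x [^]\<^bsub>G\<^esub> k \<otimes>\<^bsub>G\<^esub> x [^]\<^bsub>G\<^esub> j = x [^]\<^bsub>G\<^esub> j \<otimes>\<^bsub>G\<^esub> x [^]\<^bsub>G\<^esub> k"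
          using x by (simp add: in_torsion_iff nat_pow_mult add.commute)
        then have "x [^]\<^bsub>G\<^esub> k \<in> commuting_parts s (x [^]\<^bsub>G\<^esub> j)"
          using x jk(3) by (simp add: commuting_parts_def centralizer_def in_torsion_iff)
        then show "x \<in> {v \<otimes>\<^bsub>G\<^esub> y |v y. v \<in> torsion G (p ^ i) \<and> y \<in> commuting_parts s v}"
          using jk(1,2) by blast
      qed
      have closed_torsion: "conj_class v \<subseteq> torsion G e" if "v \<in> torsion G e" for v e
        using that conj_class_ord conj_class_subset[THEN subsetD] by (auto simp: in_torsion_iff)
      \<comment> \<open>p^a s is larger than d because l < a; this is where the downward induction is used for s.\<close>
      have s_T: "s dvd ?T"
      proof -
        have big: "p ^ a * s dvd n"
          using divides_mult[OF multiplicity_dvd s_n] cop by (simp add: a_def)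
        have "p ^ l < p ^ a" using la prime_gt_1_nat[OF p(1)] by (simp add: power_strict_increasing)
        then have "d < p ^ a * s" using s by simp
        moreover have "p ^ a * s \<le> n" using big n0 by (simp add: dvd_imp_le)
        ultimately have "n - p ^ a * s < n - d" by simp
        then have "p ^ a * s dvd card (torsion G (p ^ a * s))"
          by (rule less.hyps) (use big n_def in simp)
        then have "s dvd (\<Sum>v\<in>torsion G (p ^ a). ?N v)"
          using card_commuting_products[OF fin cop, of "torsion G (p ^ a)" a] products[of a]
          by (metis dvd_mult_right order_refl)
        then have "s dvd card (torsion G (p ^ a) \<inter> Z) * ?T"
          using split[of "torsion G (p ^ a)"] off_centre[of "torsion G (p ^ a)"] closed_torsion
          by (metis dvd_add_right_iff order_refl)
        then have "s dvd card Z * ?T" by (simp add: Int_absorb1 Z_sub)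
        moreover have "coprime s (card Z)"
        proof (rule ccontr)
          assume "\<not> coprime s (card Z)"
          then obtain r where r: "prime r" "r dvd s" "r dvd card Z"
            by (metis coprime_iff_gcd_eq_1 prime_factor_nat gcd_greatest_iff)
          have "r dvd p ^ a"
            using prime_dvd_card_torsion_subgroup[OF fin _ Z_sub r(1,3)] subgroup_central_torsion
            by (simp add: Z_def)
          then show False
            using r(1,2) cop[of a] by (meson coprime_common_divisor not_prime_unit)
        qed
        ultimately show ?thesis using coprime_dvd_mult_right_iff by blast
      qed
      define S where "S = {x \<in> carrier G. ord x dvd d * p \<and> \<not> ord x dvd d}"
      have S_full: "p ^ Suc l dvd ord x" if "x \<in> S" for x
      proof -
        have *: "ord x dvd p ^ Suc l * s" "\<not> ord x dvd p ^ l * s"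
          using that s by (simp_all add: S_def mult_ac)
        have o0: "ord x > 0" using that n0 fin ord_ge_1[of x] by (simp add: S_def)
        obtain i t where it: "ord x = p ^ i * t" "\<not> p dvd t"
          using prime_power_decomposition[OF p(1) o0] .
        have "t dvd s * p ^ Suc l" using * it by (metis dvd_mult_right mult.commute)
        then have ts: "t dvd s"
          using prime_power_part_coprime[OF p(1) it(2), of "Suc l"]
          by (meson coprime_commute coprime_dvd_mult_left_iff)
        have "\<not> i \<le> l"
        proof
          assume "i \<le> l"
          then have "p ^ i * t dvd p ^ l * s" using ts by (intro mult_dvd_mono le_imp_power_dvd)
          then show False using * it by simp
        qed
        then show ?thesis using it by (simp add: le_imp_power_dvd dvd_mult2 Suc_le_eq del: power_Suc)
      qed
      have p_S: "p ^ l dvd card S"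
      proof (rule totient_dvd_card[OF fin])
        show "S \<subseteq> carrier G" by (auto simp: S_def)
      next
        fix x and k :: nat assume "x \<in> S" "coprime k (ord x)"
        then show "x [^]\<^bsub>G\<^esub> k \<in> S" using ord_pow_coprime[OF fin, of x k] by (auto simp: S_def)
      next
        fix x assume "x \<in> S"
        then have "totient (p ^ Suc l) dvd totient (ord x)" by (intro totient_dvd S_full)
        then show "p ^ l dvd totient (ord x)"
          unfolding totient_prime_power_Suc[OF p(1)] by (rule dvd_mult_left)
      qed
      have s_S: "s dvd card S"
      proof -
        define V where "V = {v \<in> carrier G. ord v = p ^ Suc l}"
        have V: "V \<subseteq> torsion G (p ^ a)"
          using la by (auto simp: V_def in_torsion_iff Suc_le_eq intro!: le_imp_power_dvd simp del: power_Suc)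
        have "S = {v \<otimes>\<^bsub>G\<^esub> y |v y. v \<in> V \<and> y \<in> commuting_parts s v}" (is "_ = ?P")
        proof (intro equalityI subsetI)
          fix x assume x: "x \<in> S"
          then have "x \<in> torsion G (p ^ Suc l * s)" using s by (auto simp: S_def in_torsion_iff mult_ac)
          then obtain v y where vy: "x = v \<otimes>\<^bsub>G\<^esub> y" "v \<in> torsion G (p ^ Suc l)" "y \<in> commuting_parts s v"
            using products[of "Suc l"] by blast
          then have c: "v \<in> carrier G" "y \<in> carrier G" "v \<otimes>\<^bsub>G\<^esub> y = y \<otimes>\<^bsub>G\<^esub> v" and oy: "ord y dvd s"
            by (auto simp: commuting_parts_def in_torsion_iff centralizer_def)
          have "ord x dvd ord v * ord y" using ord_mul_divides[of v y] c vy(1) by simp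
          then have "p ^ Suc l dvd ord v * ord y" using S_full[OF x] dvd_trans by blast
          then have "p ^ Suc l dvd ord v"
            using cop[of "Suc l"] oy by (meson coprime_divisors coprime_dvd_mult_left_iff dvd_refl)
          then have "ord v = p ^ Suc l" using vy(2) by (auto simp: in_torsion_iff intro: dvd_antisym)
          then have "v \<in> V" using c by (simp add: V_def)
          then show "x \<in> ?P" using vy by blast
        next
          fix x assume "x \<in> ?P"
          then obtain v y where x: "x = v \<otimes>\<^bsub>G\<^esub> y" and "v \<in> V" "y \<in> commuting_parts s v"
            by blast
          then have vy: "x = v \<otimes>\<^bsub>G\<^esub> y" "v \<in> carrier G" "ord v = p ^ Suc l" "y \<in> carrier G"
             "ord y dvd s" "v \<otimes>\<^bsub>G\<^esub> y = y \<otimes>\<^bsub>G\<^esub> v"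
            by (auto simp: V_def commuting_parts_def in_torsion_iff centralizer_def)
          have "ord x = p ^ Suc l * ord y"
            using ord_mult_coprime[of v y] vy cop[of "Suc l"] by (metis coprime_divisors dvd_refl)
          then have o: "ord x dvd d * p" "p ^ Suc l dvd ord x"
            using vy(5) s by (auto simp: mult_ac intro: mult_dvd_mono)
          moreover have "\<not> p ^ Suc l dvd d"
            unfolding s(1) power_Suc2 using s(2) prime_gt_0_nat[OF p(1)] by simp
          ultimately show "x \<in> S" using vy dvd_trans by (auto simp: S_def simp del: power_Suc)
        qed
        then have "card S = (\<Sum>v\<in>V. ?N v)"
          using card_commuting_products[OF fin cop V] by simp
        moreover have "s dvd (\<Sum>v\<in>V - Z. ?N v)"
          by (rule off_centre[OF V]) (use conj_class_ord conj_class_subset[THEN subsetD] in \<open>auto simp: V_def\<close>)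
        ultimately show ?thesis using split[OF V] s_T by simp
      qed
      have "d dvd card S"
        using divides_mult[OF p_S s_S] cop s by simp
      moreover have "d dvd card (torsion G (d * p))"
      proof -
        have "d < d * p" using d0 prime_gt_1_nat[OF p(1)] by simp
        moreover have "d * p \<le> n" using dp n0 by (simp add: dvd_imp_le)
        ultimately have "n - d * p < n - d" by linarith
        then have "d * p dvd card (torsion G (d * p))"
          by (rule less.hyps) (use dp n_def in simp)
        then show ?thesis using dvd_mult_left by blast
      qed
      moreover have "torsion G (d * p) = torsion G d \<union> S" "torsion G d \<inter> S = {}"
        by (auto simp: S_def in_torsion_iff)
      then have "card (torsion G (d * p)) = card (torsion G d) + card S"
        using sub_fin[OF torsion_subset] sub_fin[of S] by (auto simp: S_def intro!: card_Un_disjoint)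
      ultimately show ?thesis by (simp add: dvd_add_left_iff)
    qed
  qed
qed

section \<open>Sums over element orders\<close>

definition ord_sum :: "(nat \<Rightarrow> real) \<Rightarrow> ('a, 'b) monoid_scheme \<Rightarrow> real" where
  "ord_sum f G = (\<Sum>x\<in>carrier G. f (group.ord G x))"

definition divisor_sum :: "(nat \<Rightarrow> real) \<Rightarrow> nat \<Rightarrow> real" where
  "divisor_sum f n = (\<Sum>d | d dvd n. real (totient d) * f d)"

text \<open>The sum for the cyclic group of order n after the orders of its generators are
lowered from n to n / q.\<close>
definition noncyclic_bound :: "(nat \<Rightarrow> real) \<Rightarrow> nat \<Rightarrow> nat \<Rightarrow> real" where
  "noncyclic_bound f n q = divisor_sum f n - real (totient n) * (f n - f (n div q))"

lemma (in group) ord_iso: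
  assumes "h \<in> iso G H" "group H" "x \<in> carrier G"
  shows "group.ord H (h x) = ord x"
proof -
  interpret H: group H by fact
  interpret h: group_hom G H h
    using assms by (simp add: group_hom_def group_hom_axioms_def iso_def is_group)
  have inj: "inj_on h (carrier G)" using assms(1) by (simp add: iso_def bij_betw_def)
  have "h x [^]\<^bsub>H\<^esub> n = \<one>\<^bsub>H\<^esub> \<longleftrightarrow> x [^] n = \<one>" for n :: nat
  proof -
    have "h (x [^] n) = h \<one> \<longleftrightarrow> x [^] n = \<one>"
      using inj_on_eq_iff[OF inj, of "x [^] n" \<one>] assms(3) by blast
    then show ?thesis using h.hom_nat_pow[OF assms(3), of n] h.hom_one by simp
  qed
  then show ?thesis
    using assms(3) by (simp add: H.ord_unique pow_eq_id)
qed

lemma (in group) ord_image_iso: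
  assumes "G \<cong> H" "group H"
  obtains h where "bij_betw h (carrier G) (carrier H)" "\<And>x. x \<in> carrier G \<Longrightarrow> group.ord H (h x) = ord x"
  using assms ord_iso unfolding is_iso_def iso_def by blast

lemma (in group) ord_sum_iso:
  assumes "G \<cong> H" "group H"
  shows "ord_sum f H = ord_sum f G"
proof -
  obtain h where h: "bij_betw h (carrier G) (carrier H)" "\<And>x. x \<in> carrier G \<Longrightarrow> group.ord H (h x) = ord x"
    using ord_image_iso[OF assms] by blast
  show ?thesis
    unfolding ord_sum_def by (subst sum.reindex_bij_betw[OF h(1), symmetric]) (simp add: h(2))
qed

text \<open>The induction on the group order passes to quotients, whose elements are sets of elements.
Copies on the natural numbers keep the type fixed.\<close>
lemma (in group) finite_group_iso_nat:
  assumes fin: "finite (carrier G)"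
  obtains H :: "nat monoid" where "group H" "G \<cong> H" "finite (carrier H)"
proof -
  obtain e :: "'a \<Rightarrow> nat" where e: "inj_on e (carrier G)"
    using finite_imp_inj_to_nat_seg[OF fin] by blast
  define g where "g = inv_into (carrier G) e"
  define H :: "nat monoid" where
    "H = \<lparr>carrier = e ` carrier G, monoid.mult = (\<lambda>a b. e (g a \<otimes> g b)), one = e \<one>\<rparr>"
  have ge: "g (e x) = x" if "x \<in> carrier G" for x using e that by (simp add: g_def)
  have H1: "\<one>\<^bsub>H\<^esub> = e \<one>" by (simp add: H_def)
  have H: "e x \<otimes>\<^bsub>H\<^esub> e y = e (x \<otimes> y)"
    if "x \<in> carrier G" "y \<in> carrier G" for x y
    using that by (simp_all add: H_def ge)
  have carr: "carrier H = e ` carrier G" by (simp add: H_def)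
  have "group H"
  proof (rule groupI)
    fix a assume "a \<in> carrier H"
    then obtain x where x: "x \<in> carrier G" "a = e x" using carr by auto
    then show "\<exists>b\<in>carrier H. b \<otimes>\<^bsub>H\<^esub> a = \<one>\<^bsub>H\<^esub>"
      by (intro bexI[of _ "e (inv x)"]) (auto simp: H H1 carr)
  qed (auto simp: carr H H1 m_assoc)
  moreover have "e \<in> iso G H"
    using e by (auto simp: iso_def hom_def bij_betw_def carr H)
  then have "G \<cong> H" by (auto simp: is_iso_def)
  moreover have "finite (carrier H)" using fin carr by simp
  ultimately show ?thesis using that by blast
qed

lemma (in group) cyclic_group_iff_ord:
  assumes fin: "finite (carrier G)"
  shows "cyclic_group G \<longleftrightarrow> (\<exists>x\<in>carrier G. ord x = order G)"
proof -
  have "carrier G = range (\<lambda>n::int. x [^] n) \<longleftrightarrow> ord x = order G" if x: "x \<in> carrier G" for x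
  proof -
    have gen: "generate G {x} = range (\<lambda>n::int. x [^] n)"
      using generate_pow[OF x] by auto
    have "generate G {x} \<subseteq> carrier G" using x by (intro generate_incl) auto
    then show ?thesis
      unfolding gen[symmetric] generate_pow_card[OF x] order_def
      using fin card_subset_eq[of "carrier G" "generate G {x}"] by auto
  qed
  then show ?thesis by (auto simp: cyclic_group)
qed

lemma (in group) ord_sum_powers:
  assumes fin: "finite (carrier G)" and x: "x \<in> carrier G"
  shows "(\<Sum>y\<in>(\<lambda>k. x [^] k) ` {1..ord x}. F (ord y)) = divisor_sum F (ord x)"
proof -
  define n where "n = ord x"
  have n0: "n > 0" using ord_ge_1[OF fin x] by (simp add: n_def)
  have "(\<Sum>y\<in>(\<lambda>k. x [^] k) ` {1..n}. F (ord y)) = (\<Sum>k\<in>{1..n}. F (ord (x [^] k)))"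
    using ord_inj'[OF x] by (subst sum.reindex) (auto simp: n_def)
  also have "\<dots> = (\<Sum>k\<in>{0<..n}. F (n div gcd k n))"
    using x by (intro sum.cong) (auto simp: ord_pow_gen n_def gcd.commute)
  also have "\<dots> = (\<Sum>e\<in>(\<lambda>k. gcd k n) ` {0<..n}. \<Sum>k\<in>{k \<in> {0<..n}. gcd k n = e}. F (n div gcd k n))"
    by (rule sum.image_gen) simp
  also have "(\<lambda>k. gcd k n) ` {0<..n} = {e. e dvd n}"
  proof (intro equalityI subsetI)
    fix e assume "e \<in> {e. e dvd n}"
    then show "e \<in> (\<lambda>k. gcd k n) ` {0<..n}"
      using n0 by (intro image_eqI[of _ _ e]) (auto intro: dvd_imp_le dvd_pos_nat simp: gcd_nat.absorb1)
  qed auto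
  also have "(\<Sum>e | e dvd n. \<Sum>k\<in>{k \<in> {0<..n}. gcd k n = e}. F (n div gcd k n)) =
      (\<Sum>e | e dvd n. real (totient (n div e)) * F (n div e))"
    using card_gcd_eq_totient[OF n0] by (intro sum.cong refl) simp
  also have "\<dots> = divisor_sum F n"
    unfolding divisor_sum_def
    by (rule sum.reindex_bij_witness[of _ "\<lambda>d. n div d" "\<lambda>d. n div d"])
      (use n0 in \<open>auto simp: div_dvd_iff_mult dvd_div_eq_mult\<close>)
  finally show ?thesis by (simp add: n_def)
qed

lemma (in group) powers_eq_carrier:
  assumes fin: "finite (carrier G)" and x: "x \<in> carrier G" "ord x = order G"
  shows "(\<lambda>k. x [^] (k::nat)) ` {1..ord x} = carrier G"
  using ord_inj'[OF x(1)] x fin by (intro card_subset_eq) (auto simp: card_image order_def)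

lemma (in group) ord_sum_cyclic:
  assumes fin: "finite (carrier G)" and cyc: "cyclic_group G"
  shows "ord_sum f G = divisor_sum f (order G)"
proof -
  obtain x where x: "x \<in> carrier G" "ord x = order G"
    using cyc cyclic_group_iff_ord[OF fin] by blast
  show ?thesis
    using ord_sum_powers[OF fin x(1), of f] powers_eq_carrier[OF fin x] x(2) by (simp add: ord_sum_def)
qed

lemma cyclic_integer_mod_group:
  assumes "n > 0"
  shows "cyclic_group (integer_mod_group n)" "order (integer_mod_group n) = n"
    "finite (carrier (integer_mod_group n))"
proof -
  interpret group "integer_mod_group n" by simp
  show fin: "finite (carrier (integer_mod_group n))" and ord_n: "order (integer_mod_group n) = n"
    using assms by (auto simp: carrier_integer_mod_group order_def)
  show "cyclic_group (integer_mod_group n)"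
  proof (cases "n = 1")
    case True
    then show ?thesis by (intro trivial_imp_cyclic_group) (simp add: trivial_integer_mod_group)
  next
    case False
    then have one: "1 \<in> carrier (integer_mod_group n)" by simp
    have "1 [^]\<^bsub>integer_mod_group n\<^esub> k = \<one>\<^bsub>integer_mod_group n\<^esub> \<longleftrightarrow> n dvd k" for k :: nat
      by (simp add: mod_eq_0_iff_dvd int_dvd_int_iff)
    then have "ord 1 = n" using one by (subst ord_unique) auto
    then show ?thesis using one ord_n cyclic_group_iff_ord[OF fin] by auto
  qed
qed

lemma ord_sum_integer_mod_group:
  "n > 0 \<Longrightarrow> ord_sum f (integer_mod_group n) = divisor_sum f n"
  using group.ord_sum_cyclic[OF group_integer_mod_group] cyclic_integer_mod_group by metis

lemma divisors_prime_power_times: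
  fixes p :: nat
  assumes p: "prime p" and m: "\<not> p dvd m" "m > 0"
  shows "bij_betw (\<lambda>(i, d). p ^ i * d) ({..b} \<times> {d. d dvd m}) {d. d dvd p ^ b * m}"
  unfolding bij_betw_def
proof
  have p0: "p > 0" and p1: "p > 1" using prime_gt_0_nat prime_gt_1_nat p by auto
  have nd: "\<not> p dvd d" if "d dvd m" for d using m(1) that dvd_trans by blast
  have mult: "multiplicity p (p ^ i * d) = i" if "d dvd m" for i d
    using nd[OF that] p by (intro multiplicity_decomposeI[of _ _ _ d]) auto
  show "inj_on (\<lambda>(i, d). p ^ i * d) ({..b} \<times> {d. d dvd m})"
  proof (rule inj_onI, clarsimp)
    fix i d j e assume *: "d dvd m" "e dvd m" and eq: "p ^ i * d = p ^ j * e"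
    have "i = j" using mult[OF *(1), of i] mult[OF *(2), of j] eq by simp
    then show "i = j \<and> d = e" using eq p0 by simp
  qed
  show "(\<lambda>(i, d). p ^ i * d) ` ({..b} \<times> {d. d dvd m}) = {d. d dvd p ^ b * m}"
  proof (intro equalityI subsetI)
    fix x assume "x \<in> {d. d dvd p ^ b * m}"
    then have x: "x dvd p ^ b * m" by simp
    then have x0: "x > 0" using m p0 by (intro dvd_pos_nat[OF _ x]) auto
    obtain d where d: "x = p ^ multiplicity p x * d" "\<not> p dvd d"
      using prime_power_decomposition[OF p x0] .
    have cop: "coprime (p ^ i) m" "coprime (p ^ i) d" for i
      using prime_power_part_coprime p m d by blast+
    have "d dvd p ^ b * m" using x d by (metis dvd_mult_right)
    then have "d dvd m" using cop by (metis coprime_commute coprime_dvd_mult_right_iff)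
    moreover have "p ^ multiplicity p x dvd p ^ b"
      using x d(1) cop(1) by (metis coprime_dvd_mult_left_iff dvd_mult_left)
    then have "multiplicity p x \<le> b" using p1 by (simp add: dvd_power_iff_le)
    ultimately show "x \<in> (\<lambda>(i, d). p ^ i * d) ` ({..b} \<times> {d. d dvd m})"
      using d(1) by (intro image_eqI[of _ _ "(multiplicity p x, d)"]) auto
  qed (auto intro!: mult_dvd_mono le_imp_power_dvd)
qed

lemma divisor_sum_prime_power_times:
  fixes p :: nat
  assumes p: "prime p" and m: "\<not> p dvd m" "m > 0"
  shows "divisor_sum f (p ^ b * m) = (\<Sum>i\<le>b. real (totient (p ^ i)) * divisor_sum (\<lambda>d. f (p ^ i * d)) m)"
proof -
  have tot: "totient (p ^ i * d) = totient (p ^ i) * totient d" if "d dvd m" for i d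
    using prime_power_part_coprime[OF p, of d i] m(1) that dvd_trans
    by (intro totient_mult_coprime) blast
  have "divisor_sum f (p ^ b * m) =
      (\<Sum>(i, d)\<in>{..b} \<times> {d. d dvd m}. real (totient (p ^ i * d)) * f (p ^ i * d))"
    unfolding divisor_sum_def
    by (subst sum.reindex_bij_betw[OF divisors_prime_power_times[OF assms], symmetric])
      (simp add: case_prod_unfold)
  also have "\<dots> = (\<Sum>(i, d)\<in>{..b} \<times> {d. d dvd m}. real (totient (p ^ i)) * (real (totient d) * f (p ^ i * d)))"
    by (intro sum.cong) (auto simp: tot)
  also have "\<dots> = (\<Sum>i\<le>b. real (totient (p ^ i)) * divisor_sum (\<lambda>d. f (p ^ i * d)) m)"
    using m(2) by (simp add: sum.cartesian_product[symmetric] divisor_sum_def sum_distrib_left)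
  finally show ?thesis .
qed

section \<open>Groups with a normal cyclic Sylow subgroup\<close>

text \<open>Each step multiplies y - 1 by 1 + y + ... + y^(p-1), which is congruent to p modulo p.\<close>
lemma cong_1_power_prime_power:
  fixes x :: int and p :: nat
  assumes "int p dvd x - 1"
  shows "int p ^ Suc i dvd x ^ (p ^ i) - 1"
proof (induction i)
  case 0
  then show ?case using assms by simp
next
  case (Suc i)
  define y where "y = x ^ (p ^ i)"
  have IH: "int p ^ Suc i dvd y - 1" using Suc by (simp add: y_def)
  then have "int p dvd y - 1" by (meson dvd_power dvd_trans zero_less_Suc)
  then have "[y = 1] (mod int p)" by (simp add: cong_iff_dvd_diff)
  then have "[(\<Sum>j<p. y ^ j) = (\<Sum>j<p. 1 ^ j)] (mod int p)"
    by (intro cong_sum cong_pow)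
  then have "int p dvd (\<Sum>j<p. y ^ j)"
    by (simp add: cong_dvd_iff)
  then have "int p ^ Suc i * int p dvd (y - 1) * (\<Sum>j<p. y ^ j)"
    using IH by (rule mult_dvd_mono[rotated])
  also have "(y - 1) * (\<Sum>j<p. y ^ j) = y ^ p - 1"
    by (simp add: power_diff_1_eq)
  also have "y ^ p = x ^ (p ^ Suc i)"
    by (simp add: y_def power_mult[symmetric] mult.commute)
  finally show ?case by (simp add: mult_ac)
qed

context group
begin

lemma conj_pow_iterate:
  assumes y: "y \<in> carrier G" and u: "u \<in> carrier G" and conj: "y \<otimes> u \<otimes> inv y = u [^] (k::nat)"
  shows "y [^] (n::nat) \<otimes> u \<otimes> inv (y [^] n) = u [^] (k ^ n)"
proof (induction n)
  case (Suc n)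
  have "y [^] Suc n \<otimes> u \<otimes> inv (y [^] Suc n) = y \<otimes> (y [^] n \<otimes> u \<otimes> inv (y [^] n)) \<otimes> inv y"
    using y u by (simp only: nat_pow_Suc2 inv_mult_group nat_pow_closed m_assoc m_closed inv_closed)
  also have "\<dots> = (y \<otimes> u \<otimes> inv y) [^] (k ^ n)"
    using Suc conj_pow[OF u y] by simp
  also have "\<dots> = u [^] (k ^ Suc n)"
    using conj u by (simp add: nat_pow_pow)
  finally show ?case .
qed (use u in simp)

lemma torsionD: "x \<in> torsion G d \<Longrightarrow> x [^] d = \<one>"
  by (simp add: torsion_def)

text \<open>An automorphism of order prime to p of a cyclic p-group that fixes a nontrivial element
is trivial: it is u \<mapsto> u^k with k = 1 modulo p, so its p^b-th power is the identity, and p^b is prime to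
its order.\<close>
lemma commute_if_fixes_power:
  assumes fin: "finite (carrier G)" and p: "prime p"
    and u: "u \<in> carrier G" "ord u = p ^ b" and y: "y \<in> carrier G" "\<not> p dvd ord y"
    and conj: "y \<otimes> u \<otimes> inv y = u [^] (k::nat)"
    and v: "u [^] (j::nat) \<noteq> \<one>" "y \<otimes> u [^] j = u [^] j \<otimes> y"
  shows "y \<otimes> u = u \<otimes> y"
proof -
  have "u [^] (k * j) = y \<otimes> u [^] j \<otimes> inv y"
    using conj conj_pow[OF u(1) y(1), of j] u(1) by (simp add: nat_pow_pow)
  also have "\<dots> = u [^] j"
    using conj_eq_iff[of "u [^] j" "u [^] j" y] v(2) u(1) y(1) by (simp only: nat_pow_closed)
  finally have "int (p ^ b) dvd int j - int (k * j)"
    using int_pow_eq[OF u(1), of "int (k * j)" "int j"] unfolding int_pow_int u(2) by blast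
  then have dvd: "int (p ^ b) dvd (int k - 1) * int j"
    by (subst dvd_minus_iff[symmetric]) (simp add: algebra_simps)
  have "int p dvd int k - 1"
  proof (rule ccontr)
    assume "\<not> int p dvd int k - 1"
    then have "coprime (int (p ^ b)) (int k - 1)"
      using p by (simp add: prime_imp_coprime)
    then have "int (p ^ b) dvd int j"
      using dvd by (simp add: coprime_dvd_mult_right_iff)
    then show False using v(1) u by (simp add: pow_eq_id del: of_nat_power)
  qed
  from cong_1_power_prime_power[OF this, of b]
  have "int p ^ b dvd int k ^ (p ^ b) - 1"
    by (metis dvd_mult_right power_Suc)
  then have "[int (k ^ (p ^ b)) = int 1] (mod int (ord u))"
    using u(2) by (simp add: cong_iff_dvd_diff)
  then have "[k ^ (p ^ b) = 1] (mod ord u)"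
    by (simp only: cong_int_iff)
  from pow_cong[OF u(1) this dvd_refl]
  have "y [^] (p ^ b) \<otimes> u \<otimes> inv (y [^] (p ^ b)) = u"
    using conj_pow_iterate[OF y(1) u(1) conj, of "p ^ b"] u(1) by simp
  then have com: "y [^] (p ^ b) \<otimes> u = u \<otimes> y [^] (p ^ b)"
    using u y conj_eq_iff[of u u "y [^] (p ^ b)"] by simp
  have "coprime (p ^ b) (ord y)" using prime_power_part_coprime[OF p y(2)] .
  then obtain t where t: "[p ^ b * t = 1] (mod ord y)"
    using cong_solve_coprime_nat unfolding One_nat_def by blast
  have "y = (y [^] (p ^ b)) [^] t"
    using pow_cong[OF y(1) t dvd_refl] y(1) by (simp add: nat_pow_pow)
  then show ?thesis
    using commute_pow[OF _ u(1) com, of t] y(1) by simp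
qed

end

lemma sum_totient_prime_powers:
  assumes "prime p"
  shows "(\<Sum>i\<le>b. totient (p ^ i)) = p ^ b"
proof (induction b)
  case (Suc b)
  have "(\<Sum>i\<le>Suc b. totient (p ^ i)) = p ^ b * Suc (p - 1)"
    using Suc by (simp only: sum.atMost_Suc totient_prime_power_Suc[OF assms] mult_Suc_right)
  then show ?case using prime_gt_0_nat[OF assms] by simp
qed simp

lemma divisor_sum_prime_power:
  assumes "prime p"
  shows "divisor_sum f (p ^ b) = (\<Sum>i\<le>b. real (totient (p ^ i)) * f (p ^ i))"
proof -
  have "{d. d dvd (1::nat)} = {1}" by auto
  then have "divisor_sum g 1 = g 1" for g by (simp add: divisor_sum_def)
  then show ?thesis
    using divisor_sum_prime_power_times[OF assms, of 1 f b] prime_gt_1_nat[OF assms] by simp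
qed

text \<open>The assumptions say that the solutions of x^(p^b) = 1 are exactly the powers of u. They form a
Sylow p-subgroup, and it is normal since conjugation preserves orders.\<close>
locale normal_cyclic_sylow = group +
  fixes p b m :: nat and u
  assumes fin: "finite (carrier G)" and p: "prime p" and b: "b > 0"
    and order_eq: "order G = p ^ b * m" and m: "\<not> p dvd m"
    and card_P: "card (torsion G (p ^ b)) = p ^ b"
    and u: "u \<in> carrier G" "ord u = p ^ b"
begin

abbreviation "P \<equiv> torsion G (p ^ b)"
abbreviation "Q \<equiv> G Mod P"

lemma m0: "m > 0" using m by (metis dvd_0_right not_gr0)

lemma P_powers: "P = (\<lambda>k. u [^] (k::nat)) ` {1..p ^ b}"
proof (rule card_subset_eq[symmetric])
  show "finite P" using fin torsion_subset finite_subset by blast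
  show "(\<lambda>k. u [^] (k::nat)) ` {1..p ^ b} \<subseteq> P"
    using u by (auto simp: torsion_def nat_pow_pow pow_eq_id)
  show "card ((\<lambda>k. u [^] (k::nat)) ` {1..p ^ b}) = card P"
    using ord_inj'[OF u(1)] u(2) card_P by (simp add: card_image)
qed

lemma powers_in_P: "u [^] (k::nat) \<in> P"
  using u by (simp add: torsion_def nat_pow_pow pow_eq_id)

lemma P_cases: "v \<in> P \<Longrightarrow> \<exists>k::nat. v = u [^] k"
  unfolding P_powers by blast

lemma P_commute: "v \<in> P \<Longrightarrow> w \<in> P \<Longrightarrow> v \<otimes> w = w \<otimes> v"
  using P_cases[of v] P_cases[of w] u by (auto simp: nat_pow_mult add.commute)

lemma subgroup_P: "subgroup P G"
proof
  show "P \<subseteq> carrier G" by (rule torsion_subset)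
  show "\<one> \<in> P" by (simp add: torsion_def)
  fix x assume x: "x \<in> P"
  then show "inv x \<in> P" by (simp add: in_torsion_iff)
  fix y assume "y \<in> P"
  then show "x \<otimes> y \<in> P"
    using x P_cases[of x] P_cases[of y] powers_in_P u by (auto simp: nat_pow_mult)
qed

lemma normal_P: "P \<lhd> G"
  using subgroup_P by (rule normal_invI) (simp add: in_torsion_iff ord_conj)

sublocale P: normal P G by (rule normal_P)

sublocale Q: group Q by (rule P.factorgroup_is_group)

lemma finite_Q: "finite (carrier Q)"
  using fin by (simp add: FactGroup_def RCOSETS_def)

lemma order_Q: "order Q = m"
proof -
  have "card P * card (rcosets P) = order G" using lagrange[OF subgroup_P] by (simp add: mult.commute)
  then have "p ^ b * card (rcosets P) = p ^ b * m" unfolding card_P order_eq .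
  then show ?thesis using prime_gt_0_nat[OF p] by (simp add: order_def FactGroup_def)
qed

lemma coset_in_Q: "z \<in> carrier G \<Longrightarrow> P #> z \<in> carrier Q"
  by (simp add: carrier_FactGroup)

lemma pow_in_P_iff:
  assumes "z \<in> carrier G" shows "z [^] (n::nat) \<in> P \<longleftrightarrow> Q.ord (P #> z) dvd n"
proof -
  have "z [^] n \<in> P \<longleftrightarrow> P #> (z [^] n) = P"
    using coset_join1[OF _ nat_pow_closed[OF assms] subgroup_P]
      coset_join2[OF nat_pow_closed[OF assms] subgroup_P] by blast
  also have "\<dots> \<longleftrightarrow> (P #> z) [^]\<^bsub>Q\<^esub> n = \<one>\<^bsub>Q\<^esub>"
    using P.FactGroup_pow[OF assms] by simp
  finally show ?thesis using Q.pow_eq_id[OF coset_in_Q[OF assms]] by simp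
qed

text \<open>An element of order prime to p has the least order possible in its coset.\<close>
lemma ord_coprime_eq:
  assumes z: "z \<in> carrier G" and cop: "\<not> p dvd ord z"
  shows "ord z = Q.ord (P #> z)"
proof (rule dvd_antisym)
  have "z [^] Q.ord (P #> z) \<in> P" by (simp add: pow_in_P_iff z)
  then have "(z [^] Q.ord (P #> z)) [^] (p ^ b) = \<one>" by (rule torsionD)
  then have "z [^] (Q.ord (P #> z) * p ^ b) = \<one>" using z by (simp only: nat_pow_pow)
  then have "ord z dvd Q.ord (P #> z) * p ^ b" using z by (simp add: pow_eq_id)
  moreover have "coprime (ord z) (p ^ b)" using prime_power_part_coprime[OF p cop] by (simp add: coprime_commute)
  ultimately show "ord z dvd Q.ord (P #> z)" by (simp add: coprime_dvd_mult_left_iff)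
  have "z [^] ord z \<in> P" using pow_ord_eq_1[OF z] P.one_closed by simp
  then show "Q.ord (P #> z) dvd ord z" unfolding pow_in_P_iff[OF z] .
qed

lemma coset_eq_imp:
  assumes "z \<in> carrier G" "y \<in> P #> z" shows "y \<in> carrier G" "P #> y = P #> z"
  using assms repr_independence[OF assms(2,1) subgroup_P] torsion_subset r_coset_subset_G by blast+

lemma coset_decomposition:
  assumes z: "z \<in> carrier G"
  obtains v y where "z = v \<otimes> y" "v \<in> P" "y \<in> carrier G" "\<not> p dvd ord y" "v \<otimes> y = y \<otimes> v"
    "P #> y = P #> z"
proof -
  have "z \<in> torsion G (p ^ b * m)"
    using z ord_dvd_group_order[OF z] by (simp add: in_torsion_iff order_eq)
  then obtain i j :: nat where ij: "z = z [^] i \<otimes> z [^] j" "z [^] i \<in> P" "z [^] j \<in> torsion G m"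
    using coprime_parts[OF prime_power_part_coprime[OF p m]] by metis
  have "z [^] i \<otimes> z [^] j = z [^] j \<otimes> z [^] i" using z by (simp add: nat_pow_mult add.commute)
  moreover have "ord (z [^] j) dvd m" using ij(3) by (simp add: in_torsion_iff)
  then have "\<not> p dvd ord (z [^] j)" using m by (meson dvd_trans)
  moreover have "z \<in> P #> (z [^] j)" using ij(1,2) unfolding r_coset_def by blast
  then have "P #> (z [^] j) = P #> z" using coset_eq_imp(2)[OF nat_pow_closed[OF z]] by blast
  ultimately show ?thesis using that[OF ij(1,2) nat_pow_closed[OF z]] by blast
qed

lemma conj_u:
  assumes "y \<in> carrier G" obtains k :: nat where "y \<otimes> u \<otimes> inv y = u [^] k"
proof -
  have "y \<otimes> u \<otimes> inv y \<in> P" using assms u by (simp add: in_torsion_iff ord_conj)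
  then show ?thesis using P_cases that by blast
qed

text \<open>The sum of f over the orders in a coset of order s that contains an element of order s
centralizing P: such orders are s times the orders in P.\<close>
definition order_distribution :: "(nat \<Rightarrow> real) \<Rightarrow> nat \<Rightarrow> real" where
  "order_distribution f s = (\<Sum>i\<le>b. real (totient (p ^ i)) * f (p ^ i * s))"

text \<open>The coset contains an element y of order prime to p. If y commutes with u, then the coset
consists of the products v y with v in P, and orders multiply. Otherwise no element of order prime to p
in the coset commutes with any nontrivial element of P, so every element of the coset equals its
own p'-part.\<close>
lemma coset_dichotomy:
  assumes X: "X \<in> carrier Q"
  obtains (central) z where "z \<in> X" "ord z = p ^ b * Q.ord X"
      "\<And>f. (\<Sum>z\<in>X. f (ord z)) = order_distribution f (Q.ord X)"
    | (free) "\<And>z. z \<in> X \<Longrightarrow> ord z = Q.ord X"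
proof -
  obtain x where x: "x \<in> carrier G" "X = P #> x" using X by (auto simp: carrier_FactGroup)
  obtain y where y: "y \<in> carrier G" "\<not> p dvd ord y" "P #> y = P #> x"
    using coset_decomposition[OF x(1)] by metis
  have Xy: "X = P #> y" and sy: "ord y = Q.ord X"
    using x y ord_coprime_eq[OF y(1,2)] by auto
  show ?thesis
  proof (cases "y \<otimes> u = u \<otimes> y")
    case True
    have com: "v \<otimes> y = y \<otimes> v" if "v \<in> P" for v
      using P_cases[OF that] commute_pow[OF u(1) y(1) True[symmetric]] by auto
    have ord_vy: "ord (v \<otimes> y) = ord v * ord y" if v: "v \<in> P" for v
    proof (rule ord_mult_coprime)
      show "coprime (ord v) (ord y)"
        using v by (intro coprime_divisors[OF _ dvd_refl prime_power_part_coprime[OF p y(2), of b]])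
          (simp add: in_torsion_iff)
    qed (use v y com torsion_subset in auto)
    have X_img: "X = (\<lambda>v. v \<otimes> y) ` P" unfolding Xy r_coset_def by auto
    have inj: "inj_on (\<lambda>v. v \<otimes> y) P"
      using inj_on_multc[OF y(1)] torsion_subset by (rule inj_on_subset)
    have "(\<Sum>z\<in>X. f (ord z)) = order_distribution f (Q.ord X)" for f
    proof -
      have "(\<Sum>z\<in>X. f (ord z)) = (\<Sum>v\<in>P. f (ord v * Q.ord X))"
        unfolding X_img sum.reindex[OF inj] by (simp add: ord_vy sy X_img[symmetric])
      also have "\<dots> = divisor_sum (\<lambda>d. f (d * Q.ord X)) (p ^ b)"
        using ord_sum_powers[OF fin u(1), of "\<lambda>d. f (d * Q.ord X)"] u(2) P_powers by simp
      finally show ?thesis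
        by (simp add: divisor_sum_prime_power[OF p] order_distribution_def)
    qed
    moreover have "u \<otimes> y \<in> X" using powers_in_P[of 1] u unfolding X_img by auto
    moreover have "ord (u \<otimes> y) = p ^ b * Q.ord X" using ord_vy[of u] powers_in_P[of 1] u sy by simp
    ultimately show ?thesis using central by blast
  next
    case False
    have "ord z = Q.ord X" if z: "z \<in> X" for z
    proof -
      have zc: "z \<in> carrier G" and Pz: "P #> z = X" using coset_eq_imp[OF x(1)] z x(2) by auto
      obtain v w where vw: "z = v \<otimes> w" "v \<in> P" "w \<in> carrier G" "\<not> p dvd ord w" "v \<otimes> w = w \<otimes> v"
          "P #> w = P #> z"
        using coset_decomposition[OF zc] by metis
      have "w \<in> P #> y" using rcos_self[OF vw(3) subgroup_P] vw(6) Pz Xy by simp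
      then obtain c where c: "c \<in> P" "w = c \<otimes> y" unfolding r_coset_def by blast
      have cc: "c \<in> carrier G" using c torsion_subset by blast
      have nw: "w \<otimes> u \<noteq> u \<otimes> w"
      proof
        assume "w \<otimes> u = u \<otimes> w"
        then have "c \<otimes> (y \<otimes> u) = (u \<otimes> c) \<otimes> y" using c cc y u by (simp add: m_assoc)
        also have "u \<otimes> c = c \<otimes> u" using P_commute[of u c] c powers_in_P[of 1] u by simp
        finally have "c \<otimes> (y \<otimes> u) = c \<otimes> (u \<otimes> y)" using cc y u by (simp add: m_assoc)
        then show False using False cc y u by simp
      qed
      have "v = \<one>"
      proof (rule ccontr)
        assume v1: "v \<noteq> \<one>"
        obtain j :: nat where j: "v = u [^] j" using P_cases[OF vw(2)] by blast
        obtain k :: nat where k: "w \<otimes> u \<otimes> inv w = u [^] k" using conj_u[OF vw(3)] .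
        show False
          using commute_if_fixes_power[OF fin p u vw(3,4) k, of j] v1 vw(5) j nw by simp
      qed
      then have "z = w" using vw by simp
      then show ?thesis using ord_coprime_eq[OF vw(3,4)] Pz by simp
    qed
    then show ?thesis using free by blast
  qed
qed

lemma ord_sum_cosets: "ord_sum f G = (\<Sum>X\<in>carrier Q. \<Sum>z\<in>X. f (ord z))"
proof -
  have "{z \<in> carrier G. P #> z = X} = X" if X: "X \<in> carrier Q" for X
  proof -
    obtain x where x: "x \<in> carrier G" "X = P #> x" using X by (auto simp: carrier_FactGroup)
    show ?thesis
    proof (intro equalityI subsetI)
      fix z assume "z \<in> {z \<in> carrier G. P #> z = X}"
      then show "z \<in> X" using rcos_self[OF _ subgroup_P] by blast
    qed (use coset_eq_imp[OF x(1)] x(2) in blast)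
  qed
  then show ?thesis
    unfolding ord_sum_def sum.image_gen[OF fin, of _ "\<lambda>z. P #> z"]
    by (intro sum.cong) (auto simp: carrier_FactGroup)
qed

lemma card_coset: "X \<in> carrier Q \<Longrightarrow> card X = p ^ b"
  using card_rcosets_equal[of X P] torsion_subset card_P by (simp add: FactGroup_def)

lemma sum_order_distribution:
  "(\<Sum>X\<in>carrier Q. order_distribution f (Q.ord X)) =
    (\<Sum>i\<le>b. real (totient (p ^ i)) * ord_sum (\<lambda>d. f (p ^ i * d)) Q)"
  unfolding order_distribution_def ord_sum_def sum_distrib_left by (rule sum.swap)

lemma real_sum_totient: "(\<Sum>i\<le>b. real (totient (p ^ i))) = real (p ^ b)"
  using sum_totient_prime_powers[OF p, of b] by (metis of_nat_sum)

text \<open>Replacing each coset sum by the order distribution of a centralizing coset bounds the sum by a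
combination of sums over the quotient Q. If Q is not cyclic, the bound for Q gains on all
terms i = 0, ..., b, while only the gain of the term i = b is needed. If Q is cyclic, its generators are
cosets in which all orders equal m, because a centralizing coset of order m would contain a generator of G; there
orders drop from m p^i to m, which for i = b is more than the required drop to m p^b / q as q < p^b.\<close>
lemma ord_sum_less:
  fixes f :: "nat \<Rightarrow> real"
  assumes mono: "\<And>x y. 0 < x \<Longrightarrow> x < y \<Longrightarrow> f x < f y"
    and q: "1 < q" "q < p" "q dvd m"
    and noncyclic: "\<And>z. z \<in> carrier G \<Longrightarrow> ord z \<noteq> order G"
    and quotient: "cyclic_group Q \<or>
      (\<forall>i\<le>b. ord_sum (\<lambda>d. f (p ^ i * d)) Q \<le> noncyclic_bound (\<lambda>d. f (p ^ i * d)) m q)"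
  shows "ord_sum f G < noncyclic_bound f (order G) q"
proof -
  define t where "t i = real (totient (p ^ i))" for i
  have p0: "p > 0" using p prime_gt_0_nat by blast
  have t_pos: "t i > 0" for i using p0 by (simp add: t_def)
  have mq: "0 < m div q" "m div q < m"
    using q m0 by (auto simp: dvd_imp_le intro: div_greater_zero_iff[THEN iffD2])
  have mono_le: "f x \<le> f y" if "0 < x" "x \<le> y" for x y using mono[of x y] that by (cases "x = y") auto
  have divq: "order G div q = p ^ b * (m div q)"
    using q(3) order_eq by (simp add: div_mult_swap)
  have tot: "real (totient (order G)) = t b * real (totient m)"
    unfolding order_eq t_def by (subst totient_mult_coprime[OF prime_power_part_coprime[OF p m]]) simp
  have ordX: "Q.ord X > 0" if "X \<in> carrier Q" for X using Q.ord_ge_1[OF finite_Q that] by simp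
  have coset_le: "(\<Sum>z\<in>X. f (ord z)) \<le> order_distribution f (Q.ord X)" if X: "X \<in> carrier Q" for X
    using X
  proof (cases rule: coset_dichotomy)
    case free
    have "(\<Sum>z\<in>X. f (ord z)) = real (p ^ b) * f (Q.ord X)"
      using free card_coset[OF X] by simp
    also have "\<dots> = (\<Sum>i\<le>b. t i * f (Q.ord X))"
      unfolding t_def sum_distrib_right[symmetric] real_sum_totient ..
    also have "\<dots> \<le> order_distribution f (Q.ord X)"
      unfolding order_distribution_def t_def
      using p0 ordX[OF X] by (intro sum_mono mult_left_mono mono_le) auto
    finally show ?thesis .
  qed simp
  have D: "divisor_sum f (order G) = (\<Sum>i\<le>b. t i * divisor_sum (\<lambda>d. f (p ^ i * d)) m)"
    unfolding order_eq t_def by (rule divisor_sum_prime_power_times[OF p m m0])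
  show ?thesis
  proof (cases "cyclic_group Q")
    case True
    define gens where "gens = {X \<in> carrier Q. Q.ord X = m}"
    have card_gens: "card gens = totient m"
    proof -
      obtain X where X: "X \<in> carrier Q" "Q.ord X = m"
        using True Q.cyclic_group_iff_ord[OF finite_Q] order_Q by auto
      have "gens = (\<lambda>k. X [^]\<^bsub>Q\<^esub> k) ` {k \<in> {1..Q.ord X}. coprime k (Q.ord X)}"
      proof (intro equalityI subsetI)
        fix Y assume Y: "Y \<in> gens"
        then have "Y \<in> (\<lambda>k. X [^]\<^bsub>Q\<^esub> (k::nat)) ` {1..m}"
          using Q.powers_eq_carrier[OF finite_Q X(1)] X order_Q by (simp add: gens_def)
        then obtain k where "k \<in> {1..m}" "Y = X [^]\<^bsub>Q\<^esub> k" by blast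
        moreover from this Y have "coprime k m"
          using Q.pow_ord_eq_ord_iff[OF finite_Q X(1), of k] X by (simp add: gens_def)
        ultimately show "Y \<in> (\<lambda>k. X [^]\<^bsub>Q\<^esub> k) ` {k \<in> {1..Q.ord X}. coprime k (Q.ord X)}"
          using X by auto
      qed (use X Q.ord_pow_coprime[OF finite_Q X(1)] in \<open>auto simp: gens_def\<close>)
      then show ?thesis using Q.card_coprime_powers[OF finite_Q X(1)] X by simp
    qed
    have gen_free: "(\<Sum>z\<in>X. f (ord z)) = real (p ^ b) * f m" if X: "X \<in> gens" for X
    proof -
      have Xc: "X \<in> carrier Q" and Xm: "Q.ord X = m" using X by (auto simp: gens_def)
      from Xc show ?thesis
      proof (cases rule: coset_dichotomy)
        case (central z)
        obtain x where "x \<in> carrier G" "X = P #> x" using Xc by (auto simp: carrier_FactGroup)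
        then have "z \<in> carrier G" using central(1) coset_eq_imp(1) by blast
        then show ?thesis using central(2) noncyclic[of z] Xm order_eq by simp
      next
        case free
        then show ?thesis using card_coset[OF Xc] Xm by simp
      qed
    qed
    have "ord_sum f G = (\<Sum>X\<in>carrier Q - gens. \<Sum>z\<in>X. f (ord z)) + (\<Sum>X\<in>gens. \<Sum>z\<in>X. f (ord z))"
      unfolding ord_sum_cosets using finite_Q by (intro sum.subset_diff) (auto simp: gens_def)
    also have "\<dots> \<le> (\<Sum>X\<in>carrier Q - gens. order_distribution f (Q.ord X)) + (\<Sum>X\<in>gens. real (p ^ b) * f m)"
      using coset_le gen_free by (intro add_mono sum_mono) auto
    also have "(\<Sum>X\<in>carrier Q - gens. order_distribution f (Q.ord X)) =
        (\<Sum>X\<in>carrier Q. order_distribution f (Q.ord X)) - (\<Sum>X\<in>gens. order_distribution f (Q.ord X))"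
      using finite_Q by (intro sum_diff) (auto simp: gens_def)
    also have "(\<Sum>X\<in>gens. order_distribution f (Q.ord X)) = real (totient m) * order_distribution f m"
      using card_gens by (simp add: gens_def)
    also have "(\<Sum>X\<in>gens. real (p ^ b) * f m) = real (totient m) * (real (p ^ b) * f m)"
      using card_gens by simp
    also have "(\<Sum>X\<in>carrier Q. order_distribution f (Q.ord X)) = divisor_sum f (order G)"
      unfolding sum_order_distribution D t_def
      using Q.ord_sum_cyclic[OF finite_Q True] order_Q by simp
    finally have "ord_sum f G \<le> divisor_sum f (order G) - real (totient m) * (order_distribution f m - real (p ^ b) * f m)"
      by (simp add: algebra_simps)
    moreover have "t b * (f (order G) - f (order G div q)) < order_distribution f m - real (p ^ b) * f m"
    proof -
      \<comment> \<open>q < p^b gives m < p^b (m / q).\<close>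
      have "q < p ^ b" using q(2) b p0 self_le_power[of p b] by (simp add: order_less_le_trans)
      then have "m < order G div q"
        using mq(1) q unfolding divq by (metis dvd_mult_div_cancel mult_strict_right_mono)
      then have "t b * (f (order G) - f (order G div q)) < t b * (f (p ^ b * m) - f m)"
        using t_pos[of b] m0 mono unfolding order_eq by simp
      also have "\<dots> \<le> (\<Sum>i\<le>b. t i * (f (p ^ i * m) - f m))"
        by (rule member_le_sum) (use t_pos p0 m0 in \<open>auto intro!: mult_nonneg_nonneg mono_le simp: less_imp_le\<close>)
      also have "\<dots> = order_distribution f m - real (p ^ b) * f m"
        unfolding order_distribution_def real_sum_totient[symmetric]
        by (simp add: t_def algebra_simps sum_subtractf sum_distrib_left)
      finally show ?thesis .
    qed
    then have "real (totient m) * (t b * (f (order G) - f (order G div q))) <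
        real (totient m) * (order_distribution f m - real (p ^ b) * f m)"
      using m0 by simp
    ultimately show ?thesis unfolding noncyclic_bound_def tot by (simp add: mult_ac)
  next
    case False
    define gap where "gap i = f (p ^ i * m) - f (p ^ i * (m div q))" for i
    have gap_pos: "gap i > 0" for i
      unfolding gap_def using mq p0 mono[of "p ^ i * (m div q)" "p ^ i * m"] by simp
    have "ord_sum f G \<le> (\<Sum>X\<in>carrier Q. order_distribution f (Q.ord X))"
      unfolding ord_sum_cosets using coset_le by (rule sum_mono)
    also have "\<dots> \<le> (\<Sum>i\<le>b. t i * (divisor_sum (\<lambda>d. f (p ^ i * d)) m - real (totient m) * gap i))"
      unfolding sum_order_distribution t_def gap_def
      using quotient False by (intro sum_mono mult_left_mono) (auto simp: noncyclic_bound_def)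
    also have "\<dots> = divisor_sum f (order G) - real (totient m) * (\<Sum>i\<le>b. t i * gap i)"
      unfolding D by (simp add: algebra_simps sum_subtractf sum_distrib_left)
    also have "\<dots> < divisor_sum f (order G) - real (totient m) * (t b * gap b)"
    proof -
      have "t b * gap b < t 0 * gap 0 + t b * gap b" using t_pos[of 0] gap_pos[of 0] by simp
      also have "\<dots> = (\<Sum>i\<in>{0, b}. t i * gap i)" using b by simp
      also have "\<dots> \<le> (\<Sum>i\<le>b. t i * gap i)"
        using t_pos gap_pos by (intro sum_mono2) (auto intro!: mult_nonneg_nonneg simp: less_imp_le)
      finally show ?thesis using m0 by simp
    qed
    finally show ?thesis
      unfolding noncyclic_bound_def tot divq by (simp add: gap_def order_eq mult_ac)
  qed
qed

end

section \<open>Groups of prime power order\<close>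

lemma prime_power_sum_by_parts:
  fixes f :: "nat \<Rightarrow> real"
  assumes p: "prime p"
  shows "(\<Sum>i\<le>c. real (totient (p ^ i)) * f (p ^ i)) =
    real (p ^ c) * f (p ^ c) - (\<Sum>i<c. (f (p ^ Suc i) - f (p ^ i)) * real (p ^ i))"
proof (induction c)
  case (Suc c)
  have t: "real (totient (p ^ Suc c)) = real (p ^ Suc c) - real (p ^ c)"
    unfolding totient_prime_power_Suc[OF p] using prime_gt_0_nat[OF p]
    by (simp add: of_nat_diff algebra_simps)
  show ?case unfolding sum.atMost_Suc sum.lessThan_Suc Suc t by (simp add: algebra_simps)
qed simp

context group
begin

lemma card_torsion_ge:
  assumes fin: "finite (carrier G)" and d: "d dvd order G"
  shows "d \<le> card (torsion G d)"
proof (rule dvd_imp_le)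
  show "d dvd card (torsion G d)" using frobenius_solutions[OF is_group fin d] .
  have "\<one> \<in> torsion G d" by (simp add: torsion_def)
  moreover have "finite (torsion G d)" using fin torsion_subset finite_subset by blast
  ultimately show "0 < card (torsion G d)" by (auto simp: card_gt_0_iff)
qed

lemma prime_power_group_ord:
  assumes p: "prime p" and ord_G: "order G = p ^ a" and a: "a > 0"
    and noncyclic: "\<And>z. z \<in> carrier G \<Longrightarrow> ord z \<noteq> order G" and z: "z \<in> carrier G"
  obtains v where "v \<le> a - 1" "ord z = p ^ v"
proof -
  have "ord z dvd p ^ a" using ord_dvd_group_order[OF z] ord_G by simp
  then obtain v where v: "v \<le> a" "ord z = p ^ v" using divides_primepow_nat[OF p] by blast
  moreover have "v \<noteq> a" using noncyclic[OF z] ord_G v by auto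
  ultimately show ?thesis using that[of v] by auto
qed

text \<open>Abel summation: with c = a - 1 and an increasing f, the sum equals p^a f(p^c) minus the sum of
(f(p^(i+1)) - f(p^i)) times the number of solutions of x^(p^i) = 1, over i < c. By Frobenius' theorem each of these
numbers is at least p^i, and the bound is the same expression with p^i in their place.\<close>
lemma ord_sum_prime_power_group:
  fixes f :: "nat \<Rightarrow> real"
  assumes fin: "finite (carrier G)" and p: "prime p" and ord_G: "order G = p ^ a" and a: "a > 0"
    and noncyclic: "\<And>z. z \<in> carrier G \<Longrightarrow> ord z \<noteq> order G"
    and mono: "\<And>x y. 0 < x \<Longrightarrow> x < y \<Longrightarrow> f x < f y"
  defines "target \<equiv> noncyclic_bound f (order G) p"
  shows "ord_sum f G \<le> target"
    "ord_sum f G = target \<longleftrightarrow> (\<forall>i<a - 1. card (torsion G (p ^ i)) = p ^ i)"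
proof -
  define \<Delta> where "\<Delta> i = f (p ^ Suc i) - f (p ^ i)" for i
  define c where "c = a - 1"
  have ac: "a = Suc c" using a by (simp add: c_def)
  have p1: "p > 1" using prime_gt_1_nat[OF p] .
  have D_pos: "\<Delta> i > 0" for i
    unfolding \<Delta>_def using mono[of "p ^ i" "p ^ Suc i"] p1 by simp
  have tele: "f (p ^ v) = f (p ^ c) - (\<Sum>i<c. if v \<le> i then \<Delta> i else 0)" if "v \<le> c" for v
    using that
  proof (induction c rule: dec_induct)
    case base
    have "(\<Sum>i<v. if v \<le> i then \<Delta> i else 0) = 0" by (rule sum.neutral) auto
    then show ?case by simp
  next
    case (step n)
    then show ?case by (simp add: \<Delta>_def)
  qed
  have pointwise: "f (ord z) = f (p ^ c) - (\<Sum>i<c. if z \<in> torsion G (p ^ i) then \<Delta> i else 0)"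
    if z: "z \<in> carrier G" for z
  proof -
    obtain v where v: "v \<le> c" "ord z = p ^ v"
      using prime_power_group_ord[OF p ord_G a noncyclic z] unfolding c_def by metis
    have "z \<in> torsion G (p ^ i) \<longleftrightarrow> v \<le> i" for i
      using z v p1 by (simp add: in_torsion_iff dvd_power_iff_le)
    then show ?thesis using tele[OF v(1)] v(2) by simp
  qed
  have "ord_sum f G = (\<Sum>z\<in>carrier G. f (p ^ c)) -
      (\<Sum>z\<in>carrier G. \<Sum>i<c. if z \<in> torsion G (p ^ i) then \<Delta> i else 0)"
    unfolding ord_sum_def sum_subtractf[symmetric] by (intro sum.cong refl pointwise)
  also have "(\<Sum>z\<in>carrier G. f (p ^ c)) = real (p ^ a) * f (p ^ c)"
    using ord_G by (simp add: order_def)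
  also have "(\<Sum>z\<in>carrier G. \<Sum>i<c. if z \<in> torsion G (p ^ i) then \<Delta> i else 0) =
      (\<Sum>i<c. \<Sum>z\<in>carrier G. if z \<in> torsion G (p ^ i) then \<Delta> i else 0)"
    by (rule sum.swap)
  also have "\<dots> = (\<Sum>i<c. \<Delta> i * real (card (torsion G (p ^ i))))"
    using fin torsion_subset
    by (intro sum.cong refl) (simp add: sum.inter_restrict[symmetric] Int_absorb1)
  finally have S: "ord_sum f G = real (p ^ a) * f (p ^ c) - (\<Sum>i<c. \<Delta> i * real (card (torsion G (p ^ i))))" .
  have t: "real (totient (p ^ a)) = real (p ^ a) - real (p ^ c)"
    unfolding ac totient_prime_power_Suc[OF p] using p1 by (simp add: of_nat_diff algebra_simps)
  have d: "order G div p = p ^ c" using ord_G p1 by (simp add: ac)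
  have "divisor_sum f (p ^ a) =
      (\<Sum>i\<le>c. real (totient (p ^ i)) * f (p ^ i)) + real (totient (p ^ a)) * f (p ^ a)"
    unfolding divisor_sum_prime_power[OF p] ac by simp
  then have "target = real (p ^ a) * f (p ^ c) - (\<Sum>i<c. \<Delta> i * real (p ^ i))"
    unfolding target_def noncyclic_bound_def d unfolding ord_G t prime_power_sum_by_parts[OF p] \<Delta>_def
    by (simp add: algebra_simps)
  then have diff: "target - ord_sum f G = (\<Sum>i<c. \<Delta> i * (real (card (torsion G (p ^ i))) - real (p ^ i)))"
    unfolding S by (simp add: sum_subtractf algebra_simps)
  have nonneg: "0 \<le> \<Delta> i * (real (card (torsion G (p ^ i))) - real (p ^ i))" if "i < c" for i
  proof -
    have "p ^ i dvd order G" unfolding ord_G ac using that by (intro le_imp_power_dvd) simp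
    then have "real (p ^ i) \<le> real (card (torsion G (p ^ i)))"
      using card_torsion_ge[OF fin] of_nat_le_iff by blast
    then show ?thesis using D_pos[of i] by simp
  qed
  have "0 \<le> target - ord_sum f G"
    unfolding diff using nonneg by (intro sum_nonneg) simp
  then show "ord_sum f G \<le> target" by simp
  have "ord_sum f G = target \<longleftrightarrow> target - ord_sum f G = 0" by auto
  also have "\<dots> \<longleftrightarrow> (\<forall>i<c. \<Delta> i * (real (card (torsion G (p ^ i))) - real (p ^ i)) = 0)"
    unfolding diff using nonneg by (subst sum_nonneg_eq_0_iff) auto
  also have "\<dots> \<longleftrightarrow> (\<forall>i<c. card (torsion G (p ^ i)) = p ^ i)"
    using D_pos by (intro all_cong) (simp add: less_imp_neq[symmetric] del: of_nat_power)
  finally show "ord_sum f G = target \<longleftrightarrow> (\<forall>i<a - 1. card (torsion G (p ^ i)) = p ^ i)"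
    unfolding c_def .
qed

lemma card_torsion_iso:
  assumes "G \<cong> H" "group H"
  shows "card (torsion H d) = card (torsion G d)"
proof -
  interpret H: group H by fact
  obtain h where h: "bij_betw h (carrier G) (carrier H)" "\<And>x. x \<in> carrier G \<Longrightarrow> group.ord H (h x) = ord x"
    using ord_image_iso[OF assms] by blast
  have "h ` torsion G d = torsion H d"
  proof (intro equalityI subsetI)
    fix x assume x: "x \<in> torsion H d"
    then obtain y where "y \<in> carrier G" "x = h y"
      using h(1) by (auto simp: H.in_torsion_iff bij_betw_def)
    then show "x \<in> h ` torsion G d" using x h(2) by (simp add: in_torsion_iff H.in_torsion_iff)
  next
    fix x assume "x \<in> h ` torsion G d"
    then obtain y where "y \<in> torsion G d" "x = h y" by blast
    then show "x \<in> torsion H d"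
      using h(2) bij_betwE[OF h(1)] by (simp add: in_torsion_iff H.in_torsion_iff)
  qed
  moreover have "inj_on h (torsion G d)"
    using bij_betw_imp_inj_on[OF h(1)] torsion_subset by (rule inj_on_subset)
  ultimately show ?thesis using card_image[of h "torsion G d"] by simp
qed

lemma inv_pow_is_pow:
  assumes w: "w \<in> carrier G" and fin: "finite (carrier G)"
  shows "inv (w [^] (k::nat)) \<in> range (\<lambda>k::nat. w [^] k)"
proof -
  have "w [^] (k * (ord w - 1)) \<otimes> w [^] k = w [^] (k * ord w)"
    using ord_ge_1[OF fin w] w by (simp add: nat_pow_mult algebra_simps)
  also have "\<dots> = \<one>" using w by (simp add: pow_eq_id)
  finally have "inv (w [^] k) = w [^] (k * (ord w - 1))"
    using w by (intro inv_equality) auto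
  then show ?thesis by blast
qed

lemma power_generates:
  assumes "finite (carrier G)" "w \<in> carrier G" "coprime k (ord w)"
  obtains t :: nat where "w = (w [^] (k::nat)) [^] t"
proof -
  obtain t where t: "[k * t = 1] (mod ord w)"
    using cong_solve_coprime_nat[OF assms(3)] unfolding One_nat_def by blast
  then have "w = (w [^] k) [^] t"
    using pow_cong[OF assms(2) t dvd_refl] assms(2) by (simp add: nat_pow_pow)
  then show ?thesis using that by blast
qed

text \<open>The p^c p products are distinct: an equality between two of them would put a power of w' with
exponent prime to p, and hence w' itself, among the powers of w.\<close>
lemma products_of_powers_cover:
  assumes fin: "finite (carrier G)" and p: "prime p" and ord_G: "order G = p ^ Suc c"
    and w: "w \<in> carrier G" "ord w = p ^ c" and w': "w' \<in> carrier G" "w' \<notin> range (\<lambda>k::nat. w [^] k)"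
    and g: "g \<in> carrier G"
  obtains k i where "k < p ^ c" "i < p" "g = w [^] (k::nat) \<otimes> w' [^] (i::nat)"
proof -
  let ?h = "\<lambda>(k::nat, i::nat). w [^] k \<otimes> w' [^] i"
  have ord_w': "\<exists>l. ord w' = p ^ l"
    using ord_dvd_group_order[OF w'(1)] divides_primepow_nat[OF p] unfolding ord_G by blast
  have no: False if "w [^] (k::nat) = w [^] (l::nat) \<otimes> w' [^] d" "0 < d" "d < p" for k l d
  proof -
    have "\<not> p dvd d" using that by (auto dest: dvd_imp_le)
    then have "coprime d (ord w')"
      using ord_w' prime_power_part_coprime[OF p] by (auto simp: coprime_commute)
    then obtain t :: nat where t: "w' = (w' [^] d) [^] t" using power_generates[OF fin w'(1)] by blast
    obtain m :: nat where m: "inv (w [^] l) = w [^] m" using inv_pow_is_pow[OF w(1) fin, of l] by blast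
    have "w [^] m \<otimes> w [^] k = inv (w [^] l) \<otimes> (w [^] l \<otimes> w' [^] d)"
      unfolding m[symmetric] that(1) ..
    then have "w' [^] d = w [^] (m + k)" using w w' by (simp add: nat_pow_mult)
    then have "w' = w [^] ((m + k) * t)" using t w by (simp add: nat_pow_pow)
    then show False using w'(2) by blast
  qed
  have "inj_on ?h ({..<p ^ c} \<times> {..<p})"
  proof (rule inj_onI, clarify)
    fix k i l j assume *: "k < p ^ c" "i < p" "l < p ^ c" "j < p"
      and eq: "w [^] k \<otimes> w' [^] i = w [^] l \<otimes> w' [^] j"
    have aux: False if "w [^] k \<otimes> w' [^] i = w [^] l \<otimes> w' [^] j" "i < j" "j < p" for k l :: nat and i j
    proof -
      have "w [^] k \<otimes> w' [^] i = (w [^] l \<otimes> w' [^] (j - i)) \<otimes> w' [^] i"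
        using that w w' by (simp add: m_assoc nat_pow_mult)
      then have "w [^] k = w [^] l \<otimes> w' [^] (j - i)" using w w' by simp
      then show False by (rule no) (use that in auto)
    qed
    have ij: "i = j" using aux[OF eq] aux[OF eq[symmetric]] * by (metis linorder_less_linear)
    then have "w [^] k = w [^] l" using eq w w' by simp
    then have "k = l"
      using ord_inj[OF w(1)] * w(2) by (auto simp: inj_on_def)
    then show "k = l \<and> i = j" using ij by simp
  qed
  moreover have "?h ` ({..<p ^ c} \<times> {..<p}) \<subseteq> carrier G" using w w' by auto
  moreover have "card ({..<p ^ c} \<times> {..<p}) = card (carrier G)"
    using ord_G by (simp add: order_def)
  ultimately have "?h ` ({..<p ^ c} \<times> {..<p}) = carrier G"
    using fin by (metis card_image card_subset_eq)
  then have "g \<in> ?h ` ({..<p ^ c} \<times> {..<p})" using g by simp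
  then show ?thesis using that by auto
qed

text \<open>If H has index p and g H g^(-1) differs from H, then H times g H g^(-1) is the whole group. Writing g^(-1) as such a
product shows that g is in H, a contradiction.\<close>
lemma conj_in_powers:
  assumes fin: "finite (carrier G)" and p: "prime p" and ord_G: "order G = p ^ Suc c"
    and w: "w \<in> carrier G" "ord w = p ^ c" and g: "g \<in> carrier G"
  shows "g \<otimes> w \<otimes> inv g \<in> range (\<lambda>k::nat. w [^] k)"
proof (rule ccontr)
  assume *: "\<not> ?thesis"
  obtain k i :: nat where "inv g = w [^] k \<otimes> (g \<otimes> w \<otimes> inv g) [^] i"
    using products_of_powers_cover[OF fin p ord_G w _ *, of "inv g"] w g
    by (metis inv_closed m_closed)
  then have "inv g = w [^] k \<otimes> (g \<otimes> w [^] i \<otimes> inv g)"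
    by (simp only: conj_pow[OF w(1) g])
  then have "inv g = w [^] k \<otimes> (g \<otimes> w [^] i) \<otimes> inv g"
    using w g by (simp add: m_assoc)
  then have "w [^] k \<otimes> (g \<otimes> w [^] i) = \<one>"
    using w g right_cancel[of "w [^] k \<otimes> (g \<otimes> w [^] i)" \<one> "inv g"] by simp
  then have "inv (w [^] k) \<otimes> inv (w [^] i) = inv (w [^] k) \<otimes> (w [^] k \<otimes> (g \<otimes> w [^] i)) \<otimes> inv (w [^] i)"
    using w by simp
  also have "\<dots> = g" using w g by (simp add: m_assoc)
  finally have "g = inv (w [^] k) \<otimes> inv (w [^] i)" by simp
  moreover obtain k' i' :: nat where "inv (w [^] k) = w [^] k'" "inv (w [^] i) = w [^] i'"
    using inv_pow_is_pow[OF w(1) fin] by blast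
  ultimately have "g = w [^] (k' + i')" using w by (simp add: nat_pow_mult)
  then have "g \<otimes> w = w \<otimes> g" using w by (simp add: commute_pow)
  then have "g \<otimes> w \<otimes> inv g = w [^] (1::nat)" using w g by (simp add: m_assoc)
  then show False using * by blast
qed

lemma commute_with_central_factor_pow:
  assumes xyc: "x \<in> carrier G" "y \<in> carrier G" "c \<in> carrier G"
    and cx: "c \<otimes> x = x \<otimes> c" and cy: "c \<otimes> y = y \<otimes> c" and yx: "y \<otimes> x = c \<otimes> (x \<otimes> y)"
  shows "y [^] (m::nat) \<otimes> x = c [^] m \<otimes> (x \<otimes> y [^] m)"
proof (induction m)
  case (Suc m)
  have cm: "c [^] m \<otimes> y = y \<otimes> c [^] m" using commute_pow[OF xyc(3,2) cy] .
  have "y [^] Suc m \<otimes> x = y \<otimes> (y [^] m \<otimes> x)"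
    using xyc by (simp only: nat_pow_Suc2 m_assoc nat_pow_closed)
  also have "\<dots> = (y \<otimes> c [^] m) \<otimes> (x \<otimes> y [^] m)" using xyc Suc by (simp add: m_assoc)
  also have "\<dots> = c [^] m \<otimes> (y \<otimes> x) \<otimes> y [^] m" unfolding cm[symmetric] using xyc by (simp add: m_assoc)
  also have "\<dots> = c [^] Suc m \<otimes> (x \<otimes> (y \<otimes> y [^] m))" unfolding yx using xyc by (simp add: m_assoc)
  also have "y \<otimes> y [^] m = y [^] Suc m" using xyc by (simp only: nat_pow_Suc2)
  finally show ?case .
qed (use xyc in simp)

lemma product_pow_commutator:
  assumes xyc: "x \<in> carrier G" "y \<in> carrier G" "c \<in> carrier G"
    and cx: "c \<otimes> x = x \<otimes> c" and cy: "c \<otimes> y = y \<otimes> c" and yx: "y \<otimes> x = c \<otimes> (x \<otimes> y)"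
  shows "(x \<otimes> y) [^] (m::nat) = c [^] (m choose 2) \<otimes> (x [^] m \<otimes> y [^] m)"
proof (induction m)
  case (Suc m)
  have cm: "x [^] m \<otimes> c [^] m = c [^] m \<otimes> x [^] m"
    using commute_pow[OF xyc(1) nat_pow_closed[OF xyc(3)], of m m] commute_pow[OF xyc(3,1) cx, of m] by simp
  have "(x \<otimes> y) [^] Suc m = c [^] (m choose 2) \<otimes> (x [^] m \<otimes> (y [^] m \<otimes> x) \<otimes> y)"
    using xyc Suc by (simp add: m_assoc)
  also have "\<dots> = c [^] (m choose 2) \<otimes> ((x [^] m \<otimes> c [^] m) \<otimes> x \<otimes> (y [^] m \<otimes> y))"
    unfolding commute_with_central_factor_pow[OF assms] using xyc by (simp add: m_assoc)
  also have "\<dots> = (c [^] (m choose 2) \<otimes> c [^] m) \<otimes> ((x [^] m \<otimes> x) \<otimes> (y [^] m \<otimes> y))"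
    unfolding cm using xyc by (simp add: m_assoc)
  also have "c [^] (m choose 2) \<otimes> c [^] m = c [^] (Suc m choose 2)"
    using xyc by (simp add: nat_pow_mult numeral_2_eq_2 add.commute)
  finally show ?case by simp
qed (use xyc in \<open>simp add: numeral_2_eq_2\<close>)

lemma iso_of_hom_surj_card:
  assumes "h \<in> hom H G" "h ` carrier H = carrier G" "finite (carrier H)" "order H = order G"
    and "group H"
  shows "G \<cong> H"
proof -
  interpret H: group H by fact
  have "inj_on h (carrier H)"
    using assms by (intro eq_card_imp_inj_on) (simp_all add: order_def)
  then have "H \<cong> G" using assms by (auto simp: is_iso_def iso_def bij_betw_def)
  then show ?thesis by (rule H.iso_sym)
qed

end

section \<open>Noncyclic p-groups with few elements of small order\<close>

lemma (in group) noncyclic_exponent_ge_2: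
  assumes p: "prime p" and ord_G: "order G = p ^ a"
    and noncyclic: "\<And>z. z \<in> carrier G \<Longrightarrow> ord z \<noteq> order G"
  shows "a \<ge> 2"
proof (rule ccontr)
  assume "\<not> a \<ge> 2"
  then have a01: "a = 0 \<or> a = 1" by auto
  have "z = \<one>" if z: "z \<in> carrier G" for z
  proof -
    have "ord z dvd p ^ a" using ord_dvd_group_order[OF z] ord_G by simp
    then have "ord z = 1"
      using a01 noncyclic[OF z] ord_G p by (auto simp: prime_nat_iff)
    then show ?thesis using z ord_eq_1 by blast
  qed
  then have "carrier G = {\<one>}" by auto
  then show False using noncyclic[of \<one>] by (simp add: order_def)
qed

text \<open>The equality case for groups of order p^a with a = c + 2. All elements outside
the p^c solutions of x^(p^c) = 1 have order p^(c+1).\<close>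
locale few_small_orders = group +
  fixes p c :: nat
  assumes fin: "finite (carrier G)" and p: "prime p" and order_G: "order G = p ^ Suc (Suc c)"
    and noncyclic: "\<And>z. z \<in> carrier G \<Longrightarrow> ord z \<noteq> order G"
    and card_torsion: "\<And>i. i \<le> c \<Longrightarrow> card (torsion G (p ^ i)) = p ^ i"
begin

lemma p1: "p > 1" using prime_gt_1_nat[OF p] .

lemma p_power_dvd_iff: "p ^ i dvd p ^ j \<longleftrightarrow> i \<le> j"
  using p1 by (simp add: dvd_power_iff_le)

abbreviation "Z \<equiv> torsion G (p ^ c)"

lemma card_Z: "card Z = p ^ c" using card_torsion[of c] by simp

lemma exists_outside_Z:
  obtains x where "x \<in> carrier G" "x \<notin> Z"
proof -
  have "card Z < card (carrier G)"
    unfolding card_Z order_G[unfolded order_def] by (rule power_strict_increasing) (use p1 in auto)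
  then have "carrier G \<noteq> Z" by auto
  then show ?thesis using that torsion_subset by blast
qed

lemma ord_outside:
  assumes z: "z \<in> carrier G" "z \<notin> Z" shows "ord z = p ^ Suc c"
proof -
  obtain v where v: "v \<le> Suc c" "ord z = p ^ v"
    using prime_power_group_ord[OF p order_G _ noncyclic z(1)] by auto
  then have "\<not> v \<le> c" using z by (auto simp: in_torsion_iff le_imp_power_dvd)
  then have "v = Suc c" using v(1) by simp
  then show ?thesis using v by simp
qed

text \<open>The powers of w^p are p^c solutions of x^(p^c) = 1, and there are no others.\<close>
lemma Z_powers:
  assumes w: "w \<in> carrier G" "w \<notin> Z" shows "Z = range (\<lambda>k::nat. (w [^] p) [^] k)"
proof -
  have ow: "ord w = p ^ Suc c" using ord_outside[OF w] .
  have op: "ord (w [^] p) = p ^ c"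
    using ord_pow[OF w(1), of p] ow p1 by simp
  have wp: "w [^] p \<in> carrier G" using w by simp
  have sub: "range (\<lambda>k::nat. (w [^] p) [^] k) \<subseteq> Z"
  proof
    fix z assume "z \<in> range (\<lambda>k::nat. (w [^] p) [^] k)"
    then obtain k :: nat where "z = (w [^] p) [^] k" by blast
    moreover have "((w [^] p) [^] k) [^] (p ^ c) = \<one>"
      unfolding nat_pow_pow[OF wp] pow_eq_id[OF wp] op by simp
    ultimately show "z \<in> Z" using wp by (simp add: torsion_def)
  qed
  have eq: "(\<lambda>k::nat. (w [^] p) [^] k) ` {1..p ^ c} = Z"
  proof (rule card_subset_eq)
    show "finite Z" using fin torsion_subset finite_subset by blast
    show "(\<lambda>k::nat. (w [^] p) [^] k) ` {1..p ^ c} \<subseteq> Z" using sub by blast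
    show "card ((\<lambda>k::nat. (w [^] p) [^] k) ` {1..p ^ c}) = card Z"
      using ord_inj'[OF wp] op card_Z by (simp add: card_image)
  qed
  have "Z \<subseteq> range (\<lambda>k::nat. (w [^] p) [^] k)"
    unfolding eq[symmetric] by (rule image_mono) simp
  then show ?thesis using sub by (rule equalityI)
qed

lemma Z_sub_powers:
  assumes w: "w \<in> carrier G" "w \<notin> Z" shows "Z \<subseteq> range (\<lambda>k::nat. w [^] k)"
  unfolding Z_powers[OF w] using w by (auto simp: nat_pow_pow)

text \<open>Every element of G is a power of some w outside Z, and Z consists of powers of w.\<close>
lemma Z_central:
  assumes z: "z \<in> Z" and g: "g \<in> carrier G" shows "z \<otimes> g = g \<otimes> z"
proof -
  obtain x where x: "x \<in> carrier G" "x \<notin> Z"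
    using exists_outside_Z .
  have "\<exists>w. w \<in> carrier G \<and> w \<notin> Z \<and> g \<in> range (\<lambda>k::nat. w [^] k)"
  proof (cases "g \<in> Z")
    case True
    then show ?thesis using Z_sub_powers[OF x] x by blast
  next
    case False
    have "g = g [^] (1::nat)" using g by simp
    then show ?thesis using False g by blast
  qed
  then obtain w and k :: nat where w: "w \<in> carrier G" "w \<notin> Z" and k: "g = w [^] k" by blast
  obtain l :: nat where l: "z = w [^] l" using z Z_sub_powers[OF w] by blast
  show ?thesis using w by (simp add: k l nat_pow_mult add.commute)
qed

lemma two_generators:
  obtains x y where "x \<in> carrier G" "x \<notin> Z" "y \<in> carrier G" "y \<notin> range (\<lambda>k::nat. x [^] k)"
proof -
  obtain x where x: "x \<in> carrier G" "x \<notin> Z"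
    using exists_outside_Z .
  have "range (\<lambda>k::nat. x [^] k) \<noteq> carrier G"
  proof
    assume "range (\<lambda>k::nat. x [^] k) = carrier G"
    moreover have "range (\<lambda>k::nat. x [^] k) = (\<lambda>k. x [^] k) ` {0..ord x - 1}"
      using ord_elems[OF fin x(1)] by (auto simp: image_def)
    ultimately have "card (carrier G) = ord x"
      using card_image[OF ord_inj[OF x(1)]] ord_ge_1[OF fin x(1)] by simp
    then show False using noncyclic[OF x(1)] by (simp add: order_def)
  qed
  moreover have "range (\<lambda>k::nat. x [^] k) \<subseteq> carrier G" using x by auto
  ultimately show ?thesis using that x by blast
qed

text \<open>Both cyclic subgroups are normal, so the commutator is a power of x and of y. If it were outside Z,
it would generate both subgroups.\<close>
lemma commutator_in_Z:
  assumes x: "x \<in> carrier G" "x \<notin> Z" and y: "y \<in> carrier G" "y \<notin> range (\<lambda>k::nat. x [^] k)"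
  obtains z where "z \<in> Z" "y \<otimes> x = z \<otimes> (x \<otimes> y)"
proof -
  have yZ: "y \<notin> Z" using Z_sub_powers[OF x] y by blast
  have ox: "ord x = p ^ Suc c" and oy: "ord y = p ^ Suc c" using ord_outside x y yZ by auto
  define z where "z = (y \<otimes> x \<otimes> inv y) \<otimes> inv x"
  have zc: "z \<in> carrier G" using x y by (simp add: z_def)
  obtain i :: nat where i: "y \<otimes> x \<otimes> inv y = x [^] i"
    using conj_in_powers[OF fin p order_G x(1) ox y(1)] by blast
  obtain i' :: nat where i': "inv (x [^] (1::nat)) = x [^] i'"
    using inv_pow_is_pow[OF x(1) fin, of 1] by blast
  have z1: "z = x [^] (i + i')" using i i' x by (simp add: z_def nat_pow_mult[symmetric])
  obtain j :: nat where j: "x \<otimes> y \<otimes> inv x = y [^] j"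
    using conj_in_powers[OF fin p order_G y(1) oy x(1)] by blast
  have "x \<otimes> inv y \<otimes> inv x = inv (y [^] j)"
    using x y by (simp add: j[symmetric] inv_mult_group m_assoc)
  then obtain j' :: nat where j': "x \<otimes> inv y \<otimes> inv x = y [^] j'"
    using inv_pow_is_pow[OF y(1) fin, of j] by auto
  have z2: "z = y [^] (Suc j')"
    using x y j' by (simp only: nat_pow_Suc2) (simp add: z_def m_assoc)
  have "z \<in> Z"
  proof (rule ccontr)
    assume "z \<notin> Z"
    then have oz: "ord z = p ^ Suc c" using ord_outside zc by blast
    then have "coprime (Suc j') (ord y)"
      using pow_ord_eq_ord_iff[OF fin y(1), of "Suc j'"] z2 oy by simp
    then obtain t :: nat where "y = (y [^] Suc j') [^] t" using power_generates[OF fin y(1)] by blast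
    then have "y = x [^] ((i + i') * t)" using z1 z2 x by (simp add: nat_pow_pow)
    then show False using y(2) by blast
  qed
  moreover have "y \<otimes> x = z \<otimes> (x \<otimes> y)"
    using x y by (simp add: z_def m_assoc)
  ultimately show ?thesis using that by blast
qed

lemma iso_elementary_abelian:
  assumes c0: "c = 0" shows "G \<cong> integer_mod_group p \<times>\<times> integer_mod_group p"
proof -
  obtain x y where x: "x \<in> carrier G" "x \<notin> Z" and y: "y \<in> carrier G" "y \<notin> range (\<lambda>k::nat. x [^] k)"
    using two_generators .
  have Z1: "Z = {\<one>}" using c0 by (auto simp: torsion_def)
  have com: "y \<otimes> x = x \<otimes> y" using commutator_in_Z[OF x y] Z1 x y by (metis l_one m_closed singletonD)
  have yZ: "y \<notin> Z" using Z_sub_powers[OF x] y by blast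
  have ox: "ord x = p" and oy: "ord y = p" using ord_outside x y yZ c0 by auto
  let ?H = "integer_mod_group p \<times>\<times> integer_mod_group p"
  let ?h = "\<lambda>(i, j). x [^] nat i \<otimes> y [^] nat j"
  have carr: "carrier ?H = {0..<int p} \<times> {0..<int p}"
    using p1 by (simp add: DirProd_def carrier_integer_mod_group)
  have add: "w [^] nat ((i + j) mod int p) = w [^] nat i \<otimes> w [^] nat j"
    if "w \<in> carrier G" "ord w = p" "0 \<le> i" "0 \<le> j" for w i j
  proof -
    have "nat ((i + j) mod int p) = (nat i + nat j) mod p"
      using that p1 by (simp add: nat_mod_distrib nat_add_distrib)
    moreover have "w [^] ((nat i + nat j) mod p) = w [^] (nat i + nat j)"
      by (rule pow_cong[OF that(1), of _ _ p]) (use that in auto)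
    ultimately show ?thesis by (simp only: nat_pow_mult[OF that(1)])
  qed
  have "?h \<in> hom ?H G"
  proof (rule homI)
    fix s assume "s \<in> carrier ?H"
    then show "?h s \<in> carrier G" using x y by (auto simp: case_prod_unfold)
  next
    fix s t assume st: "s \<in> carrier ?H" "t \<in> carrier ?H"
    obtain i j k l where e: "s = (i, j)" "t = (k, l)" by fastforce
    have nn: "0 \<le> i" "0 \<le> j" "0 \<le> k" "0 \<le> l" using st unfolding e carr by auto
    have cm: "x [^] nat k \<otimes> y [^] nat j = y [^] nat j \<otimes> x [^] nat k"
      using commute_pow[OF x(1) nat_pow_closed[OF y(1)]] commute_pow[OF y(1) x(1) com] by simp
    have "?h (s \<otimes>\<^bsub>?H\<^esub> t) = (x [^] nat i \<otimes> x [^] nat k) \<otimes> (y [^] nat j \<otimes> y [^] nat l)"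
      unfolding e using add[OF x(1) ox nn(1,3)] add[OF y(1) oy nn(2,4)] by simp
    also have "\<dots> = x [^] nat i \<otimes> (x [^] nat k \<otimes> y [^] nat j) \<otimes> y [^] nat l"
      using x y by (simp add: m_assoc)
    also have "\<dots> = ?h s \<otimes> ?h t" unfolding cm e using x y by (simp add: m_assoc)
    finally show "?h (s \<otimes>\<^bsub>?H\<^esub> t) = ?h s \<otimes> ?h t" .
  qed
  moreover have "?h ` carrier ?H = carrier G"
  proof
    show "?h ` carrier ?H \<subseteq> carrier G" using x y by auto
    show "carrier G \<subseteq> ?h ` carrier ?H"
    proof
      fix g assume g: "g \<in> carrier G"
      obtain k i where ki: "k < p ^ Suc c" "i < p" "g = x [^] k \<otimes> y [^] i"
        using products_of_powers_cover[OF fin p order_G x(1) _ y g] ox c0 by auto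
      then show "g \<in> ?h ` carrier ?H"
        unfolding carr using c0 by (intro image_eqI[of _ _ "(int k, int i)"]) auto
    qed
  qed
  moreover have "finite (carrier ?H)" "order ?H = order G"
    unfolding order_def[of ?H] carr by (simp_all add: order_G c0)
  moreover have "group ?H" by (intro DirProd_group) auto
  ultimately show ?thesis by (rule iso_of_hom_surj_card)
qed

text \<open>Since y^p is a p-th power of a power of x, some x' among the powers of x satisfies x'^p y^p = 1. The
commutator e of y and x' is central with e^p = 1, and w = x' y, which is not in Z, has
w^p = e^(p(p-1)/2). For odd p this gives w^p = 1, for p = 2 it gives w^4 = 1, whereas w has order p^(c+1).\<close>
lemma prime_eq_2_if_nontrivial_centre:
  assumes c1: "c \<ge> 1" shows "p = 2 \<and> c = 1"
proof -
  obtain x y where x: "x \<in> carrier G" "x \<notin> Z" and y: "y \<in> carrier G" "y \<notin> range (\<lambda>k::nat. x [^] k)"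
    using two_generators .
  have yZ: "y \<notin> Z" using Z_sub_powers[OF x] y by blast
  have "y [^] p \<in> range (\<lambda>k::nat. (y [^] p) [^] k)"
    using y by (intro range_eqI[of _ _ 1]) simp
  then have ypZ: "y [^] p \<in> Z" using Z_powers[OF y(1) yZ] by simp
  then obtain j :: nat where j: "y [^] p = (x [^] p) [^] j" using Z_powers[OF x] by auto
  obtain n :: nat where n: "inv (x [^] j) = x [^] n" using inv_pow_is_pow[OF x(1) fin] by blast
  \<comment> \<open>x' = x^(-j), so that x'^p cancels y^p.\<close>
  define x' where "x' = x [^] n"
  have x'c: "x' \<in> carrier G" using x by (simp add: x'_def)
  obtain d where d: "d \<in> Z" "y \<otimes> x = d \<otimes> (x \<otimes> y)" using commutator_in_Z[OF x y] .
  have dc: "d \<in> carrier G" using d torsion_subset by blast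
  define e where "e = d [^] n"
  have ec: "e \<in> carrier G" using dc by (simp add: e_def)
  have e_central: "e \<otimes> g = g \<otimes> e" if "g \<in> carrier G" for g
    unfolding e_def using commute_pow[OF dc that Z_central[OF d(1) that]] .
  have conj: "y \<otimes> x \<otimes> inv y = d \<otimes> x"
    unfolding d(2) using x y dc by (simp add: m_assoc)
  have "y \<otimes> x' \<otimes> inv y = e \<otimes> x'"
    unfolding x'_def e_def conj_pow[OF x(1) y(1), symmetric] conj
    using pow_mult_distrib[OF Z_central[OF d(1) x(1)] dc x(1)] .
  then have yx': "y \<otimes> x' = e \<otimes> (x' \<otimes> y)"
    using conj_eq_iff[of x' "e \<otimes> x'" y] x'c y ec by (simp add: m_assoc)
  have x'p: "x' [^] p \<otimes> y [^] p = \<one>"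
  proof -
    have "x' [^] p = inv (x [^] j) [^] p" by (simp add: x'_def n)
    also have "\<dots> = inv (y [^] p)"
      unfolding j using x by (simp add: nat_pow_inv nat_pow_pow mult.commute)
    finally show ?thesis using y by simp
  qed
  have "y [^] p \<otimes> x' = e [^] p \<otimes> (x' \<otimes> y [^] p)"
    using commute_with_central_factor_pow[OF x'c y(1) ec e_central[OF x'c] e_central[OF y(1)] yx'] .
  then have "\<one> \<otimes> (x' \<otimes> y [^] p) = e [^] p \<otimes> (x' \<otimes> y [^] p)"
    using Z_central[OF ypZ x'c] x'c y by simp
  then have ep: "e [^] p = \<one>"
    using x'c y ec right_cancel[of \<one> "e [^] p" "x' \<otimes> y [^] p"] by simp
  define w where "w = x' \<otimes> y"
  have wc: "w \<in> carrier G" using x'c y by (simp add: w_def)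
  have "w [^] p = e [^] (p choose 2) \<otimes> (x' [^] p \<otimes> y [^] p)"
    unfolding w_def
    by (rule product_pow_commutator[OF x'c y(1) ec e_central[OF x'c] e_central[OF y(1)] yx'])
  then have wp: "w [^] p = e [^] (p choose 2)" using x'p ec by simp
  have "w \<notin> Z"
  proof
    assume "w \<in> Z"
    then obtain k :: nat where "w = x [^] k" using Z_sub_powers[OF x] by blast
    moreover have "x [^] j \<otimes> w = y" using x y by (simp add: w_def x'_def n[symmetric])
    ultimately have "y = x [^] (j + k)" using x by (simp add: nat_pow_mult)
    then show False using y by blast
  qed
  then have ow: "ord w = p ^ Suc c" using ord_outside wc by blast
  have "p = 2"
  proof (rule ccontr)
    assume "p \<noteq> 2"
    then have "odd p" using prime_odd_nat[OF p] p1 by linarith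
    then have "p choose 2 = p * ((p - 1) div 2)" by (simp add: choose_two div_mult_swap)
    then have "w [^] p = (e [^] p) [^] ((p - 1) div 2)" using wp ec by (simp add: nat_pow_pow)
    then have "w [^] p = \<one>" using ep by simp
    then have "p ^ Suc c dvd p ^ 1" using wc ow by (simp add: pow_eq_id)
    then have "Suc c \<le> 1" unfolding p_power_dvd_iff .
    then show False using c1 by simp
  qed
  moreover have "c \<le> 1"
  proof -
    have "w [^] (p * p) = (e [^] p) [^] (p choose 2)"
      using wp wc ec by (simp add: nat_pow_pow[symmetric]) (simp add: nat_pow_pow mult.commute)
    then have "w [^] (p * p) = \<one>" using ep by simp
    then have "p ^ Suc c dvd p ^ 2" using wc ow by (simp add: pow_eq_id power2_eq_square)
    then have "Suc c \<le> 2" unfolding p_power_dvd_iff .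
    then show ?thesis by simp
  qed
  ultimately show ?thesis using c1 by simp
qed

text \<open>Here Z = {1, z} and all elements outside Z have square z. For x outside Z and y not a power of x, the product w = x y is
also outside Z, so w^2 = z, and this forces y x = z w. With x, y, w, z in the roles of i, j, k, -1 these relations
determine the multiplication table.\<close>
lemma iso_quaternion_group:
  assumes p2: "p = 2" and c1: "c = 1" shows "G \<cong> quaternion_group"
proof -
  obtain x y where x: "x \<in> carrier G" "x \<notin> Z" and y: "y \<in> carrier G" "y \<notin> range (\<lambda>k::nat. x [^] k)"
    using two_generators .
  have yZ: "y \<notin> Z" using Z_sub_powers[OF x] y by blast
  have ox: "ord x = 4" and oy: "ord y = 4" using ord_outside x y yZ p2 c1 by auto
  define z where "z = x \<otimes> x"
  have zc: "z \<in> carrier G" using x by (simp add: z_def)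
  have pow4: "x [^] (4::nat) = \<one>" using pow_ord_eq_1[OF x(1)] ox by simp
  have zz: "z \<otimes> z = \<one>" using pow4 x by (simp add: z_def numeral_eq_Suc m_assoc)
  have z1: "z \<noteq> \<one>"
  proof
    assume "z = \<one>"
    then have "x [^] (2::nat) = \<one>" using x by (simp add: z_def numeral_eq_Suc)
    then show False using x ox by (simp add: pow_eq_id)
  qed
  have "\<one> \<in> Z" "z \<in> Z" using zc zz p2 c1 by (simp_all add: torsion_def numeral_eq_Suc)
  moreover have "card Z = 2" using card_Z p2 c1 by simp
  ultimately have Z: "Z = {\<one>, z}"
    using z1 by (intro card_subset_eq[symmetric]) (auto intro: card_ge_0_finite)
  have cen: "z \<otimes> g = g \<otimes> z" if "g \<in> carrier G" for g using Z_central that Z by blast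
  have square: "w \<otimes> w = z" if w: "w \<in> carrier G" "w \<notin> Z" for w
  proof -
    have "ord w = 4" using ord_outside[OF w] p2 c1 by simp
    then have "w [^] (4::nat) = \<one>" "w [^] (2::nat) \<noteq> \<one>" using w pow_eq_id[of w] by auto
    then have "w \<otimes> w \<in> Z" "w \<otimes> w \<noteq> \<one>"
      using w p2 c1 by (simp_all add: torsion_def numeral_eq_Suc m_assoc)
    then show ?thesis using Z by blast
  qed
  have yy: "y \<otimes> y = z" using square y yZ by blast
  define w where "w = x \<otimes> y"
  have wc: "w \<in> carrier G" using x y by (simp add: w_def)
  have "w \<notin> range (\<lambda>k::nat. x [^] k)"
  proof
    assume "w \<in> range (\<lambda>k::nat. x [^] k)"
    then obtain k :: nat where k: "x \<otimes> y = x [^] k" by (auto simp: w_def)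
    obtain i :: nat where i: "inv (x [^] (1::nat)) = x [^] i" using inv_pow_is_pow[OF x(1) fin, of 1] by blast
    have "y = inv x \<otimes> (x \<otimes> y)" using x y by simp
    then have "y = x [^] (i + k)" using i k x by (simp add: nat_pow_mult[symmetric])
    then show False using y by blast
  qed
  then have "w \<notin> Z" using Z_sub_powers[OF x] by blast
  then have ww: "w \<otimes> w = z" using square wc by blast
  have xyxy: "x \<otimes> (y \<otimes> (x \<otimes> y)) = z" using ww x y by (simp add: w_def m_assoc)
  have xx: "x \<otimes> x = z" by (simp add: z_def)
  have inv_sq: "inv g = z \<otimes> g" if "g \<in> carrier G" "g \<otimes> g = z" for g
    using that zc zz by (intro inv_equality) (simp_all add: m_assoc)
  have yx: "y \<otimes> x = z \<otimes> w"
  proof -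
    have "y \<otimes> (x \<otimes> y) = inv x \<otimes> z" using xyxy x y by (metis inv_cancel_left(1) m_closed)
    also have "\<dots> = x" using inv_sq[OF x(1) xx] x zc zz cen[of x] by (simp add: m_assoc)
    finally have "(y \<otimes> x) \<otimes> y = x" using x y by (simp add: m_assoc)
    then have "y \<otimes> x = x \<otimes> inv y" using x y by (metis inv_solve_right m_closed)
    also have "\<dots> = z \<otimes> w"
      using inv_sq[OF y(1) yy] x y zc cen[of x] by (simp add: w_def m_assoc[symmetric])
    finally show ?thesis .
  qed
  have zl: "g \<otimes> (z \<otimes> h) = z \<otimes> (g \<otimes> h)" if "g \<in> carrier G" "h \<in> carrier G" for g h
    using that zc cen[of g] by (metis m_assoc)
  have zzl: "z \<otimes> (z \<otimes> h) = h" if "h \<in> carrier G" for h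
    using that zc zz by (simp add: m_assoc[symmetric])
  have xw: "x \<otimes> w = z \<otimes> y" using x y by (simp add: w_def xx m_assoc[symmetric])
  have wy: "w \<otimes> y = z \<otimes> x" using x y cen[of x] by (simp add: w_def m_assoc yy)
  have wx: "w \<otimes> x = y"
  proof -
    have "w \<otimes> x = x \<otimes> (y \<otimes> x)" using x y by (simp add: w_def m_assoc)
    also have "\<dots> = z \<otimes> (x \<otimes> w)" unfolding yx using zl x wc by simp
    also have "\<dots> = y" unfolding xw using zzl y by simp
    finally show ?thesis .
  qed
  have yw: "y \<otimes> w = x"
  proof -
    have "y \<otimes> w = (y \<otimes> x) \<otimes> y" using x y by (simp add: w_def m_assoc)
    also have "\<dots> = z \<otimes> (w \<otimes> y)" unfolding yx using zc wc y by (simp add: m_assoc)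
    also have "\<dots> = x" unfolding wy using zzl x by simp
    finally show ?thesis .
  qed
  have xy: "x \<otimes> y = w" by (simp add: w_def)
  define h :: "int \<times> int \<times> int \<times> int \<Rightarrow> 'a" where
    "h t = (case t of (a, b, c, d) \<Rightarrow>
      if a = 1 then \<one> else if a = -1 then z else if b = 1 then x else if b = -1 then z \<otimes> x
      else if c = 1 then y else if c = -1 then z \<otimes> y else if d = 1 then w else z \<otimes> w)" for t
  have cl: "x \<in> carrier G" "y \<in> carrier G" using x y by auto
  have zr: "x \<otimes> z = z \<otimes> x" "y \<otimes> z = z \<otimes> y" "w \<otimes> z = z \<otimes> w" using cen cl wc by auto
  \<comment> \<open>Only these instances of zl rewrite towards a normal form; for g = z the rule would loop.\<close>
  note zlr = zl[OF cl(1)] zl[OF cl(2)] zl[OF wc]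
  have "h \<in> hom quaternion_group G"
  proof (rule homI)
    fix s assume "s \<in> carrier quaternion_group"
    then show "h s \<in> carrier G"
      using cl zc wc by (auto simp: h_def quaternion_group_def)
  next
    fix s t assume "s \<in> carrier quaternion_group" "t \<in> carrier quaternion_group"
    then show "h (s \<otimes>\<^bsub>quaternion_group\<^esub> t) = h s \<otimes> h t"
      unfolding quaternion_group_def
      by (simp, elim disjE)
        (simp_all add: h_def cl zc wc m_assoc zlr zzl zz zr xx yy ww xy yx xw wx yw wy)
  qed
  moreover have "h ` carrier quaternion_group = carrier G"
  proof
    show "h ` carrier quaternion_group \<subseteq> carrier G"
      using cl zc wc by (auto simp: h_def quaternion_group_def)
    show "carrier G \<subseteq> h ` carrier quaternion_group"
    proof
      fix g assume g: "g \<in> carrier G"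
      obtain k i where ki: "k < 4" "i < 2" "g = x [^] (k::nat) \<otimes> y [^] (i::nat)"
        using products_of_powers_cover[OF fin p order_G x(1) _ y g] ox p2 c1 by auto
      have "x [^] k \<in> {\<one>, x, z, z \<otimes> x}"
      proof -
        have "k = 0 \<or> k = 1 \<or> k = 2 \<or> k = 3" using ki(1) by auto
        then show ?thesis using x xx by (auto simp: numeral_eq_Suc)
      qed
      moreover have "y [^] i \<in> {\<one>, y}"
        using ki(2) y by (auto simp: less_2_cases_iff)
      ultimately have "g \<in> {\<one>, x, z, z \<otimes> x, y, w, z \<otimes> y, z \<otimes> w}"
        using ki(3) cl zc by (auto simp: xy m_assoc)
      moreover have "\<one> = h (1, 0, 0, 0)" "z = h (-1, 0, 0, 0)" "x = h (0, 1, 0, 0)" "z \<otimes> x = h (0, -1, 0, 0)"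
        "y = h (0, 0, 1, 0)" "z \<otimes> y = h (0, 0, -1, 0)" "w = h (0, 0, 0, 1)" "z \<otimes> w = h (0, 0, 0, -1)"
        by (simp_all add: h_def)
      ultimately show "g \<in> h ` carrier quaternion_group"
        unfolding quaternion_group_def by auto
    qed
  qed
  moreover have "finite (carrier quaternion_group)" by (simp add: quaternion_group_def)
  moreover have "order quaternion_group = order G"
    by (simp add: order_quaternion_group order_G p2 c1 numeral_eq_Suc)
  ultimately show ?thesis using group_quaternion_group by (intro iso_of_hom_surj_card)
qed

lemma iso_elementary_abelian_or_quaternion: "G \<cong> integer_mod_group p \<times>\<times> integer_mod_group p \<or> G \<cong> quaternion_group"
  using iso_elementary_abelian prime_eq_2_if_nontrivial_centre iso_quaternion_group by (cases "c = 0") auto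

end

lemma card_involutions_quaternion_group: "card (torsion quaternion_group 2) = 2"
proof -
  have "torsion quaternion_group 2 = {(1, 0, 0, 0), (-1, 0, 0, 0)}"
    by (auto simp: torsion_def quaternion_group_def numeral_2_eq_2)
  then show ?thesis by simp
qed

section \<open>The sum of the orders: cyclic subgroups of small index\<close>

text \<open>Let H be the cyclic group generated by x, of index less than p. Its order has full p-part. For
every p-element w, two of the cosets H, H w, ..., H w^(p-1) coincide, so w^d is in H for some 0 < d < p; then w is
in H, because d is prime to the order of w. Thus all p-elements of G lie in H.\<close>
lemma (in group) card_torsion_of_small_index:
  assumes fin: "finite (carrier G)" and p: "prime p" and order_eq: "order G = p ^ b * m" and m: "\<not> p dvd m"
    and x: "x \<in> carrier G" and index: "order G < p * ord x"
  shows "card (torsion G (p ^ b)) = p ^ b" "\<exists>u\<in>carrier G. ord u = p ^ b"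
proof -
  have p0: "p > 0" using prime_gt_0_nat[OF p] .
  have ox: "ord x > 0" using ord_ge_1[OF fin x] by simp
  obtain i where i: "order G = ord x * i" using ord_dvd_group_order[OF x] by blast
  have "i < p" using index ox by (simp add: i mult.commute)
  moreover have "i > 0" using i fin order_gt_0_iff_finite by (metis gr0I mult_0_right less_irrefl)
  ultimately have "\<not> p dvd i" by (auto dest: dvd_imp_le)
  then have "p ^ b dvd ord x"
    using i order_eq prime_power_part_coprime[OF p] by (metis coprime_dvd_mult_left_iff dvd_triv_left)
  then obtain e where e: "ord x = p ^ b * e" by blast
  have e0: "e > 0" using e ox by (metis gr0I mult_0_right less_irrefl)
  define u where "u = x [^] e"
  have u: "u \<in> carrier G" "ord u = p ^ b"
    unfolding u_def using x ord_pow[OF x, of e] e e0 by auto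
  have in_powers: "w \<in> range (\<lambda>k::nat. u [^] k)" if w: "w \<in> torsion G (p ^ b)" for w
  proof -
    have wc: "w \<in> carrier G" and ow: "ord w dvd p ^ b" using w by (auto simp: in_torsion_iff)
    let ?h = "\<lambda>(k::nat, l::nat). x [^] k \<otimes> w [^] l"
    have "\<not> inj_on ?h ({0..ord x - 1} \<times> {..<p})"
    proof
      assume "inj_on ?h ({0..ord x - 1} \<times> {..<p})"
      moreover have "?h ` ({0..ord x - 1} \<times> {..<p}) \<subseteq> carrier G" using x wc by auto
      ultimately have "card ({0..ord x - 1} \<times> {..<p}) \<le> card (carrier G)"
        using fin card_inj_on_le by blast
      then show False using index ox by (simp add: order_def mult.commute)
    qed
    then obtain k l k' l' where kl: "k \<in> {0..ord x - 1}" "k' \<in> {0..ord x - 1}" "l < p" "l' < p"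
      "(k, l) \<noteq> (k', l')" "x [^] k \<otimes> w [^] l = x [^] k' \<otimes> w [^] l'"
      unfolding inj_on_def by auto
    have "l \<noteq> l'"
    proof
      assume "l = l'"
      then have "x [^] k = x [^] k'" using kl(6) x wc by simp
      then show False using ord_inj[OF x] kl(1,2,5) \<open>l = l'\<close> by (auto simp: inj_on_def)
    qed
    have aux: "\<exists>r::nat. w [^] (l' - l) = x [^] r"
      if "l < l'" "x [^] k \<otimes> w [^] l = x [^] k' \<otimes> w [^] l'" for k l k' l' :: nat
    proof -
      obtain r :: nat where r: "inv (x [^] k') = x [^] r" using inv_pow_is_pow[OF x fin] by blast
      have "(x [^] k' \<otimes> w [^] (l' - l)) \<otimes> w [^] l = x [^] k \<otimes> w [^] l"
        using that x wc by (simp add: m_assoc nat_pow_mult)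
      then have "x [^] k = x [^] k' \<otimes> w [^] (l' - l)" using x wc by simp
      then have "w [^] (l' - l) = inv (x [^] k') \<otimes> x [^] k" using x wc by simp
      then show ?thesis using r x by (auto simp: nat_pow_mult)
    qed
    obtain d r :: nat where d: "0 < d" "d < p" "w [^] d = x [^] r"
    proof (cases "l < l'")
      case True
      then show ?thesis using aux[OF True kl(6)] that[of "l' - l"] kl(4) by auto
    next
      case False
      then have "l' < l" using \<open>l \<noteq> l'\<close> by simp
      then show ?thesis using aux[OF _ kl(6)[symmetric]] that[of "l - l'"] kl(3) by auto
    qed
    have "\<not> p dvd d" using d by (auto dest: dvd_imp_le)
    then have "coprime d (ord w)"
      using ow prime_power_part_coprime[OF p, of d b] by (meson coprime_commute coprime_divisors dvd_refl)
    then obtain t :: nat where "w = (w [^] d) [^] t" using power_generates[OF fin wc] by blast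
    then have wx: "w = x [^] (r * t)" using d(3) x by (simp add: nat_pow_pow)
    then have "x [^] (r * t * p ^ b) = \<one>" using w x by (simp add: torsion_def nat_pow_pow)
    then have "p ^ b * e dvd p ^ b * (r * t)" using x e by (simp add: pow_eq_id mult.commute)
    then have "e dvd r * t" using p0 by simp
    then obtain s where "r * t = e * s" by blast
    then have "w = u [^] s" using wx x by (simp add: u_def nat_pow_pow)
    then show ?thesis by blast
  qed
  have img: "(\<lambda>k::nat. u [^] k) ` {1..p ^ b} = torsion G (p ^ b)"
  proof (intro equalityI subsetI)
    fix w assume "w \<in> (\<lambda>k::nat. u [^] k) ` {1..p ^ b}"
    then obtain k :: nat where "w = u [^] k" by blast
    moreover have "(u [^] k) [^] (p ^ b) = \<one>"
      unfolding nat_pow_pow[OF u(1)] pow_eq_id[OF u(1)] u(2) by simp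
    ultimately show "w \<in> torsion G (p ^ b)" using u by (simp add: torsion_def)
  next
    fix w assume "w \<in> torsion G (p ^ b)"
    then obtain k :: nat where k: "w = u [^] k" using in_powers by blast
    define j where "j = (if k mod p ^ b = 0 then p ^ b else k mod p ^ b)"
    have "[k = j] (mod p ^ b)" by (auto simp: j_def cong_def)
    then have "w = u [^] j" using pow_cong[OF u(1)] u(2) k by simp
    moreover have "j \<in> {1..p ^ b}" using p0 by (auto simp: j_def less_imp_le)
    ultimately show "w \<in> (\<lambda>k::nat. u [^] k) ` {1..p ^ b}" by blast
  qed
  show "card (torsion G (p ^ b)) = p ^ b"
    unfolding img[symmetric] using ord_inj'[OF u(1)] u(2) by (simp add: card_image)
  show "\<exists>u\<in>carrier G. ord u = p ^ b" using u by blast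
qed

lemma sum_totient_times_prime_powers_gt:
  assumes p: "prime p"
  shows "(real (p ^ b))\<^sup>2 * (real p / (real p + 1)) < (\<Sum>i\<le>b. real (totient (p ^ i)) * real (p ^ i))"
proof -
  have p0: "p > 0" using prime_gt_0_nat[OF p] .
  have "(real p + 1) * (\<Sum>i\<le>b. real (totient (p ^ i)) * real (p ^ i)) = real p * (real (p ^ b))\<^sup>2 + 1"
  proof (induction b)
    case (Suc b)
    have t: "real (totient (p ^ Suc b)) = real (p ^ b) * (real p - 1)"
      unfolding totient_prime_power_Suc[OF p] using p0 by (simp add: of_nat_diff)
    show ?case unfolding sum.atMost_Suc distrib_left Suc t
      by (simp add: power2_eq_square algebra_simps)
  qed (simp add: algebra_simps)
  then have "(\<Sum>i\<le>b. real (totient (p ^ i)) * real (p ^ i)) = (real p * (real (p ^ b))\<^sup>2 + 1) / (real p + 1)"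
    by (simp add: field_simps)
  also have "(real (p ^ b))\<^sup>2 * (real p / (real p + 1)) < \<dots>"
    using p0 by (simp add: divide_strict_right_mono mult.commute)
  finally show ?thesis .
qed

text \<open>The sum is multiplicative, and its value at p^b is (p^(2b+1) + 1)/(p + 1).\<close>
lemma divisor_sum_id_gt:
  assumes "n > 1"
  shows "(real n)\<^sup>2 * (\<Prod>p\<in>prime_factors n. real p / (real p + 1)) < divisor_sum real n"
  using assms
proof (induction n rule: less_induct)
  case (less n)
  obtain p where p: "prime p" "p dvd n" using less.prems prime_factor_nat[of n] by auto
  define b where "b = multiplicity p n"
  obtain m where m: "n = p ^ b * m" "\<not> p dvd m" and m0: "m > 0"
    using prime_power_decomposition[OF p(1), of n] less.prems unfolding b_def by auto
  have b0: "b > 0" using p less.prems by (simp add: b_def prime_multiplicity_gt_zero_iff)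
  have pf: "prime_factors n = insert p (prime_factors m)" "p \<notin> prime_factors m"
    using m m0 p(1) b0 prime_gt_0_nat[OF p(1)]
    by (auto simp: prime_factors_product prime_factors_power prime_prime_factors)
  define S where "S = (\<Sum>i\<le>b. real (totient (p ^ i)) * real (p ^ i))"
  have D: "divisor_sum real n = S * divisor_sum real m"
    unfolding m(1) divisor_sum_prime_power_times[OF p(1) m(2) m0] S_def
    by (simp add: divisor_sum_def sum_distrib_left sum_distrib_right mult_ac)
  have S: "(real (p ^ b))\<^sup>2 * (real p / (real p + 1)) < S"
    unfolding S_def by (rule sum_totient_times_prime_powers_gt[OF p(1)])
  let ?A = "\<Prod>p\<in>prime_factors m. real p / (real p + 1)"
  have le: "(real m)\<^sup>2 * ?A \<le> divisor_sum real m"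
  proof (cases "m = 1")
    case True
    have "{d. d dvd (1::nat)} = {1}" by auto
    then show ?thesis using True by (simp add: divisor_sum_def)
  next
    case False
    moreover have "1 < p ^ b" using one_less_power[OF prime_gt_1_nat[OF p(1)] b0] .
    then have "m < n" using m(1) m0 by simp
    ultimately show ?thesis using less.IH[of m] m0 by auto
  qed
  have pos: "0 < (real m)\<^sup>2 * ?A"
    using m0 by (intro mult_pos_pos prod_pos) (auto simp: prime_gt_0_nat dest: in_prime_factors_imp_prime)
  have "(real n)\<^sup>2 * (\<Prod>p\<in>prime_factors n. real p / (real p + 1)) =
      ((real (p ^ b))\<^sup>2 * (real p / (real p + 1))) * ((real m)\<^sup>2 * ?A)"
    unfolding pf(1) using pf(2) by (simp add: m(1) power_mult_distrib)
  also have "\<dots> < S * ((real m)\<^sup>2 * ?A)" using S pos by (intro mult_strict_right_mono)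
  also have "\<dots> \<le> S * divisor_sum real m"
    using le by (intro mult_left_mono) (simp_all add: S_def sum_nonneg)
  finally show ?case unfolding D .
qed

lemma prod_subset_antimono:
  fixes f :: "'a \<Rightarrow> real"
  assumes "finite B" "A \<subseteq> B" "\<And>b. b \<in> B \<Longrightarrow> 0 \<le> f b" "\<And>b. b \<in> B \<Longrightarrow> f b \<le> 1"
  shows "prod f B \<le> prod f A"
proof -
  have "prod f B = prod f (B - A) * prod f A" using assms(1,2) by (metis prod.subset_diff)
  also have "\<dots> \<le> 1 * prod f A"
    using assms by (intro mult_right_mono prod_le_1 prod_nonneg) auto
  finally show ?thesis by simp
qed

lemma prod_interval_telescope:
  assumes "q \<le> (P::nat)" "q > 0"
  shows "(\<Prod>i=q..P. real i / (real i + 1)) = real q / (real P + 1)"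
  using assms by (induction P rule: dec_induct) (simp_all add: field_simps)

text \<open>Extending the product to all integers from q to P makes it smaller and lets it telescope.\<close>
lemma prod_prime_ratio_ge:
  assumes "A \<subseteq> {q..P}" "q \<le> (P::nat)" "q > 0"
  shows "real q / (real P + 1) \<le> (\<Prod>p\<in>A. real p / (real p + 1))"
proof -
  have "(\<Prod>i\<in>{q..P}. real i / (real i + 1)) \<le> (\<Prod>p\<in>A. real p / (real p + 1))"
    using assms by (intro prod_subset_antimono) (auto simp: field_simps)
  then show ?thesis using prod_interval_telescope[OF assms(2,3)] by simp
qed

text \<open>After clearing denominators this reads q^2 P \<le> (q - 1)(P^2 + q^2 - 1). For q = 2 the difference of
the sides is (P - 1)(P - 3); for q \<ge> 3 the inequality follows from P^2 + q^2 \<ge> 2 P q.\<close>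
lemma two_prime_inequality:
  fixes q P :: nat
  assumes q: "q \<ge> 2" and P: "P > q"
  defines "x \<equiv> 1 / real q" and "y \<equiv> 1 / real P"
  shows "(1 - x) * ((1 - x\<^sup>2) * (1 - y\<^sup>2)) \<le> 1 - x - x * y"
proof -
  have q0: "real q > 0" and P0: "real P > 0" using q P by auto
  have main: "real q ^ 2 * real P \<le> (real q - 1) * (real P ^ 2 + real q ^ 2 - 1)"
  proof (cases "q = 2")
    case True
    have "0 \<le> (real P - 1) * (real P - 3)" using P True by simp
    then show ?thesis using True by (simp add: power2_eq_square algebra_simps)
  next
    case False
    then have q3: "real q \<ge> 3" using q by simp
    have "0 \<le> (real P - real q)\<^sup>2" by simp
    then have "2 * real q * real P \<le> real P ^ 2 + real q ^ 2"
      by (simp add: power2_eq_square algebra_simps)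
    then have "(real q - 1) * (2 * real q * real P - 1) \<le> (real q - 1) * (real P ^ 2 + real q ^ 2 - 1)"
      using q3 by (intro mult_left_mono) auto
    moreover have "real q ^ 2 * real P \<le> (real q - 1) * (2 * real q * real P - 1)"
    proof -
      have "real q \<le> real q * (real q - 2) * real P"
      proof -
        have "1 * 1 \<le> (real q - 2) * real P" using q3 P by (intro mult_mono) auto
        then have "real q * 1 \<le> real q * ((real q - 2) * real P)" using q0 by (intro mult_left_mono) auto
        then show ?thesis by simp
      qed
      then show ?thesis using q3 by (simp add: power2_eq_square algebra_simps)
    qed
    ultimately show ?thesis by linarith
  qed
  have "x * y = (real q ^ 2 * real P) / (real q ^ 3 * real P ^ 2)"
    unfolding x_def y_def using q0 P0 by (simp add: field_simps power2_eq_square power3_eq_cube)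
  also have "\<dots> \<le> ((real q - 1) * (real P ^ 2 + real q ^ 2 - 1)) / (real q ^ 3 * real P ^ 2)"
    using main q0 P0 by (intro divide_right_mono) auto
  also have "\<dots> = (1 - x) * (x\<^sup>2 + y\<^sup>2 - x\<^sup>2 * y\<^sup>2)"
    unfolding x_def y_def using q0 P0 by (simp add: field_simps power2_eq_square power3_eq_cube)
  finally show ?thesis by (simp add: algebra_simps)
qed

text \<open>Let A be the product of p/(p+1) over the primes p dividing n. The divisor sum exceeds n^2 A,
while phi(n)/n is A times the product of the factors 1 - 1/p^2, which is at most its part for q and P. As A \<ge> q/(P+1),
the claim reduces to an inequality in q and P.\<close>
lemma square_over_largest_prime_less:
  fixes n q P :: nat
  assumes n: "n > 0" and q: "prime q" "q dvd n" and P: "prime P" "P dvd n" and qP: "q < P"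
    and least: "\<And>p. prime p \<Longrightarrow> p dvd n \<Longrightarrow> q \<le> p" and greatest: "\<And>p. prime p \<Longrightarrow> p dvd n \<Longrightarrow> p \<le> P"
  shows "(real n)\<^sup>2 / real P < noncyclic_bound real n q"
proof -
  let ?S = "prime_factors n"
  define A where "A = (\<Prod>p\<in>?S. real p / (real p + 1))"
  define x y where "x = 1 / real q" and "y = 1 / real P"
  have q2: "q \<ge> 2" using prime_ge_2_nat[OF q(1)] .
  have n1: "n > 1" using q n q2 by (auto dest: dvd_imp_le)
  have pS: "p \<ge> 2" if "p \<in> ?S" for p using that by (auto intro: prime_ge_2_nat)
  have qPS: "q \<in> ?S" "P \<in> ?S" using n q P by (auto simp: prime_factors_dvd)
  have A0: "A > 0" unfolding A_def using pS by (intro prod_pos) force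
  have A_ge: "real q / (real P + 1) \<le> A"
    unfolding A_def using least greatest qP q2 n
    by (intro prod_prime_ratio_ge) (auto simp: prime_factors_dvd simp del: in_prime_factors_iff)
  have tot: "real (totient n) = real n * A * (\<Prod>p\<in>?S. 1 - (1 / real p)\<^sup>2)"
  proof -
    have "1 - 1 / real p = real p / (real p + 1) * (1 - (1 / real p)\<^sup>2)" if "p \<in> ?S" for p
    proof -
      have "1 - (1 / real p)\<^sup>2 = (1 - 1 / real p) * (1 + 1 / real p)"
        by (simp add: power2_eq_square algebra_simps)
      also have "1 + 1 / real p = (real p + 1) / real p" using pS[OF that] by (simp add: field_simps)
      finally show ?thesis using pS[OF that] by simp
    qed
    then have "(\<Prod>p\<in>?S. 1 - 1 / real p) = A * (\<Prod>p\<in>?S. 1 - (1 / real p)\<^sup>2)"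
      unfolding A_def prod.distrib[symmetric] by (intro prod.cong) auto
    then show ?thesis by (simp add: totient_formula2)
  qed
  have R: "(\<Prod>p\<in>?S. 1 - (1 / real p)\<^sup>2) \<le> (1 - x\<^sup>2) * (1 - y\<^sup>2)"
  proof -
    have "(\<Prod>p\<in>?S. 1 - (1 / real p)\<^sup>2) \<le> (\<Prod>p\<in>{q, P}. 1 - (1 / real p)\<^sup>2)"
    proof (rule prod_subset_antimono)
      fix p assume "p \<in> ?S"
      then have "p \<ge> 2" using pS by blast
      then show "0 \<le> 1 - (1 / real p)\<^sup>2" by (simp add: power_le_one)
    qed (use qPS in auto)
    then show ?thesis using qP by (simp add: x_def y_def)
  qed
  have nq: "real (n div q) = real n * x" using q by (simp add: x_def real_of_nat_div)
  have x1: "0 < x" "x \<le> 1" using q2 by (auto simp: x_def)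
  have "x + x * y = (real P + 1) / (real q * real P)"
    using q2 qP by (simp add: x_def y_def field_simps)
  then have "real q / (real P + 1) * (x + x * y) = 1 / real P"
    using q2 by simp
  then have "(real n)\<^sup>2 / real P = (real n)\<^sup>2 * (real q / (real P + 1) * (x + x * y))"
    by simp
  also have "\<dots> \<le> (real n)\<^sup>2 * (A * (x + x * y))"
    using A_ge x1 by (intro mult_left_mono mult_right_mono) (auto simp: y_def)
  also have "\<dots> \<le> (real n)\<^sup>2 * (A * (1 - (1 - x) * ((1 - x\<^sup>2) * (1 - y\<^sup>2))))"
    using two_prime_inequality[OF q2 qP] A0 unfolding x_def[symmetric] y_def[symmetric]
    by (intro mult_left_mono) auto
  also have "\<dots> = (real n)\<^sup>2 * A - real n * (1 - x) * (real n * A * ((1 - x\<^sup>2) * (1 - y\<^sup>2)))"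
    by (simp add: algebra_simps power2_eq_square)
  also have "\<dots> \<le> (real n)\<^sup>2 * A - real n * (1 - x) * real (totient n)"
    unfolding tot using R A0 x1 by (intro diff_left_mono mult_left_mono) auto
  also have "\<dots> < divisor_sum real n - real n * (1 - x) * real (totient n)"
    using divisor_sum_id_gt[OF n1] by (simp add: A_def)
  also have "\<dots> = noncyclic_bound real n q"
    unfolding noncyclic_bound_def nq by (simp add: algebra_simps)
  finally show ?thesis .
qed

definition least_prime_divisor :: "nat \<Rightarrow> nat \<Rightarrow> bool" where
  "least_prime_divisor q n \<longleftrightarrow> prime q \<and> q dvd n \<and> (\<forall>p. prime p \<longrightarrow> p dvd n \<longrightarrow> q \<le> p)"

lemma least_prime_divisorD:
  assumes "least_prime_divisor q n"
  shows "prime q" "q dvd n" "\<And>p. prime p \<Longrightarrow> p dvd n \<Longrightarrow> q \<le> p"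
  using assms by (auto simp: least_prime_divisor_def)

lemma exists_second_prime_divisor:
  fixes q n :: nat
  assumes "n > 0" "\<And>p a. prime p \<Longrightarrow> n \<noteq> p ^ a" "prime q"
  obtains p where "prime p" "p dvd n" "p \<noteq> q"
proof -
  obtain m where m: "n = q ^ multiplicity q n * m" "\<not> q dvd m"
    using prime_power_decomposition[OF assms(3,1)] .
  then have "m \<noteq> 1" using assms(2,3) by (metis mult.right_neutral)
  then obtain p where "prime p" "p dvd m" using prime_factor_nat by blast
  then show ?thesis using that[of p] m by (metis dvd_mult)
qed

text \<open>If all cyclic subgroups have index at least P, the sum is at most n^2/P; a cyclic
subgroup of smaller index contains all P-elements.\<close>
lemma (in group) order_sum_dichotomy:
  assumes fin: "finite (carrier G)" and not_pp: "\<And>p a. prime p \<Longrightarrow> order G \<noteq> p ^ a"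
    and q: "least_prime_divisor q (order G)" and P: "prime P" "P dvd order G"
    and greatest: "\<And>p. prime p \<Longrightarrow> p dvd order G \<Longrightarrow> p \<le> P"
  shows "ord_sum real G < noncyclic_bound real (order G) q \<or> (\<exists>b m u. normal_cyclic_sylow G P b m u)"
proof (cases "\<exists>x\<in>carrier G. order G < P * ord x")
  case True
  then obtain x where x: "x \<in> carrier G" "order G < P * ord x" by blast
  have n0: "order G > 0" using fin by (simp add: order_gt_0_iff_finite)
  define b where "b = multiplicity P (order G)"
  obtain m where m: "order G = P ^ b * m" "\<not> P dvd m"
    using prime_power_decomposition[OF P(1) n0] unfolding b_def .
  have b0: "b > 0" using P n0 by (simp add: b_def prime_multiplicity_gt_zero_iff)
  obtain u where u: "u \<in> carrier G" "ord u = P ^ b"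
    using card_torsion_of_small_index(2)[OF fin P(1) m x] by blast
  have "normal_cyclic_sylow G P b m u"
    using card_torsion_of_small_index(1)[OF fin P(1) m x] fin P(1) b0 m u
    by unfold_locales auto
  then show ?thesis by blast
next
  case False
  have n0: "order G > 0" using fin by (simp add: order_gt_0_iff_finite)
  note q' = least_prime_divisorD[OF q]
  obtain p where "prime p" "p dvd order G" "p \<noteq> q"
    using exists_second_prime_divisor[OF n0 not_pp q'(1)] by blast
  then have qP: "q < P" using q'(3)[of p] greatest[of p] by simp
  have P0: "real P > 0" using prime_gt_0_nat[OF P(1)] by simp
  have "real (ord x) \<le> real (order G) / real P" if "x \<in> carrier G" for x
  proof -
    have "P * ord x \<le> order G" using False that by auto
    then have "real P * real (ord x) \<le> real (order G)" by (metis of_nat_le_iff of_nat_mult)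
    then show ?thesis using P0 by (simp add: field_simps)
  qed
  then have "ord_sum real G \<le> (\<Sum>x\<in>carrier G. real (order G) / real P)"
    unfolding ord_sum_def by (rule sum_mono)
  also have "\<dots> = (real (order G))\<^sup>2 / real P" by (simp add: order_def power2_eq_square)
  also have "\<dots> < noncyclic_bound real (order G) q"
    by (rule square_over_largest_prime_less[OF n0 q'(1,2) P qP q'(3) greatest])
  finally show ?thesis by blast
qed

section \<open>The product of the orders: counting solutions\<close>

text \<open>Factorize m = n / o' and note that r^k divides m exactly if o' divides n / r^k.\<close>
lemma ln_quotient_as_prime_power_sum:
  fixes n o' :: nat
  assumes n: "n > 0" and o': "o' dvd n"
  shows "ln (real o') = ln (real n) -
    (\<Sum>r\<in>prime_factors n. \<Sum>k\<in>{1..multiplicity r n}. if o' dvd n div r ^ k then ln (real r) else 0)"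
proof -
  obtain m where m: "n = o' * m" using o' by blast
  have pos: "o' > 0" "m > 0" using n m by auto
  have inner: "(\<Sum>k\<in>{1..multiplicity r n}. if o' dvd n div r ^ k then ln (real r) else 0) =
      real (multiplicity r m) * ln (real r)" if r: "r \<in> prime_factors n" for r
  proof -
    have pr: "prime r" using r by auto
    have r1: "r > 1" using prime_gt_1_nat[OF pr] .
    have "o' dvd n div r ^ k \<longleftrightarrow> k \<le> multiplicity r m" if k: "k \<in> {1..multiplicity r n}" for k
    proof -
      have "r ^ k dvd n" using k by (intro multiplicity_dvd') auto
      then have "o' dvd n div r ^ k \<longleftrightarrow> o' * r ^ k dvd o' * m"
        unfolding m[symmetric] using r1 by (subst dvd_div_iff_mult) auto
      also have "\<dots> \<longleftrightarrow> r ^ k dvd m" using pos by simp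
      also have "\<dots> \<longleftrightarrow> k \<le> multiplicity r m"
        using pos r1 by (subst power_dvd_iff_le_multiplicity) auto
      finally show ?thesis .
    qed
    then have "(\<Sum>k\<in>{1..multiplicity r n}. if o' dvd n div r ^ k then ln (real r) else 0) =
        (\<Sum>k\<in>{1..multiplicity r n}. if k \<le> multiplicity r m then ln (real r) else 0)"
      by (intro sum.cong) auto
    also have "\<dots> = (\<Sum>k\<in>{k \<in> {1..multiplicity r n}. k \<le> multiplicity r m}. ln (real r))"
      by (rule sum.inter_filter[symmetric]) simp
    also have "{k \<in> {1..multiplicity r n}. k \<le> multiplicity r m} = {1..multiplicity r m}"
      using dvd_imp_multiplicity_le[of m n r] m n by auto
    finally show ?thesis by simp
  qed
  have sub: "prime_factors m \<subseteq> prime_factors n" using m n by (intro dvd_prime_factors) auto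
  have "m = (\<Prod>r\<in>prime_factors m. r ^ multiplicity r m)"
    using pos by (simp add: prime_factorization_nat)
  then have "ln (real m) = ln (\<Prod>r\<in>prime_factors m. real r ^ multiplicity r m)"
    by (metis (no_types, lifting) of_nat_power of_nat_prod prod.cong)
  also have "\<dots> = (\<Sum>r\<in>prime_factors m. real (multiplicity r m) * ln (real r))"
    by (subst ln_prod) (auto simp: ln_realpow prime_gt_0_nat dest: in_prime_factors_imp_prime)
  also have "\<dots> = (\<Sum>r\<in>prime_factors n. real (multiplicity r m) * ln (real r))"
  proof (rule sum.mono_neutral_left[OF _ sub])
    show "\<forall>r\<in>prime_factors n - prime_factors m. real (multiplicity r m) * ln (real r) = 0"
      by (auto simp: prime_factors_multiplicity)
  qed simp
  also have "\<dots> = (\<Sum>r\<in>prime_factors n. \<Sum>k\<in>{1..multiplicity r n}. if o' dvd n div r ^ k then ln (real r) else 0)"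
    using inner by (intro sum.cong refl) simp
  finally have "ln (real m) = \<dots>" .
  moreover have "ln (real n) = ln (real o') + ln (real m)" using m pos by (simp add: ln_mult)
  ultimately show ?thesis by simp
qed

lemma (in group) ord_sum_ln:
  assumes fin: "finite (carrier G)"
  defines "n \<equiv> order G"
  shows "ord_sum (\<lambda>k. ln (real k)) G = real n * ln (real n) -
    (\<Sum>r\<in>prime_factors n. \<Sum>k\<in>{1..multiplicity r n}. ln (real r) * real (card (torsion G (n div r ^ k))))"
proof -
  have n0: "n > 0" using fin by (simp add: n_def order_gt_0_iff_finite)
  have "ord_sum (\<lambda>k. ln (real k)) G = (\<Sum>x\<in>carrier G. ln (real n) -
      (\<Sum>r\<in>prime_factors n. \<Sum>k\<in>{1..multiplicity r n}. if x \<in> torsion G (n div r ^ k) then ln (real r) else 0))"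
    unfolding ord_sum_def
  proof (rule sum.cong)
    fix x assume x: "x \<in> carrier G"
    have "ord x dvd n" using ord_dvd_group_order[OF x] by (simp add: n_def)
    from ln_quotient_as_prime_power_sum[OF n0 this]
    show "ln (real (ord x)) = ln (real n) -
      (\<Sum>r\<in>prime_factors n. \<Sum>k\<in>{1..multiplicity r n}. if x \<in> torsion G (n div r ^ k) then ln (real r) else 0)"
      using x by (simp add: in_torsion_iff)
  qed simp
  also have "\<dots> = real n * ln (real n) - (\<Sum>r\<in>prime_factors n. \<Sum>k\<in>{1..multiplicity r n}.
      \<Sum>x\<in>carrier G. if x \<in> torsion G (n div r ^ k) then ln (real r) else 0)"
    unfolding sum_subtractf
    by (simp add: order_def n_def sum.swap[of _ _ "carrier G"])
  also have "(\<Sum>r\<in>prime_factors n. \<Sum>k\<in>{1..multiplicity r n}.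
      \<Sum>x\<in>carrier G. if x \<in> torsion G (n div r ^ k) then ln (real r) else 0) =
      (\<Sum>r\<in>prime_factors n. \<Sum>k\<in>{1..multiplicity r n}. ln (real r) * real (card (torsion G (n div r ^ k))))"
    using fin torsion_subset
    by (intro sum.cong refl) (simp add: sum.inter_restrict[symmetric] Int_absorb1)
  finally show ?thesis .
qed

lemma (in group) card_torsion_cyclic:
  assumes fin: "finite (carrier G)" and cyc: "cyclic_group G" and d: "d dvd order G"
  shows "card (torsion G d) = d"
proof -
  have n0: "order G > 0" using fin by (simp add: order_gt_0_iff_finite)
  have "real (card (torsion G d)) = ord_sum (\<lambda>e. if e dvd d then 1 else 0) G"
    unfolding ord_sum_def using fin
    by (simp add: sum.inter_filter[symmetric] torsion_def pow_eq_id)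
      (intro arg_cong[of _ _ card], auto simp: pow_eq_id)
  also have "\<dots> = (\<Sum>e | e dvd order G. if e dvd d then real (totient e) else 0)"
    unfolding ord_sum_cyclic[OF fin cyc] divisor_sum_def by (intro sum.cong) auto
  also have "\<dots> = (\<Sum>e | e dvd d. real (totient e))"
    using n0 d by (subst sum.inter_filter[symmetric])
      (auto intro!: sum.cong intro: dvd_trans)
  also have "\<dots> = real d" using totient_divisor_sum[of d] by (metis of_nat_sum)
  finally show ?thesis by simp
qed

lemma totient_less_of_not_prime_power:
  fixes n p :: nat
  assumes p: "prime p" "p dvd n" and n: "n > 0" and not_pp: "\<And>a. n \<noteq> p ^ a"
  shows "totient n < n - n div p"
proof -
  define b where "b = multiplicity p n"
  obtain m where m: "n = p ^ b * m" "\<not> p dvd m"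
    using prime_power_decomposition[OF p(1) n] unfolding b_def .
  have b0: "b > 0" using p n by (simp add: b_def prime_multiplicity_gt_zero_iff)
  then obtain c where c: "b = Suc c" by (cases b) auto
  have m1: "m > 1" using m n not_pp[of b] by (cases "m = 0") auto
  have p1: "p > 1" using prime_gt_1_nat[OF p(1)] .
  have "totient n = totient (p ^ b) * totient m"
    unfolding m(1) by (rule totient_mult_coprime[OF prime_power_part_coprime[OF p(1) m(2)]])
  also have "\<dots> < totient (p ^ b) * m" using m1 p1 by (simp add: totient_less)
  also have "\<dots> = n - n div p"
    unfolding m(1) c totient_prime_power_Suc[OF p(1)] using p1
    by (simp add: algebra_simps diff_mult_distrib2)
  finally show ?thesis .
qed

text \<open>Expanding the logarithm expresses n ln n minus the sum as a combination, with nonnegative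
coefficients, of the numbers of solutions of x^(n / r^k) = 1. By Frobenius' theorem none of them is below
its value n / r^k for the cyclic group, and for r = p, k = 1 all n elements are solutions. That one term is worth
(n - n/p) ln p, more than the phi(n) ln q that is needed.\<close>
lemma (in group) ord_sum_ln_less_if_sylow_noncyclic:
  assumes fin: "finite (carrier G)" and p: "prime p" "p dvd order G"
    and all: "\<And>x. x \<in> carrier G \<Longrightarrow> ord x dvd order G div p"
    and q: "prime q" "q dvd order G" "q \<le> p" and not_pp: "\<And>a. order G \<noteq> p ^ a"
  shows "ord_sum (\<lambda>k. ln (real k)) G < noncyclic_bound (\<lambda>k. ln (real k)) (order G) q"
proof -
  define n where "n = order G"
  have n0: "n > 0" using fin by (simp add: n_def order_gt_0_iff_finite)
  let ?C = "integer_mod_group n"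
  let ?I = "Sigma (prime_factors n) (\<lambda>r. {1..multiplicity r n})"
  interpret C: group ?C by simp
  note Z = cyclic_integer_mod_group[OF n0]
  have div: "n div r ^ k dvd n" if "(r, k) \<in> ?I" for r k
  proof -
    have "r ^ k dvd n" using that by (auto simp: multiplicity_dvd')
    then have "n = r ^ k * (n div r ^ k)" by simp
    then show ?thesis by (metis dvd_triv_right)
  qed
  have G: "ord_sum (\<lambda>k. ln (real k)) G = real n * ln (real n) -
      (\<Sum>(r, k)\<in>?I. ln (real r) * real (card (torsion G (n div r ^ k))))"
    using ord_sum_ln[OF fin] by (simp add: n_def sum.Sigma)
  have "ord_sum (\<lambda>k. ln (real k)) ?C = real n * ln (real n) -
      (\<Sum>(r, k)\<in>?I. ln (real r) * real (card (torsion ?C (n div r ^ k))))"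
    using C.ord_sum_ln[OF Z(3)] Z(2) by (simp add: sum.Sigma)
  then have D: "divisor_sum (\<lambda>k. ln (real k)) n = real n * ln (real n) -
      (\<Sum>(r, k)\<in>?I. ln (real r) * real (n div r ^ k))"
    unfolding ord_sum_integer_mod_group[OF n0]
    using C.card_torsion_cyclic[OF Z(3,1)] Z(2) div by (simp add: case_prod_unfold cong: sum.cong)
  have "divisor_sum (\<lambda>k. ln (real k)) n - ord_sum (\<lambda>k. ln (real k)) G =
      (\<Sum>(r, k)\<in>?I. ln (real r) * (real (card (torsion G (n div r ^ k))) - real (n div r ^ k)))"
    unfolding G D by (simp add: case_prod_unfold sum_subtractf right_diff_distrib)
  also have "\<dots> \<ge> (\<Sum>(r, k)\<in>{(p, 1)}. ln (real r) * (real (card (torsion G (n div r ^ k))) - real (n div r ^ k)))"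
  proof (rule sum_mono2)
    show "finite ?I" by auto
    show "{(p, 1)} \<subseteq> ?I" using p n0 unfolding n_def
      by (auto simp: prime_factors_dvd Suc_le_eq prime_multiplicity_gt_zero_iff)
    fix s assume s: "s \<in> ?I - {(p, 1)}"
    then obtain r k where rk: "s = (r, k)" "(r, k) \<in> ?I" by (metis DiffD1 surj_pair)
    have "real (n div r ^ k) \<le> real (card (torsion G (n div r ^ k)))"
      using card_torsion_ge[OF fin, of "n div r ^ k"] div[OF rk(2)] by (simp add: n_def)
    moreover have "prime r" using rk(2) by auto
    then have "0 \<le> ln (real r)" using prime_gt_1_nat[of r] by simp
    ultimately show "0 \<le> (case s of (r, k) \<Rightarrow> ln (real r) * (real (card (torsion G (n div r ^ k))) - real (n div r ^ k)))"
      using rk(1) by simp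
  qed
  also have "torsion G (n div p) = carrier G"
    using all by (auto simp: in_torsion_iff n_def)
  then have "(\<Sum>(r, k)\<in>{(p, 1)}. ln (real r) * (real (card (torsion G (n div r ^ k))) - real (n div r ^ k))) =
      ln (real p) * (real n - real (n div p))"
    by (simp add: order_def n_def)
  finally have diff: "ln (real p) * (real n - real (n div p)) \<le>
      divisor_sum (\<lambda>k. ln (real k)) n - ord_sum (\<lambda>k. ln (real k)) G" .
  have "totient n < n - n div p"
    by (rule totient_less_of_not_prime_power) (use p n0 not_pp in \<open>auto simp: n_def\<close>)
  then have tot: "real (totient n) < real n - real (n div p)"
    by (simp add: of_nat_diff[symmetric] div_le_dividend del: of_nat_diff)
  have q0: "q > 0" "p > 1" using prime_gt_0_nat[OF q(1)] prime_gt_1_nat[OF p(1)] by auto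
  have "real (totient n) * (ln (real n) - ln (real (n div q))) = real (totient n) * ln (real q)"
  proof -
    have "real (n div q) = real n / real q" using q(2) by (simp add: n_def real_of_nat_div)
    then show ?thesis using n0 q0 by (simp add: ln_div)
  qed
  also have "\<dots> \<le> real (totient n) * ln (real p)"
    using q(3) q0 by (intro mult_left_mono) auto
  also have "\<dots> < (real n - real (n div p)) * ln (real p)"
    using tot q0 by (intro mult_strict_right_mono) auto
  finally show ?thesis using diff unfolding noncyclic_bound_def n_def by (simp add: mult.commute)
qed

text \<open>The hypothesis on d says that d collects the full powers of the largest primes dividing n,
possibly with a partial power of the smallest of these primes. The induction starts at d = n and divides by the
least prime r of the current value d r: the number of solutions of x^d = 1 is d k, and the d (r - k) > 0 solutions of
x^(d r) = 1 that are lost have order divisible by r, so that r - 1 divides d (r - k). As all primes dividing d are at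
least r, the numbers r - 1 and d are coprime, whence r - 1 divides r - k and k = 1.\<close>
lemma (in group) card_torsion_top_part:
  assumes fin: "finite (carrier G)"
    and full: "\<And>r. prime r \<Longrightarrow> r dvd order G \<Longrightarrow> \<exists>x\<in>carrier G. \<not> ord x dvd order G div r"
    and d: "d dvd order G" and top: "\<And>l l'. prime l \<Longrightarrow> l dvd d \<Longrightarrow> prime l' \<Longrightarrow> l' dvd order G div d \<Longrightarrow> l' \<le> l"
  shows "card (torsion G d) = d"
  using d top
proof (induction "order G div d" arbitrary: d rule: less_induct)
  case (less d)
  define n where "n = order G"
  have n0: "n > 0" using fin by (simp add: n_def order_gt_0_iff_finite)
  show ?case
  proof (cases "d = n")
    case True
    have "torsion G n = carrier G"
      using ord_dvd_group_order by (auto simp: in_torsion_iff n_def)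
    then show ?thesis using True by (simp add: n_def order_def)
  next
    case False
    obtain e where e: "n = d * e" using less.prems(1) by (auto simp: n_def)
    have d0: "d > 0" and e0: "e > 0" using e n0 by auto
    have nd: "order G div d = e" using e d0 by (simp add: n_def[symmetric])
    have "e \<noteq> 1" using e False by auto
    define r where "r = Max (prime_factors e)"
    have ne: "prime_factors e \<noteq> {}" using \<open>e \<noteq> 1\<close> e0 by (simp add: prime_factorization_empty_iff)
    have "r \<in> prime_factors e" unfolding r_def using ne by (intro Max_in) auto
    then have r: "prime r" "r dvd e" by auto
    have r_max: "l \<le> r" if "prime l" "l dvd e" for l
      unfolding r_def using that e0 by (intro Max_ge) (auto simp: prime_factors_dvd)
    obtain e' where e': "e = r * e'" using r by blast
    have r1: "r > 1" using prime_gt_1_nat[OF r(1)] .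
    have dr: "d * r dvd order G" using e e' by (simp add: n_def)
    have ndr: "order G div (d * r) = e'" using e e' d0 r1 by (simp add: n_def[symmetric])
    have IH: "card (torsion G (d * r)) = d * r"
    proof (rule less.hyps)
      show "order G div (d * r) < order G div d" unfolding ndr nd using e' e0 r1 by simp
      fix l l' assume l: "prime l" "l dvd d * r" and l': "prime l'" "l' dvd order G div (d * r)"
      have "l' dvd e" using l'(2) unfolding ndr e' by simp
      then have "l' \<le> r" using r_max l'(1) by blast
      show "l' \<le> l"
      proof (cases "l dvd d")
        case True
        then show ?thesis using less.prems(2)[OF l(1) _ l'(1)] \<open>l' dvd e\<close> nd by simp
      next
        case False
        then have "l dvd r" using l prime_dvd_mult_iff by blast
        then have "l = r" using l(1) r(1) primes_dvd_imp_eq by blast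
        then show ?thesis using \<open>l' \<le> r\<close> by simp
      qed
    qed (rule dr)
    obtain k where k: "card (torsion G d) = d * k"
      using frobenius_solutions[OF is_group fin less.prems(1)] by blast
    have k1: "k \<ge> 1" using card_torsion_ge[OF fin less.prems(1)] k d0 by (cases k) auto
    define S where "S = torsion G (d * r) - torsion G d"
    have sub: "torsion G d \<subseteq> torsion G (d * r)" by (auto simp: in_torsion_iff)
    have finT: "finite (torsion G j)" for j using fin torsion_subset finite_subset by blast
    have card_S: "card S = d * (r - k)"
      unfolding S_def using sub finT by (simp add: card_Diff_subset IH k diff_mult_distrib2)
    have "S \<noteq> {}"
    proof -
      obtain x where x: "x \<in> carrier G" "\<not> ord x dvd order G div r"
        using full[OF r(1)] r(2) e by (auto simp: n_def)
      define v where "v = multiplicity r (d * r)"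
      have v: "v = Suc (multiplicity r d)"
        unfolding v_def using r(1) d0 r1 by (simp add: prime_elem_multiplicity_mult_distrib)
      have "v \<le> multiplicity r (order G)"
        unfolding v_def using dr n0 by (intro dvd_imp_multiplicity_le) (auto simp: n_def)
      then have "r ^ v dvd ord x"
        using full_prime_power_dvd_ord[OF fin r(1) x] le_imp_power_dvd dvd_trans by blast
      then obtain y where y: "y \<in> carrier G" "ord y = r ^ v" by (rule exists_element_of_ord[OF fin x(1)])
      have "r ^ v dvd d * r" unfolding v_def by (rule multiplicity_dvd)
      moreover have "\<not> r ^ v dvd d"
        unfolding v using d0 r1 by (subst power_dvd_iff_le_multiplicity) auto
      ultimately have "y \<in> S" using y by (simp add: S_def in_torsion_iff)
      then show ?thesis by blast
    qed
    then have "card S > 0" using finT by (simp add: S_def card_gt_0_iff)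
    then have kr: "k < r" using card_S by (cases "k < r") auto
    have "r - 1 dvd card S"
    proof (rule totient_dvd_card[OF fin])
      show "S \<subseteq> carrier G" using torsion_subset by (auto simp: S_def)
    next
      fix x and j :: nat assume x: "x \<in> S" "coprime j (ord x)"
      then have "x \<in> carrier G" using torsion_subset by (auto simp: S_def)
      then show "x [^] j \<in> S" using ord_pow_coprime[OF fin _ x(2)] x(1) by (simp add: S_def in_torsion_iff)
    next
      fix x assume x: "x \<in> S"
      have "r dvd ord x"
      proof (rule ccontr)
        assume "\<not> r dvd ord x"
        then have "coprime (ord x) r" using r(1) by (simp add: prime_imp_coprime coprime_commute)
        then show False using x by (auto simp: S_def in_torsion_iff coprime_dvd_mult_left_iff)
      qed
      then have "totient r dvd totient (ord x)" by (rule totient_dvd)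
      then show "r - 1 dvd totient (ord x)" using r(1) by (simp add: totient_prime)
    qed
    moreover have "coprime (r - 1) d"
    proof (rule ccontr)
      assume "\<not> coprime (r - 1) d"
      then obtain l where l: "prime l" "l dvd r - 1" "l dvd d"
        by (metis coprime_iff_gcd_eq_1 prime_factor_nat gcd_greatest_iff)
      have "r \<le> l" using less.prems(2)[OF l(1,3) r(1)] r(2) nd by simp
      moreover have "l \<le> r - 1" using l(2) r1 by (intro dvd_imp_le) auto
      ultimately show False using r1 by simp
    qed
    ultimately have "r - 1 dvd r - k"
      unfolding card_S by (simp add: coprime_dvd_mult_right_iff)
    then have "r - 1 \<le> r - k" using kr by (intro dvd_imp_le) auto
    then have "k = 1" using k1 kr by simp
    then show ?thesis using k by simp
  qed
qed

text \<open>If every prime divisor of the order has a cyclic Sylow subgroup, the preceding lemma applies to the full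
power of the largest prime P.\<close>
lemma (in group) order_prod_dichotomy:
  assumes fin: "finite (carrier G)" and not_pp: "\<And>p a. prime p \<Longrightarrow> order G \<noteq> p ^ a"
    and q: "least_prime_divisor q (order G)" and P: "prime P" "P dvd order G"
    and greatest: "\<And>p. prime p \<Longrightarrow> p dvd order G \<Longrightarrow> p \<le> P"
  shows "ord_sum (\<lambda>k. ln (real k)) G < noncyclic_bound (\<lambda>k. ln (real k)) (order G) q \<or>
    (\<exists>b m u. normal_cyclic_sylow G P b m u)"
proof (cases "\<exists>p. prime p \<and> p dvd order G \<and> (\<forall>x\<in>carrier G. ord x dvd order G div p)")
  case True
  then show ?thesis
    using ord_sum_ln_less_if_sylow_noncyclic[OF fin _ _ _ least_prime_divisorD[OF q] not_pp] by blast
next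
  case False
  have n0: "order G > 0" using fin by (simp add: order_gt_0_iff_finite)
  define b where "b = multiplicity P (order G)"
  obtain m where m: "order G = P ^ b * m" "\<not> P dvd m"
    using prime_power_decomposition[OF P(1) n0] unfolding b_def .
  have b0: "b > 0" using P n0 by (simp add: b_def prime_multiplicity_gt_zero_iff)
  have P0: "P > 0" using prime_gt_0_nat[OF P(1)] .
  have card_P: "card (torsion G (P ^ b)) = P ^ b"
  proof (rule card_torsion_top_part[OF fin])
    fix l l' assume l: "prime l" "l dvd P ^ b" and l': "prime l'" "l' dvd order G div P ^ b"
    have "l = P" using l P(1) prime_dvd_power primes_dvd_imp_eq by blast
    moreover have "l' dvd order G" using l'(2) m(1) P0 by simp
    ultimately show "l' \<le> l" using greatest[OF l'(1)] by simp
  qed (use False m in auto)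
  obtain x where x: "x \<in> carrier G" "\<not> ord x dvd order G div P" using False P by blast
  have "P ^ b dvd ord x" unfolding b_def by (rule full_prime_power_dvd_ord[OF fin P(1) x])
  then obtain u where "u \<in> carrier G" "ord u = P ^ b" by (rule exists_element_of_ord[OF fin x(1)])
  then have "normal_cyclic_sylow G P b m u"
    using fin P(1) b0 m card_P by unfold_locales auto
  then show ?thesis by blast
qed

section \<open>Induction on the group order\<close>

text \<open>The second condition lets a bound for f on the quotient group be applied to
the rescaled functions d \<mapsto> f(k d).\<close>
definition affinely_scaling :: "(nat \<Rightarrow> real) \<Rightarrow> bool" where
  "affinely_scaling f \<longleftrightarrow> (\<forall>x y. 0 < x \<longrightarrow> x < y \<longrightarrow> f x < f y) \<and>
    (\<forall>k>0. \<exists>c\<ge>0. \<exists>e. \<forall>d>0. f (k * d) = c * f d + e)"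

lemma affinely_scaling_real: "affinely_scaling real"
  unfolding affinely_scaling_def
  by (intro conjI allI impI, simp) (rule_tac x = "real k" in exI, auto)

lemma affinely_scaling_ln: "affinely_scaling (\<lambda>k. ln (real k))"
  unfolding affinely_scaling_def
proof (intro conjI allI impI)
  fix k :: nat assume "k > 0"
  then show "\<exists>c\<ge>0. \<exists>e. \<forall>d>0. ln (real (k * d)) = c * ln (real d) + e"
    by (intro exI[of _ 1] conjI exI[of _ "ln (real k)"]) (auto simp: ln_mult)
qed auto

lemma divisor_sum_affine:
  assumes n: "n > 0" and f': "\<And>d. d > 0 \<Longrightarrow> f' d = c * f d + e"
  shows "divisor_sum f' n = c * divisor_sum f n + e * real n"
proof -
  have "divisor_sum f' n = (\<Sum>d | d dvd n. real (totient d) * (c * f d + e))"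
    unfolding divisor_sum_def using n f' by (intro sum.cong) (auto intro: dvd_pos_nat)
  also have "\<dots> = c * divisor_sum f n + e * (\<Sum>d | d dvd n. real (totient d))"
    by (simp add: divisor_sum_def algebra_simps sum.distrib sum_distrib_left)
  also have "(\<Sum>d | d dvd n. real (totient d)) = real n"
    using totient_divisor_sum[of n] by (metis of_nat_sum)
  finally show ?thesis .
qed

lemma noncyclic_bound_affine:
  assumes n: "n > 0" "q dvd n" and f': "\<And>d. d > 0 \<Longrightarrow> f' d = c * f d + e"
  shows "noncyclic_bound f' n q = c * noncyclic_bound f n q + e * real n"
proof -
  have "n div q > 0" using n by (auto elim!: dvdE)
  then show ?thesis
    unfolding noncyclic_bound_def using divisor_sum_affine[of n f' c f e, OF n(1) f'] n
    by (simp add: f' algebra_simps)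
qed

lemma (in group) ord_sum_affine:
  assumes fin: "finite (carrier G)" and f': "\<And>d. d > 0 \<Longrightarrow> f' d = c * f d + e"
  shows "ord_sum f' G = c * ord_sum f G + e * real (order G)"
proof -
  have "ord_sum f' G = (\<Sum>x\<in>carrier G. c * f (ord x) + e)"
    unfolding ord_sum_def using ord_ge_1[OF fin] by (intro sum.cong refl f') (simp add: Suc_le_eq)
  then show ?thesis by (simp add: ord_sum_def sum.distrib sum_distrib_left order_def mult.commute)
qed

text \<open>Prime powers are settled by Frobenius' theorem alone. Otherwise either the bound is strict already or there is a normal
cyclic Sylow subgroup for the largest prime P > q; the order of the quotient by it is again divisible by q, and
the induction applies to the quotient unless this is cyclic.\<close>
lemma noncyclic_ord_sum_nat:
  fixes G :: "nat monoid" and f :: "nat \<Rightarrow> real"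
  assumes f: "affinely_scaling f"
    and reduce: "\<And>(G :: nat monoid) q P. \<lbrakk>group G; finite (carrier G); \<And>p a. prime p \<Longrightarrow> order G \<noteq> p ^ a;
        least_prime_divisor q (order G); prime P; P dvd order G; \<And>p. prime p \<Longrightarrow> p dvd order G \<Longrightarrow> p \<le> P\<rbrakk>
      \<Longrightarrow> ord_sum f G < noncyclic_bound f (order G) q \<or> (\<exists>b m u. normal_cyclic_sylow G P b m u)"
    and G: "group G" "finite (carrier G)" "\<not> cyclic_group G" and q: "least_prime_divisor q (order G)"
  shows "ord_sum f G \<le> noncyclic_bound f (order G) q \<and>
    ((\<forall>p a. prime p \<longrightarrow> order G \<noteq> p ^ a) \<longrightarrow> ord_sum f G < noncyclic_bound f (order G) q)"
  using G q
proof (induction "order G" arbitrary: G rule: less_induct)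
  case (less G)
  interpret group G by fact
  note fin = \<open>finite (carrier G)\<close>
  have mono: "f x < f y" if "0 < x" "x < y" for x y using f that by (auto simp: affinely_scaling_def)
  have n0: "order G > 0" using fin by (simp add: order_gt_0_iff_finite)
  have q: "prime q" "q dvd order G" "\<And>p. prime p \<Longrightarrow> p dvd order G \<Longrightarrow> q \<le> p"
    using \<open>least_prime_divisor q (order G)\<close> by (auto simp: least_prime_divisor_def)
  have noncyclic: "ord z \<noteq> order G" if "z \<in> carrier G" for z
    using \<open>\<not> cyclic_group G\<close> cyclic_group_iff_ord[OF fin] that by blast
  show ?case
  proof (cases "\<exists>p a. prime p \<and> order G = p ^ a")
    case True
    then obtain p a where p: "prime p" "order G = p ^ a" by blast
    have "a > 0" using noncyclic_exponent_ge_2[OF p noncyclic] by simp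
    moreover have "q = p" using q(1,2) p prime_dvd_power primes_dvd_imp_eq by metis
    ultimately have "ord_sum f G \<le> noncyclic_bound f (order G) q"
      using ord_sum_prime_power_group(1)[OF fin p _ noncyclic mono] by simp
    then show ?thesis using True by blast
  next
    case False
    define P where "P = Max (prime_factors (order G))"
    have "q \<in> prime_factors (order G)" using q n0 by (simp add: prime_factors_dvd)
    then have "P \<in> prime_factors (order G)" unfolding P_def by (intro Max_in) auto
    then have P: "prime P" "P dvd order G" by auto
    have P_max: "p \<le> P" if "prime p" "p dvd order G" for p
      unfolding P_def using that n0 by (intro Max_ge) (auto simp: prime_factors_dvd)
    have "ord_sum f G < noncyclic_bound f (order G) q"
    proof (rule ccontr)
      assume not_less: "\<not> ?thesis"
      then obtain b m u where "normal_cyclic_sylow G P b m u"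
        using reduce[OF is_group fin _ \<open>least_prime_divisor q (order G)\<close> P P_max] False by blast
      then interpret S: normal_cyclic_sylow G P b m u .
      have P0: "P > 0" using prime_gt_0_nat[OF P(1)] .
      have "m \<noteq> 1"
      proof
        assume "m = 1"
        then have "order G = P ^ b" using S.order_eq by simp
        then show False using False P(1) by blast
      qed
      then obtain l where l: "prime l" "l dvd m" using prime_factor_nat by blast
      have "l \<noteq> P" using l S.m by auto
      moreover have "l dvd order G" using l S.order_eq by simp
      ultimately have qP: "q < P" using q(3)[OF l(1)] P_max[OF l(1)] by simp
      have qm: "q dvd m"
      proof -
        have "\<not> q dvd P ^ b" using qP q(1) P(1) prime_dvd_power primes_dvd_imp_eq by blast
        then show ?thesis using q(1,2) unfolding S.order_eq by (simp add: prime_dvd_mult_iff)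
      qed
      have quotient: "cyclic_group S.Q \<or> (\<forall>i\<le>b. ord_sum (\<lambda>d. f (P ^ i * d)) S.Q \<le>
          noncyclic_bound (\<lambda>d. f (P ^ i * d)) m q)"
      proof (cases "cyclic_group S.Q")
        case False
        obtain H :: "nat monoid" where H: "group H" "S.Q \<cong> H" "finite (carrier H)"
          using S.Q.finite_group_iso_nat[OF S.finite_Q] .
        have ordH: "order H = m"
          using iso_same_order H(2) S.order_Q unfolding is_iso_def by fastforce
        have "1 < P ^ b" using one_less_power[OF prime_gt_1_nat[OF P(1)] S.b] .
        then have "order H < order G" unfolding ordH S.order_eq using S.m0 by simp
        moreover have "\<not> cyclic_group H"
          using isomorphic_group_cyclicity[OF H(2) S.Q.is_group H(1)] False by simp
        moreover have "least_prime_divisor q (order H)"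
          using q qm S.order_eq by (auto simp: least_prime_divisor_def ordH)
        ultimately have IH: "ord_sum f H \<le> noncyclic_bound f m q"
          using less.hyps[of H] H ordH by blast
        have "ord_sum (\<lambda>d. f (P ^ i * d)) S.Q \<le> noncyclic_bound (\<lambda>d. f (P ^ i * d)) m q" for i
        proof -
          obtain c e where ce: "c \<ge> 0" "\<And>d. d > 0 \<Longrightarrow> f (P ^ i * d) = c * f d + e"
            using f P0 unfolding affinely_scaling_def by (metis zero_less_power)
          have "ord_sum (\<lambda>d. f (P ^ i * d)) S.Q = c * ord_sum f H + e * real m"
            using S.Q.ord_sum_affine[OF S.finite_Q, of "\<lambda>d. f (P ^ i * d)", OF ce(2)]
              S.Q.ord_sum_iso[OF H(2,1), of f] S.order_Q by simp
          also have "\<dots> \<le> c * noncyclic_bound f m q + e * real m"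
            using IH ce(1) by (simp add: mult_left_mono)
          also have "\<dots> = noncyclic_bound (\<lambda>d. f (P ^ i * d)) m q"
            using noncyclic_bound_affine[OF S.m0 qm, of "\<lambda>d. f (P ^ i * d)", OF ce(2)] by simp
          finally show ?thesis .
        qed
        then show ?thesis by simp
      qed simp
      have "ord_sum f G < noncyclic_bound f (order G) q"
        by (rule S.ord_sum_less[OF mono prime_gt_1_nat[OF q(1)] qP qm noncyclic quotient])
      then show False using not_less by simp
    qed
    then show ?thesis by simp
  qed
qed

lemma (in group) noncyclic_ord_sum:
  assumes fin: "finite (carrier G)" and noncyclic: "\<not> cyclic_group G"
    and q: "least_prime_divisor q (order G)" and f: "f = real \<or> f = (\<lambda>k. ln (real k))"
  shows "ord_sum f G \<le> noncyclic_bound f (order G) q"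
    "(\<And>p a. prime p \<Longrightarrow> order G \<noteq> p ^ a) \<Longrightarrow> ord_sum f G < noncyclic_bound f (order G) q"
proof -
  obtain H :: "nat monoid" where H: "group H" "G \<cong> H" "finite (carrier H)"
    using finite_group_iso_nat[OF fin] .
  have ordH: "order H = order G" using H(2) unfolding is_iso_def by (auto dest: iso_same_order)
  have ncH: "\<not> cyclic_group H" using isomorphic_group_cyclicity[OF H(2) is_group H(1)] noncyclic by simp
  have scaling: "affinely_scaling f" using f affinely_scaling_real affinely_scaling_ln by blast
  have qH: "least_prime_divisor q (order H)" using q ordH by simp
  have "ord_sum f H \<le> noncyclic_bound f (order H) q \<and>
    ((\<forall>p a. prime p \<longrightarrow> order H \<noteq> p ^ a) \<longrightarrow> ord_sum f H < noncyclic_bound f (order H) q)"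
  proof (rule noncyclic_ord_sum_nat[OF scaling _ H(1,3) ncH qH])
    fix K :: "nat monoid" and r P
    assume K: "group K" "finite (carrier K)" "\<And>p a. prime p \<Longrightarrow> order K \<noteq> p ^ a"
      "least_prime_divisor r (order K)" "prime P" "P dvd order K" "\<And>p. prime p \<Longrightarrow> p dvd order K \<Longrightarrow> p \<le> P"
    from f show "ord_sum f K < noncyclic_bound f (order K) r \<or> (\<exists>b m u. normal_cyclic_sylow K P b m u)"
    proof
      assume "f = real"
      then show ?thesis using group.order_sum_dichotomy[OF K] by blast
    next
      assume "f = (\<lambda>k. ln (real k))"
      then show ?thesis using group.order_prod_dichotomy[OF K] by blast
    qed
  qed
  then show "ord_sum f G \<le> noncyclic_bound f (order G) q"
    "(\<And>p a. prime p \<Longrightarrow> order G \<noteq> p ^ a) \<Longrightarrow> ord_sum f G < noncyclic_bound f (order G) q"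
    using ord_sum_iso[OF H(2,1), of f] ordH by auto
qed

text \<open>Equality forces the order to be a prime power p^a, and then it means that
x^(p^i) = 1 has exactly p^i solutions for all i < a - 1. For order p^2 the condition only concerns i = 0, and for the
quaternion group it says that there is a single element of order 2.\<close>
lemma (in group) noncyclic_ord_sum_eq_iff:
  assumes fin: "finite (carrier G)" and noncyclic: "\<not> cyclic_group G"
    and q: "least_prime_divisor q (order G)" and f: "f = real \<or> f = (\<lambda>k. ln (real k))"
  shows "ord_sum f G = noncyclic_bound f (order G) q \<longleftrightarrow>
    G \<cong> integer_mod_group q \<times>\<times> integer_mod_group q \<or> G \<cong> quaternion_group" (is "?L \<longleftrightarrow> ?R")
proof -
  have nc: "ord z \<noteq> order G" if "z \<in> carrier G" for z
    using noncyclic cyclic_group_iff_ord[OF fin] that by blast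
  have mono: "f x < f y" if "0 < x" "x < y" for x y using f that by auto
  have q0: "q > 0" using least_prime_divisorD(1)[OF q] prime_gt_0_nat by blast
  have order_ZZ: "order G = q ^ 2" if "G \<cong> integer_mod_group q \<times>\<times> integer_mod_group q"
  proof -
    have "order G = order (integer_mod_group q \<times>\<times> integer_mod_group q)"
      using that unfolding is_iso_def by (auto dest: iso_same_order)
    then show ?thesis
      using q0 by (simp add: order_def DirProd_def carrier_integer_mod_group power2_eq_square)
  qed
  have order_Q8: "order G = 2 ^ 3" if "G \<cong> quaternion_group"
    using that order_quaternion_group unfolding is_iso_def by (auto dest!: iso_same_order)
  show ?thesis
  proof (cases "\<exists>p a. prime p \<and> order G = p ^ a")
    case False
    have "ord_sum f G < noncyclic_bound f (order G) q"
      by (rule noncyclic_ord_sum(2)[OF assms]) (use False in blast)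
    then have "\<not> ?L" by simp
    moreover have "\<not> ?R"
      using False order_ZZ order_Q8 least_prime_divisorD(1)[OF q] two_is_prime_nat by blast
    ultimately show ?thesis by blast
  next
    case True
    then obtain p a where p: "prime p" and ord_G: "order G = p ^ a" by blast
    have a2: "a \<ge> 2" by (rule noncyclic_exponent_ge_2[OF p ord_G nc])
    have "q = p"
      using least_prime_divisorD(1,2)[OF q] p prime_dvd_power primes_dvd_imp_eq unfolding ord_G by metis
    have L: "?L \<longleftrightarrow> (\<forall>i<a - 1. card (torsion G (p ^ i)) = p ^ i)"
      using ord_sum_prime_power_group(2)[OF fin p ord_G _ nc mono] a2
      by (simp add: \<open>q = p\<close>)
    show ?thesis
    proof
      assume ?L
      obtain c where c: "a = Suc (Suc c)" using a2 by (metis add_2_eq_Suc le_Suc_ex)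
      have "few_small_orders G p c"
      proof
        show "order G = p ^ Suc (Suc c)" using ord_G c by simp
        show "card (torsion G (p ^ i)) = p ^ i" if "i \<le> c" for i
          using L \<open>?L\<close> that c by simp
      qed (fact fin p nc)+
      then show ?R using few_small_orders.iso_elementary_abelian_or_quaternion \<open>q = p\<close> by blast
    next
      assume R: ?R
      have t1: "card (torsion G 1) = 1"
      proof -
        have "torsion G 1 = {\<one>}" by (auto simp: torsion_def)
        then show ?thesis by simp
      qed
      show ?L
        unfolding L
      proof (intro allI impI)
        fix i assume i: "i < a - 1"
        consider "G \<cong> integer_mod_group q \<times>\<times> integer_mod_group q" | "G \<cong> quaternion_group" using R by blast
        then show "card (torsion G (p ^ i)) = p ^ i"
        proof cases
          case 1
          then have "p ^ a = p ^ 2" using order_ZZ ord_G \<open>q = p\<close> by simp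
          then have "a = 2" using prime_gt_1_nat[OF p] by simp
          then show ?thesis using i t1 by simp
        next
          case 2
          then have eq: "p ^ a = 2 ^ 3" using order_Q8 ord_G by simp
          then have "p dvd 2 ^ 3" using a2 by (metis dvd_power gr0I not_numeral_le_zero)
          then have p2: "p = 2" using p by (metis prime_dvd_power primes_dvd_imp_eq two_is_prime_nat)
          then have "a = 3" using eq power_inject_exp[of "2::nat" a 3] by simp
          then have "i = 0 \<or> i = 1" using i by auto
          then show ?thesis
            using t1 p2 card_torsion_iso[OF 2 group_quaternion_group, of 2] card_involutions_quaternion_group
            by auto
        qed
      qed
    qed
  qed
qed

lemma (in group) order_sum_eq: "real (order_sum G) = ord_sum real G"
  by (simp add: order_sum_def ord_sum_def)

lemma (in group) ln_order_prod:
  assumes fin: "finite (carrier G)"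
  shows "order_prod G > 0" "ln (real (order_prod G)) = ord_sum (\<lambda>k. ln (real k)) G"
proof -
  have pos: "ord x > 0" if "x \<in> carrier G" for x using ord_ge_1[OF fin that] by simp
  then show "order_prod G > 0" by (auto simp: order_prod_def intro: prod_pos)
  show "ln (real (order_prod G)) = ord_sum (\<lambda>k. ln (real k)) G"
    unfolding order_prod_def ord_sum_def of_nat_prod using pos fin by (subst ln_prod) auto
qed

theorem theorem5p3:
  fixes G :: "('a, 'b) monoid_scheme" and n q :: nat
  assumes "group G" and "finite (carrier G)" and "\<not> cyclic_group G"
    and "n = order G"
    and "prime q" and "q dvd n" and "\<And>p. prime p \<Longrightarrow> p dvd n \<Longrightarrow> q \<le> p"
  shows
    "real (order_prod G)
       \<le> real q powi (- int (totient n)) * real (order_prod (integer_mod_group n))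
     \<and> real (order_sum G)
       \<le> real (order_sum (integer_mod_group n)) - real n * real (totient n) * (real q - 1) / real q
     \<and> (real (order_prod G)
          = real q powi (- int (totient n)) * real (order_prod (integer_mod_group n))
        \<longleftrightarrow> G \<cong> integer_mod_group q \<times>\<times> integer_mod_group q \<or> G \<cong> quaternion_group)
     \<and> (real (order_sum G)
          = real (order_sum (integer_mod_group n)) - real n * real (totient n) * (real q - 1) / real q
        \<longleftrightarrow> G \<cong> integer_mod_group q \<times>\<times> integer_mod_group q \<or> G \<cong> quaternion_group)"
proof -
  interpret group G by fact
  interpret C: group "integer_mod_group n" by simp
  have n0: "n > 0" using assms(2,4) by (simp add: order_gt_0_iff_finite)
  have q0: "q > 0" using prime_gt_0_nat[OF assms(5)] .
  have q: "least_prime_divisor q (order G)"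
    using assms(4-7) by (simp add: least_prime_divisor_def)
  have nq: "real (n div q) = real n / real q" using assms(6) by (simp add: real_of_nat_div)
  note Z = cyclic_integer_mod_group[OF n0]
  have sum_rhs: "real (order_sum (integer_mod_group n)) - real n * real (totient n) * (real q - 1) / real q =
      noncyclic_bound real (order G) q"
    unfolding C.order_sum_eq ord_sum_integer_mod_group[OF n0] noncyclic_bound_def assms(4)[symmetric] nq
    using q0 by (simp add: field_simps)
  let ?R = "real q powi (- int (totient n)) * real (order_prod (integer_mod_group n))"
  have R0: "?R > 0" using C.ln_order_prod(1)[OF Z(3)] q0 by simp
  have "ln ?R = - real (totient n) * ln (real q) + divisor_sum (\<lambda>k. ln (real k)) n"
    using C.ln_order_prod[OF Z(3)] q0 ord_sum_integer_mod_group[OF n0, of "\<lambda>k. ln (real k)"]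
    by (simp add: ln_mult power_int_minus ln_inverse ln_realpow)
  also have "\<dots> = noncyclic_bound (\<lambda>k. ln (real k)) (order G) q"
    unfolding noncyclic_bound_def assms(4)[symmetric] nq using n0 q0 by (simp add: ln_div)
  finally have prod_rhs: "ln ?R = noncyclic_bound (\<lambda>k. ln (real k)) (order G) q" .
  note P = ln_order_prod[OF assms(2)]
  have "real (order_prod G) \<le> ?R \<longleftrightarrow> ln (real (order_prod G)) \<le> ln ?R"
    using P(1) R0 by (simp only: ln_le_cancel_iff of_nat_0_less_iff)
  moreover have "real (order_prod G) = ?R \<longleftrightarrow> ln (real (order_prod G)) = ln ?R"
    using P(1) R0 by (simp only: ln_inj_iff of_nat_0_less_iff)
  ultimately show ?thesis
    unfolding sum_rhs order_sum_eq prod_rhs P(2)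
    using noncyclic_ord_sum(1)[OF assms(2,3) q] noncyclic_ord_sum_eq_iff[OF assms(2,3) q] by blast
qed

end
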